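(* Let $\omega$ be a weight on $\mathbf R^{2d}\simeq \mathbf C^d$ and let $\Phi_1,\Phi_2$ be quasi-Young functions of order $r_0\in(0,1]$. Then the following is true: (1) $A^{\Phi_1,\Phi_2}_{(\omega)}(\mathbf C^d)$, $B^{\Phi_1,\Phi_2}_{(\omega)}(\mathbf C^d)$ and $M^{\Phi_1,\Phi_2}_{(\omega)}(\mathbf R^d)$ are quasi-Banach spaces of order $r_0$; (2) the Bargmann transform $\mathfrak V_d$ is isometric and bijective from $M^{\Phi_1,\Phi_2}_{(\omega)}(\mathbf R^d)$ to $A^{\Phi_1,\Phi_2}_{(\omega)}(\mathbf C^d)$.
   Context: Weight: a weight on $\mathbf R^{n}$ is a positive function $\omega\in L^\infty_{loc}(\mathbf R^n)$ with $1/\omega\in L^\infty_{loc}(\mathbf R^n)$. Quasi-Banach space of order $r_0$: a complete complex vector space with a functional $\|\cdot\|\ge 0$ that is absolutely homogeneous, vanishes only at $0$, and satisfies $\|f+g\|\le 2^{\frac1{r_0}-1}(\|f\|+\|g\|)$ (and, by the paper's convention, also $\|f+g\|^{r_0}\le\|f\|^{r_0}+\|g\|^{r_0}$). Young functions: a Young function is a convex $\Phi_0:[0,\infty)\to[0,\infty]$ with $\Phi_0(0)=0$ and $\lim_{t\to\infty}\Phi_0(t)=\infty$. A quasi-Young function of order $r_0\in(0,1]$ is a function $\Phi(t)=\Phi_0(t^{r_0})$, $t\ge0$, with $\Phi_0$ a Young function. Orlicz quasi-norms (Lebesgue measure): $\|f\|_{L^{\Phi}(\mathbf R^d)}=\inf\{\lambda>0: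 \int_{\mathbf R^d}\Phi(|f(x)|/\lambda)\,dx\le1\}$ and $\|F\|_{L^{\Phi_1,\Phi_2}_{(\omega)}(\mathbf R^{2d})}=\|F_{1}\|_{L^{\Phi_2}(\mathbf R^d)}$, $F_{1}(\xi)=\|F(\cdot,\xi)\omega(\cdot,\xi)\|_{L^{\Phi_1}(\mathbf R^d)}$. Functions equal a.e. are identified. Pilipović space: $\mathcal H_\flat(\mathbf R^d)$ is the set of Hermite series $f=\sum_{\alpha\in\mathbf N^d}c_f(\alpha)h_\alpha$ with $|c_f(\alpha)|\lesssim r^{|\alpha|}\alpha!^{-1/2}$ for some $r>0$; $\mathcal H_\flat'(\mathbf R^d)$ is the set of formal series with $|c_f(\alpha)|\lesssim r^{|\alpha|}\alpha!^{1/2}$ for every $r>0$. Here $h_\alpha(x)=\pi^{-d/4}(-1)^{|\alpha|}(2^{|\alpha|}\alpha!)^{-1/2}e^{|x|^2/2}\partial^\alpha e^{-|x|^2}$. The space $\mathcal H_\flat'$ is the dual of $\mathcal H_\flat$ through the extension $(f,g)=\sum_\alpha c_f(\alpha)\overline{c_g(\alpha)}$ of the $L^2$-form. Orlicz modulation space: let $\phi(x)=\pi^{-d/4}e^{-|x|^2/2}$. For $f\in\mathcal H'_\flat(\mathbf R^d)$, $V_\phi f(x,\xi)=(2\pi)^{-d/2}(f,e^{i\langle\cdot,\xi\rangle}\phi(\cdot-x))$, a smooth function on $\mathbf R^{2d}$. Then $M^{\Phi_1,\Phi_2}_{(\omega)}(\mathbf R^d)=\{f\in\mathcal H'_\flat(\mathbf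 R^d): V_\phi f\in L^{\Phi_1,\Phi_2}_{(\omega)}(\mathbf R^{2d})\}$ with quasi-norm $\|f\|_{M^{\Phi_1,\Phi_2}_{(\omega)}}=\|V_\phi f\|_{L^{\Phi_1,\Phi_2}_{(\omega)}}$. Bargmann transform: $(\mathfrak V_df)(z)=\langle f,\mathfrak A_d(z,\cdot)\rangle$ with $\mathfrak A_d(z,y)=\pi^{-d/4}\exp(-\frac12(\langle z,z\rangle+|y|^2)+2^{1/2}\langle z,y\rangle)$, $\langle z,w\rangle=\sum_{j=1}^d z_jw_j$; it is a bijection from $\mathcal H_\flat'(\mathbf R^d)$ to the set $A(\mathbf C^d)$ of entire functions on $\mathbf C^d$ (uniquely extending its definition on $L^2(\mathbf R^d)$). Bargmann-type spaces: $B^{\Phi_1,\Phi_2}_{(\omega)}(\mathbf C^d)$ is the set of measurable $F$ on $\mathbf C^d$ with $\|F\|_{B^{\Phi_1,\Phi_2}_{(\omega)}}=\|F_{\Phi_1,\omega}\|_{L^{\Phi_2}(\mathbf R^d)}<\infty$, where $F_{\Phi_1,\omega}(\xi)=(2\pi)^{-d/2}e^{-\frac14|\xi|^2}\big\|e^{-\frac14|\cdot|^2}F(2^{-1/2}(\cdot-i\xi))\,\omega(\cdot,\xi)\big\|_{L^{\Phi_1}(\mathbf R^d)}$, and $A^{\Phi_1,\Phi_2}_{(\omega)}(\mathbf C^d)=B^{\Phi_1,\Phi_2}_{(\omega)}(\mathbf C^d)\cap A(\mathbf C^d)$ with the inherited quasi-norm. *)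

theory Defs
  imports "HOL-Analysis.Analysis" "HOL-Library.Function_Algebras"
begin

section \<open>Weights and quasi-Young functions\<close>

definition Linf_loc :: "('a::euclidean_space \<Rightarrow> real) \<Rightarrow> bool" where
  "Linf_loc g \<longleftrightarrow> g \<in> borel_measurable lebesgue \<and>
     (\<forall>K. compact K \<longrightarrow> (\<exists>C. AE x in lebesgue. x \<in> K \<longrightarrow> \<bar>g x\<bar> \<le> C))"

definition weight :: "('a::euclidean_space \<Rightarrow> real) \<Rightarrow> bool" where
  "weight \<omega> \<longleftrightarrow> (\<forall>x. \<omega> x > 0) \<and> Linf_loc \<omega> \<and> Linf_loc (\<lambda>x. 1 / \<omega> x)"

text \<open>Functions on \<open>[0,\<infinity>)\<close> with values in \<open>[0,\<infinity>]\<close> are modelled with type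
  \<open>real \<Rightarrow> ennreal\<close>; the values at negative arguments are never used.\<close>

definition young :: "(real \<Rightarrow> ennreal) \<Rightarrow> bool" where
  "young \<Phi> \<longleftrightarrow>
     (\<forall>s\<ge>0. \<forall>t\<ge>0. \<forall>\<theta>\<in>{0..1}.
        \<Phi> ((1 - \<theta>) * s + \<theta> * t) \<le> ennreal (1 - \<theta>) * \<Phi> s + ennreal \<theta> * \<Phi> t) \<and>
     \<Phi> 0 = 0 \<and> (\<Phi> \<longlongrightarrow> \<infinity>) at_top"

definition quasi_young :: "real \<Rightarrow> (real \<Rightarrow> ennreal) \<Rightarrow> bool" where
  "quasi_young r\<^sub>0 \<Phi> \<longleftrightarrow> (\<exists>\<Phi>\<^sub>0. young \<Phi>\<^sub>0 \<and> (\<forall>t\<ge>0. \<Phi> t = \<Phi>\<^sub>0 (t powr r\<^sub>0)))"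

section \<open>Orlicz quasi-norms\<close>

text \<open>The inner quasi-norm in a mixed Orlicz space may be infinite, so the Orlicz quasi-norm
  is defined for functions with values in \<open>[0,\<infinity>]\<close> (the moduli), with
  \<open>\<Phi>(\<infinity>) = lim\<^bsub>t\<rightarrow>\<infinity>\<^esub> \<Phi>(t) = \<infinity>\<close>. The infimum of the empty set is \<open>\<infinity>\<close>.\<close>

definition at_ennreal :: "(real \<Rightarrow> ennreal) \<Rightarrow> ennreal \<Rightarrow> ennreal" where
  "at_ennreal \<Phi> t = (if t = \<infinity> then \<infinity> else \<Phi> (enn2real t))"

definition orlicz_norm :: "(real \<Rightarrow> ennreal) \<Rightarrow> ('a::euclidean_space \<Rightarrow> ennreal) \<Rightarrow> ennreal" where
  "orlicz_norm \<Phi> g =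
     (INF a\<in>{a::real. 0 < a \<and> (\<integral>\<^sup>+x. at_ennreal \<Phi> (g x / ennreal a) \<partial>lebesgue) \<le> 1}. ennreal a)"

definition mixed_norm ::
  "(real \<Rightarrow> ennreal) \<Rightarrow> (real \<Rightarrow> ennreal) \<Rightarrow> ((real^'d) \<times> (real^'d) \<Rightarrow> real) \<Rightarrow>
   ((real^'d) \<times> (real^'d) \<Rightarrow> complex) \<Rightarrow> ennreal" where
  "mixed_norm \<Phi>1 \<Phi>2 \<omega> F =
     orlicz_norm \<Phi>2 (\<lambda>\<xi>. orlicz_norm \<Phi>1 (\<lambda>x. ennreal (cmod (F (x, \<xi>) * of_real (\<omega> (x, \<xi>))))))"

definition mixed_space ::
  "(real \<Rightarrow> ennreal) \<Rightarrow> (real \<Rightarrow> ennreal) \<Rightarrow> ((real^'d) \<times> (real^'d) \<Rightarrow> real) \<Rightarrow>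
   ((real^'d) \<times> (real^'d) \<Rightarrow> complex) set" where
  "mixed_space \<Phi>1 \<Phi>2 \<omega> = {F \<in> borel_measurable lebesgue. mixed_norm \<Phi>1 \<Phi>2 \<omega> F < \<infinity>}"

section \<open>Hermite functions and the distribution space \<open>H\<^sub>\<flat>'\<close>\<close>

definition mi_abs :: "nat^'d \<Rightarrow> nat" where
  "mi_abs \<alpha> = (\<Sum>j\<in>UNIV. \<alpha> $ j)"

definition mi_fact :: "nat^'d \<Rightarrow> real" where
  "mi_fact \<alpha> = (\<Prod>j\<in>UNIV. fact (\<alpha> $ j))"

definition partial_deriv :: "'d \<Rightarrow> (real^'d \<Rightarrow> real) \<Rightarrow> real^'d \<Rightarrow> real" where
  "partial_deriv j f x = deriv (\<lambda>t. f (x + t *\<^sub>R axis j 1)) 0"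

text \<open>\<open>\<partial>\<^sup>\<alpha>\<close>. An arbitrary enumeration of the coordinates fixes the order of differentiation;
  for the smooth functions considered here the order is irrelevant.\<close>

definition mi_deriv :: "nat^'d \<Rightarrow> (real^'d \<Rightarrow> real) \<Rightarrow> real^'d \<Rightarrow> real" where
  "mi_deriv \<alpha> f = foldr (\<lambda>j. partial_deriv j ^^ (\<alpha> $ j)) (SOME js. distinct js \<and> set js = UNIV) f"

definition hermite_fun :: "nat^'d \<Rightarrow> real^'d \<Rightarrow> real" where
  "hermite_fun \<alpha> x = pi powr (- (real CARD('d) / 4)) * (-1) ^ mi_abs \<alpha> *
     (2 ^ mi_abs \<alpha> * mi_fact \<alpha>) powr (- (1/2)) * exp ((norm x)\<^sup>2 / 2) *
     mi_deriv \<alpha> (\<lambda>y. exp (- (norm y)\<^sup>2)) x"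

text \<open>A formal Hermite series \<open>\<Sum>\<^sub>\<alpha> c(\<alpha>) h\<^sub>\<alpha>\<close> is its coefficient family \<open>c\<close>.\<close>

definition H_flat_dual :: "(nat^'d \<Rightarrow> complex) set" where
  "H_flat_dual = {c. \<forall>r>0. \<exists>C. \<forall>\<alpha>. cmod (c \<alpha>) \<le> C * r ^ mi_abs \<alpha> * sqrt (mi_fact \<alpha>)}"

text \<open>The Hermite coefficients \<open>c\<^sub>g(\<alpha>) = (g, h\<^sub>\<alpha>)\<close>, with the \<open>L\<^sup>2\<close> scalar product,
  of a test function \<open>g \<in> H\<^sub>\<flat>\<close>.\<close>

definition hermite_coeff :: "(real^'d \<Rightarrow> complex) \<Rightarrow> nat^'d \<Rightarrow> complex" where
  "hermite_coeff g \<alpha> = (LINT y|lebesgue. g y * of_real (hermite_fun \<alpha> y))"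

text \<open>The sesquilinear pairing \<open>(f, g)\<close> and the bilinear pairing \<open>\<langle>f, g\<rangle>\<close>
  of \<open>f \<in> H\<^sub>\<flat>'\<close> with \<open>g \<in> H\<^sub>\<flat>\<close>.\<close>

definition sesq_pairing :: "(nat^'d \<Rightarrow> complex) \<Rightarrow> (real^'d \<Rightarrow> complex) \<Rightarrow> complex" where
  "sesq_pairing c g = (\<Sum>\<^sub>\<infinity>\<alpha>. c \<alpha> * cnj (hermite_coeff g \<alpha>))"

definition bil_pairing :: "(nat^'d \<Rightarrow> complex) \<Rightarrow> (real^'d \<Rightarrow> complex) \<Rightarrow> complex" where
  "bil_pairing c g = sesq_pairing c (\<lambda>y. cnj (g y))"

section \<open>Orlicz modulation spaces\<close>

definition gauss :: "real^'d \<Rightarrow> real" where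
  "gauss x = pi powr (- (real CARD('d) / 4)) * exp (- (norm x)\<^sup>2 / 2)"

definition stft :: "(nat^'d \<Rightarrow> complex) \<Rightarrow> (real^'d) \<times> (real^'d) \<Rightarrow> complex" where
  "stft c = (\<lambda>(x, \<xi>). of_real ((2 * pi) powr (- (real CARD('d) / 2))) *
     sesq_pairing c (\<lambda>y. exp (\<i> * of_real (y \<bullet> \<xi>)) * of_real (gauss (y - x))))"

definition M_space ::
  "(real \<Rightarrow> ennreal) \<Rightarrow> (real \<Rightarrow> ennreal) \<Rightarrow> ((real^'d) \<times> (real^'d) \<Rightarrow> real) \<Rightarrow>
   (nat^'d \<Rightarrow> complex) set" where
  "M_space \<Phi>1 \<Phi>2 \<omega> = {c \<in> H_flat_dual. stft c \<in> mixed_space \<Phi>1 \<Phi>2 \<omega>}"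

definition M_norm ::
  "(real \<Rightarrow> ennreal) \<Rightarrow> (real \<Rightarrow> ennreal) \<Rightarrow> ((real^'d) \<times> (real^'d) \<Rightarrow> real) \<Rightarrow>
   (nat^'d \<Rightarrow> complex) \<Rightarrow> ennreal" where
  "M_norm \<Phi>1 \<Phi>2 \<omega> c = mixed_norm \<Phi>1 \<Phi>2 \<omega> (stft c)"

section \<open>The Bargmann transform and Bargmann-type spaces\<close>

definition bil :: "complex^'d \<Rightarrow> complex^'d \<Rightarrow> complex" where
  "bil z w = (\<Sum>j\<in>UNIV. z $ j * w $ j)"

definition cvec :: "real^'d \<Rightarrow> complex^'d" where
  "cvec x = (\<chi> j. of_real (x $ j))"

definition bargmann_kernel :: "complex^'d \<Rightarrow> real^'d \<Rightarrow> complex" where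
  "bargmann_kernel z y = of_real (pi powr (- (real CARD('d) / 4))) *
     exp (- (1/2) * (bil z z + of_real ((norm y)\<^sup>2)) + of_real (sqrt 2) * bil z (cvec y))"

definition bargmann :: "(nat^'d \<Rightarrow> complex) \<Rightarrow> complex^'d \<Rightarrow> complex" where
  "bargmann c z = bil_pairing c (bargmann_kernel z)"

text \<open>Holomorphy in several variables: real Frechet differentiability with a complex-linear
  derivative.\<close>

definition entire :: "(complex^'d \<Rightarrow> complex) \<Rightarrow> bool" where
  "entire F \<longleftrightarrow> (\<forall>z. \<exists>D. (F has_derivative D) (at z) \<and> (\<forall>a v. D (a *s v) = a * D v))"

definition phase_point :: "real^'d \<Rightarrow> real^'d \<Rightarrow> complex^'d" where
  "phase_point x \<xi> = of_real (2 powr (- (1/2))) *s (cvec x - \<i> *s cvec \<xi>)"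

definition B_norm ::
  "(real \<Rightarrow> ennreal) \<Rightarrow> (real \<Rightarrow> ennreal) \<Rightarrow> ((real^'d) \<times> (real^'d) \<Rightarrow> real) \<Rightarrow>
   (complex^'d \<Rightarrow> complex) \<Rightarrow> ennreal" where
  "B_norm \<Phi>1 \<Phi>2 \<omega> F =
     orlicz_norm \<Phi>2 (\<lambda>\<xi>.
       ennreal ((2 * pi) powr (- (real CARD('d) / 2)) * exp (- (norm \<xi>)\<^sup>2 / 4)) *
       orlicz_norm \<Phi>1 (\<lambda>x. ennreal (cmod
         (of_real (exp (- (norm x)\<^sup>2 / 4)) * F (phase_point x \<xi>) * of_real (\<omega> (x, \<xi>))))))"

definition B_space ::
  "(real \<Rightarrow> ennreal) \<Rightarrow> (real \<Rightarrow> ennreal) \<Rightarrow> ((real^'d) \<times> (real^'d) \<Rightarrow> real) \<Rightarrow>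
   (complex^'d \<Rightarrow> complex) set" where
  "B_space \<Phi>1 \<Phi>2 \<omega> = {F \<in> borel_measurable lebesgue. B_norm \<Phi>1 \<Phi>2 \<omega> F < \<infinity>}"

definition A_space ::
  "(real \<Rightarrow> ennreal) \<Rightarrow> (real \<Rightarrow> ennreal) \<Rightarrow> ((real^'d) \<times> (real^'d) \<Rightarrow> real) \<Rightarrow>
   (complex^'d \<Rightarrow> complex) set" where
  "A_space \<Phi>1 \<Phi>2 \<omega> = B_space \<Phi>1 \<Phi>2 \<omega> \<inter> {F. entire F}"

section \<open>Quasi-Banach spaces\<close>

text \<open>A complex quasi-Banach space of order \<open>r\<^sub>0\<close> whose elements are represented by the
  members of a subspace \<open>V\<close>; two representatives \<open>f\<close>, \<open>g\<close> denote the same element iff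
  \<open>eqv f g\<close> (equality, or equality almost everywhere). The quasi-norm vanishes only at
  zero: \<open>N (f - g) = 0\<close> iff \<open>f\<close> and \<open>g\<close> are identified. Together with the triangle
  inequality this makes \<open>eqv\<close> a congruence on \<open>V\<close> and \<open>N\<close> well defined on classes.\<close>

definition quasi_banach_space ::
  "(complex \<Rightarrow> 'v::ab_group_add \<Rightarrow> 'v) \<Rightarrow> ('v \<Rightarrow> 'v \<Rightarrow> bool) \<Rightarrow> real \<Rightarrow> 'v set \<Rightarrow> ('v \<Rightarrow> real) \<Rightarrow> bool"
  where
  "quasi_banach_space smul eqv r\<^sub>0 V N \<longleftrightarrow>
     vector_space smul \<and> module.subspace smul V \<and>
     (\<forall>f\<in>V. 0 \<le> N f) \<and>
     (\<forall>f\<in>V. \<forall>g\<in>V. N (f - g) = 0 \<longleftrightarrow> eqv f g) \<and>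
     (\<forall>a. \<forall>f\<in>V. N (smul a f) = cmod a * N f) \<and>
     (\<forall>f\<in>V. \<forall>g\<in>V. N (f + g) \<le> 2 powr (1 / r\<^sub>0 - 1) * (N f + N g)) \<and>
     (\<forall>f\<in>V. \<forall>g\<in>V. N (f + g) powr r\<^sub>0 \<le> N f powr r\<^sub>0 + N g powr r\<^sub>0) \<and>
     (\<forall>s. (\<forall>n. s n \<in> V) \<and> (\<forall>e>0. \<exists>k::nat. \<forall>m\<ge>k. \<forall>n\<ge>k. N (s m - s n) < e) \<longrightarrow>
        (\<exists>f\<in>V. (\<lambda>n. N (s n - f)) \<longlonglongrightarrow> 0))"

definition fun_scale :: "complex \<Rightarrow> ('b \<Rightarrow> complex) \<Rightarrow> 'b \<Rightarrow> complex" where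
  "fun_scale a f = (\<lambda>x. a * f x)"

definition ae_eq :: "('a::euclidean_space \<Rightarrow> complex) \<Rightarrow> ('a \<Rightarrow> complex) \<Rightarrow> bool" where
  "ae_eq F G \<longleftrightarrow> (AE z in lebesgue. F z = G z)"

end

theory Submission
  imports Defs "HOL-Probability.Probability" "HOL-Complex_Analysis.Complex_Analysis"
    "HOL-Real_Asymp.Real_Asymp"
begin

text \<open>
  With \<open>z = 2\<^sup>-\<^sup>1\<^sup>/\<^sup>2 (x - i\<xi>)\<close>, the window in the short-time Fourier transform at \<open>(x, \<xi>)\<close> is,
  up to a factor of modulus \<open>exp (- (|x|\<^sup>2 + |\<xi>|\<^sup>2) / 4)\<close>, the conjugate Bargmann kernel at \<open>z\<close>; hence
  the two quasi-norms agree. The \<open>\<alpha>\<close>-th Hermite coefficient of the kernel is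
  \<open>z\<^sup>\<alpha> / \<surd>(\<alpha>!)\<close>, so the Bargmann transform of a formal Hermite series is a power series, and
  Cauchy's estimates identify its range with the entire functions.

  The quasi-norm axioms and the completeness of the \<open>B\<close> space follow from the \<open>r\<close>-triangle inequality
  and Fatou's lemma for Orlicz quasi-norms. For the \<open>A\<close> space, an entire function is bounded on
  compact sets by its quasi-norm, because around a suitable almost-maximal point it stays large on
  a whole ball, whose indicator function has quasi-norm bounded below by a power of the radius.
  Cauchy sequences of entire functions therefore converge locally uniformly. The \<open>M\<close> space
  inherits completeness through the isometry.
\<close>

text \<open>Three obstacles shape the argument. A quasi-Young function may be infinite on part or
  all of the positive half-line, so moduli and inner quasi-norms take values in [0,\<infinity>], and
  the triangle inequality is stated so as to be vacuous at infinite arguments. A Lebesgue measurable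
  function on the product has measurable sections for almost every \<xi> but not for all, so the
  mixed quasi-norm is evaluated on Borel representatives. Elements of the dual of the test space are
  formal series, so the link between the two transforms is established coefficient by coefficient,
  with no integral of the distribution itself.

  The exponents in the local bound for entire functions come from a balance. A product of two balls
  of radius \<eta> has mixed quasi-norm at least a constant times \<open>\<eta> ^ (2 * t)\<close>,
  where t is an integer not below d/r. Weighting |F| by the distance to the sphere, raised to the
  same power \<open>2 * t\<close>, makes all powers of the unknown radius cancel.\<close>

no_notation fps_nth (infixl \<open>$\<close> 75)

section \<open>The Orlicz quasi-norm\<close>

text \<open>The \<open>r\<close>-quasi-norm of the pair \<open>(a, b)\<close>. Bounding
  \<open>N (f + g)\<close> by \<open>qadd r (N f) (N g)\<close> yields both triangle inequalities
  required of a quasi-Banach space of order \<open>r\<close>.\<close>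

definition qadd :: "real \<Rightarrow> real \<Rightarrow> real \<Rightarrow> real" where
  "qadd r a b = (a powr r + b powr r) powr (1 / r)"

lemma qadd_nonneg [simp]: "0 \<le> qadd r a b"
  by (simp add: qadd_def)

lemma qadd_pos: "0 < a \<Longrightarrow> 0 < qadd r a b"
  using powr_gt_zero[of a r] powr_ge_zero[of b r] unfolding qadd_def by (subst powr_gt_zero) linarith

lemma qadd_powr: "0 < r \<Longrightarrow> qadd r a b powr r = a powr r + b powr r"
  by (simp add: qadd_def powr_powr)

lemma qadd_mono:
  "0 < r \<Longrightarrow> 0 \<le> a \<Longrightarrow> 0 \<le> b \<Longrightarrow> a \<le> a' \<Longrightarrow> b \<le> b' \<Longrightarrow> qadd r a b \<le> qadd r a' b'"
  unfolding qadd_def by (intro powr_mono2 add_mono) auto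

lemma qadd_0_left [simp]: "0 < r \<Longrightarrow> 0 \<le> b \<Longrightarrow> qadd r 0 b = b"
  by (simp add: qadd_def powr_powr)

lemma qadd_0_right [simp]: "0 < r \<Longrightarrow> 0 \<le> b \<Longrightarrow> qadd r b 0 = b"
  by (simp add: qadd_def powr_powr)

lemma filterlim_powr_at_top_pos: "0 < r \<Longrightarrow> filterlim (\<lambda>x::real. x powr r) at_top at_top"
  by real_asymp

text \<open>Midpoint convexity of \<open>x powr (1 / r)\<close> at \<open>a powr r\<close> and
  \<open>b powr r\<close>: doubling the midpoint gives \<open>2 powr (1 / r)\<close>, averaging
  gives the factor 1/2. Pairs with a zero entry are separate because convexity is used on
  \<open>{0<..}\<close>.\<close>

lemma qadd_le:
  assumes "0 < r" "r \<le> 1" "0 \<le> a" "0 \<le> b"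
  shows "qadd r a b \<le> 2 powr (1 / r - 1) * (a + b)"
proof -
  have one: "1 \<le> (2::real) powr (1 / r - 1)"
    using assms by (intro ge_one_powr_ge_zero) (auto simp: field_simps)
  show ?thesis
  proof (cases "a = 0 \<or> b = 0")
    case True
    then show ?thesis
      using assms one mult_right_mono[OF one, of "a + b"] by auto
  next
    case False
    define A B where "A = a powr r" and "B = b powr r"
    have pos: "0 < A" "0 < B" using False assms by (auto simp: A_def B_def)
    have conv: "convex_on {0<..} (\<lambda>x::real. x powr (1 / r))"
      using assms by (intro powr_convex) (auto simp: field_simps)
    have "((1 - 1/2) *\<^sub>R A + (1/2) *\<^sub>R B) powr (1/r) \<le> (1 - 1/2) * A powr (1/r) + (1/2) * B powr (1/r)"
      using pos by (intro convex_onD[OF conv]) auto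
    then have h: "((A + B) / 2) powr (1/r) \<le> (a + b) / 2"
      using assms by (simp add: A_def B_def powr_powr field_simps)
    have "(A + B) powr (1/r) = 2 powr (1/r) * ((A + B) / 2) powr (1/r)"
      using pos by (simp add: powr_divide)
    also have "\<dots> \<le> 2 powr (1/r) * ((a + b) / 2)"
      using h by (intro mult_left_mono) auto
    also have "\<dots> = 2 powr (1 / r - 1) * (a + b)"
      by (simp add: powr_diff)
    finally show ?thesis by (simp add: qadd_def A_def B_def)
  qed
qed

text \<open>The shares \<open>a / (a + b)\<close> and \<open>b / (a + b)\<close> sum to 1, and
  \<open>x \<le> x powr r\<close> on the unit interval.\<close>

lemma powr_add_le_add_powr:
  fixes a b r :: real
  assumes "0 < r" "r \<le> 1" "0 \<le> a" "0 \<le> b"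
  shows "(a + b) powr r \<le> a powr r + b powr r"
proof (cases "a + b = 0")
  case True
  then show ?thesis using assms by simp
next
  case False
  then have p: "0 < a + b" using assms by auto
  have "x \<le> x powr r" if "0 \<le> x" "x \<le> 1" for x :: real
    using that assms powr_mono'[of r 1 x] by (cases "x = 0") auto
  from this[of "a / (a + b)"] this[of "b / (a + b)"]
  have "a / (a + b) + b / (a + b) \<le> (a / (a + b)) powr r + (b / (a + b)) powr r"
    using assms p by auto
  moreover have "a / (a + b) + b / (a + b) = 1" using p by (simp flip: add_divide_distrib)
  ultimately have "1 \<le> (a powr r + b powr r) / (a + b) powr r"
    using assms p by (simp add: powr_divide add_divide_distrib)
  then show ?thesis using p by (simp add: field_simps)
qed

lemma add_le_qadd:
  assumes "0 < r" "r \<le> 1" "0 \<le> a" "0 \<le> b"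
  shows "a + b \<le> qadd r a b"
proof -
  have "a + b = ((a + b) powr r) powr (1/r)" using assms by (simp add: powr_powr)
  also have "\<dots> \<le> qadd r a b"
    unfolding qadd_def using assms by (intro powr_mono2 powr_add_le_add_powr) auto
  finally show ?thesis .
qed

text \<open>Encodes \<open>w\<^sup>r \<le> u\<^sup>r + v\<^sup>r\<close> in \<open>[0,\<infinity>]\<close> without a power function on \<^typ>\<open>ennreal\<close>.\<close>

definition qtri :: "real \<Rightarrow> ennreal \<Rightarrow> ennreal \<Rightarrow> ennreal \<Rightarrow> bool" where
  "qtri r u v w \<longleftrightarrow> (u < \<infinity> \<longrightarrow> v < \<infinity> \<longrightarrow> w \<le> ennreal (qadd r (enn2real u) (enn2real v)))"

lemma qtri_le: "qtri r u v w \<Longrightarrow> w' \<le> w \<Longrightarrow> qtri r u v w'"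
  by (auto simp: qtri_def)

lemma qtri_add:
  assumes "0 < r" "r \<le> 1"
  shows "qtri r u v (u + v)"
  unfolding qtri_def
proof (intro impI)
  assume "u < \<infinity>" "v < \<infinity>"
  then obtain a b where "u = ennreal a" "v = ennreal b" "0 \<le> a" "0 \<le> b"
    by (metis enn2real_nonneg ennreal_enn2real infinity_ennreal_def)
  then show "u + v \<le> ennreal (qadd r (enn2real u) (enn2real v))"
    using assms add_le_qadd[of r a b] by (simp flip: ennreal_plus)
qed

lemma qtri_max:
  assumes "0 < r" "r \<le> 1"
  shows "qtri r u v (max u v)"
  by (rule qtri_le[OF qtri_add[OF assms]]) auto

text \<open>Sublevel sets of a monotone function are down-closed, hence closed or open initial
  segments because suprema exist. Young functions may jump to \<open>top\<close>, so measurability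
  cannot be drawn from continuity.\<close>

lemma borel_measurable_mono_ennreal:
  fixes f :: "ennreal \<Rightarrow> ennreal"
  assumes "mono f"
  shows "f \<in> borel_measurable borel"
proof (rule borel_measurableI_le)
  fix y
  define S where "S = {x. f x \<le> y}"
  have down: "x \<in> S" if "x' \<in> S" "x \<le> x'" for x x'
    using that monoD[OF assms] unfolding S_def by (auto intro: order_trans)
  have "S = {..Sup S} \<or> S = {..<Sup S}"
  proof (cases "Sup S \<in> S")
    case True
    then have "S = {..Sup S}" using down by (auto intro: Sup_upper)
    then show ?thesis ..
  next
    case False
    have "S = {..<Sup S}"
    proof (intro set_eqI iffI)
      fix x assume "x \<in> S" then show "x \<in> {..<Sup S}"
        using False Sup_upper[of x S] by (auto simp: less_le)
    next
      fix x assume "x \<in> {..<Sup S}"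
      then obtain x' where "x' \<in> S" "x < x'" by (auto simp: less_Sup_iff)
      then show "x \<in> S" using down by (auto intro: less_imp_le)
    qed
    then show ?thesis ..
  qed
  then have "S \<in> sets borel" by (metis borel_closed borel_open closed_atMost open_lessThan)
  then show "{x \<in> space borel. f x \<le> y} \<in> sets borel" by (simp add: S_def)
qed

section \<open>Quasi-Young functions and their extension to [0,\<infinity>]\<close>

lemma young_mono:
  assumes "young \<Phi>" "0 \<le> s" "s \<le> t"
  shows "\<Phi> s \<le> \<Phi> t"
proof (cases "t = 0")
  case True
  then show ?thesis using assms by auto
next
  case False
  define \<theta> where "\<theta> = s / t"
  have \<theta>: "\<theta> \<in> {0..1}" using assms False by (auto simp: \<theta>_def)
  have "\<Phi> ((1 - \<theta>) * 0 + \<theta> * t) \<le> ennreal (1 - \<theta>) * \<Phi> 0 + ennreal \<theta> * \<Phi> t"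
    using assms \<theta> unfolding young_def by (meson order_refl order_trans)
  also have "\<dots> = ennreal \<theta> * \<Phi> t" using assms by (simp add: young_def)
  also have "\<dots> \<le> 1 * \<Phi> t" using \<theta> by (intro mult_right_mono) (auto simp: ennreal_le_1)
  finally show ?thesis using False by (simp add: \<theta>_def)
qed

locale orlicz =
  fixes r :: real and \<Phi> :: "real \<Rightarrow> ennreal"
  assumes r_pos: "0 < r" and r_le_1: "r \<le> 1" and quasi_young: "quasi_young r \<Phi>"
begin

lemma quasi_youngE:
  obtains \<Phi>\<^sub>0 where "young \<Phi>\<^sub>0" "\<And>t. 0 \<le> t \<Longrightarrow> \<Phi> t = \<Phi>\<^sub>0 (t powr r)"
  using quasi_young unfolding quasi_young_def by blast

lemma Phi_mono: "0 \<le> s \<Longrightarrow> s \<le> t \<Longrightarrow> \<Phi> s \<le> \<Phi> t"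
  by (rule quasi_youngE) (use r_pos in \<open>auto intro!: young_mono powr_mono2\<close>)

lemma Phi_0: "\<Phi> 0 = 0"
  by (rule quasi_youngE) (auto simp: young_def)

lemma Phi_at_top: "(\<Phi> \<longlongrightarrow> \<infinity>) at_top"
proof (rule quasi_youngE)
  fix \<Phi>\<^sub>0 assume y: "young \<Phi>\<^sub>0" and e: "\<And>t. 0 \<le> t \<Longrightarrow> \<Phi> t = \<Phi>\<^sub>0 (t powr r)"
  have "((\<lambda>t. \<Phi>\<^sub>0 (t powr r)) \<longlongrightarrow> \<infinity>) at_top"
    by (rule filterlim_compose[of \<Phi>\<^sub>0])
       (use y r_pos in \<open>auto simp: young_def intro!: filterlim_powr_at_top_pos\<close>)
  then show ?thesis
    by (rule Lim_transform_eventually) (use e in \<open>auto intro: eventually_mono[OF eventually_ge_at_top[of 0]]\<close>)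
qed

text \<open>In the variable \<open>t powr r\<close> the argument on the left lies below a convex
  combination of those on the right, with weights proportional to \<open>a powr r\<close> and
  \<open>b powr r\<close>. Convexity of the underlying Young function then gives the pointwise form
  of the \<open>r\<close>-triangle inequality.\<close>

lemma Phi_qadd:
  assumes "0 < a" "0 < b" "0 \<le> u" "0 \<le> v" "0 \<le> h" "h \<le> qadd r u v"
  shows "\<Phi> (h / qadd r a b) \<le>
     ennreal (a powr r / (a powr r + b powr r)) * \<Phi> (u / a) + ennreal (b powr r / (a powr r + b powr r)) * \<Phi> (v / b)"
proof (rule quasi_youngE)
  fix \<Phi>\<^sub>0 assume y: "young \<Phi>\<^sub>0" and e: "\<And>t. 0 \<le> t \<Longrightarrow> \<Phi> t = \<Phi>\<^sub>0 (t powr r)"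
  define c \<theta> where "c = a powr r + b powr r" and "\<theta> = b powr r / c"
  have c: "0 < c" using assms by (simp add: c_def add_pos_pos)
  have \<theta>: "\<theta> \<in> {0..1}" "1 - \<theta> = a powr r / c"
    using c assms by (auto simp: \<theta>_def c_def field_simps)
  have "(h / qadd r a b) powr r = h powr r / c"
    using assms r_pos by (simp add: powr_divide qadd_powr c_def)
  also have "\<dots> \<le> (u powr r + v powr r) / c"
    using c r_pos assms powr_mono2[of r h "qadd r u v"]
    by (intro divide_right_mono) (auto simp: qadd_powr)
  also have "\<dots> = (1 - \<theta>) * (u / a) powr r + \<theta> * (v / b) powr r"
    using assms c by (simp add: \<theta>(2) powr_divide) (simp add: \<theta>_def add_divide_distrib)
  finally have "\<Phi>\<^sub>0 ((h / qadd r a b) powr r) \<le> \<Phi>\<^sub>0 ((1 - \<theta>) * (u / a) powr r + \<theta> * (v / b) powr r)"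
    by (intro young_mono[OF y]) auto
  also have "\<dots> \<le> ennreal (1 - \<theta>) * \<Phi>\<^sub>0 ((u / a) powr r) + ennreal \<theta> * \<Phi>\<^sub>0 ((v / b) powr r)"
    using y \<theta> unfolding young_def by (meson powr_ge_zero)
  finally show ?thesis
    using assms by (simp add: e \<theta>(2)) (simp add: \<theta>_def c_def)
qed

abbreviation "Phi_ext \<equiv> at_ennreal \<Phi>"

lemma Phi_ext_ennreal [simp]: "0 \<le> t \<Longrightarrow> Phi_ext (ennreal t) = \<Phi> t"
  by (simp add: at_ennreal_def)

lemma Phi_ext_0 [simp]: "Phi_ext 0 = 0"
  by (simp add: at_ennreal_def Phi_0)

lemma Phi_ext_top [simp]: "Phi_ext top = top"
  by (simp add: at_ennreal_def)

lemma mono_Phi_ext: "mono Phi_ext"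
proof (rule monoI)
  fix s t :: ennreal assume "s \<le> t"
  then show "Phi_ext s \<le> Phi_ext t"
    by (cases s; cases t) (auto intro: Phi_mono simp: top_unique)
qed

lemma measurable_Phi_ext [measurable]: "Phi_ext \<in> borel_measurable borel"
  by (rule borel_measurable_mono_ennreal[OF mono_Phi_ext])

lemma Phi_ext_filterlim_top:
  assumes "(f \<longlongrightarrow> top) F"
  shows "((\<lambda>n. Phi_ext (f n)) \<longlongrightarrow> top) F"
  unfolding order_tendsto_iff
proof (intro conjI allI impI)
  fix l :: ennreal assume "l < top"
  then have "eventually (\<lambda>t. l < \<Phi> t) at_top"
    using Phi_at_top by (simp add: order_tendsto_iff)
  then obtain t where t: "0 \<le> t" "l < \<Phi> t"
    by (metis eventually_at_top_linorder linorder_le_cases)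
  have "eventually (\<lambda>n. ennreal t < f n) F"
    using assms by (auto simp: order_tendsto_iff)
  then show "eventually (\<lambda>n. l < Phi_ext (f n)) F"
  proof eventually_elim
    case (elim n)
    then have "Phi_ext (ennreal t) \<le> Phi_ext (f n)" by (intro monoD[OF mono_Phi_ext]) auto
    then show ?case using t by (auto intro: less_le_trans)
  qed
qed auto

end

section \<open>Homogeneity, triangle inequality and Fatou property of one Orlicz quasi-norm\<close>

context orlicz begin

abbreviation "lnorm g \<equiv> orlicz_norm \<Phi> g"

lemma modular_antimono:
  assumes "0 < a" "a \<le> b"
  shows "(\<integral>\<^sup>+x. Phi_ext (g x / ennreal b) \<partial>lebesgue) \<le> (\<integral>\<^sup>+x. Phi_ext (g x / ennreal a) \<partial>lebesgue)"
proof -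
  have "y / ennreal b \<le> y / ennreal a" for y
    using assms by (cases y) (auto simp: divide_ennreal ennreal_top_divide ennreal_le_iff divide_left_mono)
  then show ?thesis by (intro nn_integral_mono monoD[OF mono_Phi_ext])
qed

lemma lnorm_le: "0 < a \<Longrightarrow> (\<integral>\<^sup>+x. Phi_ext (g x / ennreal a) \<partial>lebesgue) \<le> 1 \<Longrightarrow> lnorm g \<le> ennreal a"
  unfolding orlicz_norm_def by (rule INF_lower) auto

text \<open>Admissible dilations form an up-closed set, so every number above their infimum is
  admissible. The infimum itself can fail to be, since \<open>\<Phi>\<close> may jump; hence the
  strict hypothesis.\<close>

lemma modular_le_1:
  assumes "lnorm g < ennreal a"
  shows "(\<integral>\<^sup>+x. Phi_ext (g x / ennreal a) \<partial>lebesgue) \<le> 1"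
proof -
  obtain b where b: "0 < b" "(\<integral>\<^sup>+x. Phi_ext (g x / ennreal b) \<partial>lebesgue) \<le> 1" "ennreal b < ennreal a"
    using assms unfolding orlicz_norm_def INF_less_iff by auto
  then have "b \<le> a" by (auto simp: ennreal_less_iff)
  from order_trans[OF modular_antimono[OF b(1) this] b(2)] show ?thesis .
qed

lemma lnorm_mono_AE:
  assumes "AE x in lebesgue. f x \<le> g x"
  shows "lnorm f \<le> lnorm g"
  unfolding orlicz_norm_def
proof (rule INF_superset_mono)
  have "(\<integral>\<^sup>+x. Phi_ext (f x / ennreal a) \<partial>lebesgue) \<le> (\<integral>\<^sup>+x. Phi_ext (g x / ennreal a) \<partial>lebesgue)" for a
    by (rule nn_integral_mono_AE)
       (use assms in \<open>auto intro!: monoD[OF mono_Phi_ext] divide_right_mono_ennreal elim!: eventually_mono\<close>)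
  then show "{a. 0 < a \<and> (\<integral>\<^sup>+x. Phi_ext (g x / ennreal a) \<partial>lebesgue) \<le> 1}
    \<subseteq> {a. 0 < a \<and> (\<integral>\<^sup>+x. Phi_ext (f x / ennreal a) \<partial>lebesgue) \<le> 1}"
    by (auto intro: order_trans)
qed auto

lemma lnorm_cong_AE:
  assumes "AE x in lebesgue. f x = g x"
  shows "lnorm f = lnorm g"
  by (intro antisym lnorm_mono_AE) (use assms in \<open>auto elim: eventually_mono\<close>)

lemma lnorm_0 [simp]: "lnorm (\<lambda>x. 0) = 0"
proof -
  have "lnorm (\<lambda>x::'a. 0) \<le> 0 + ennreal e" if "0 < e" for e
    using that lnorm_le[of e "\<lambda>x. 0"] by simp
  then have "lnorm (\<lambda>x::'a. 0) \<le> 0" by (rule ennreal_le_epsilon)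
  then show ?thesis by simp
qed

lemma lnorm_mult_le:
  assumes "0 < c"
  shows "lnorm (\<lambda>x. ennreal c * g x) \<le> ennreal c * lnorm g"
proof (cases "lnorm g")
  case (real l)
  show ?thesis
  proof (rule ennreal_le_epsilon)
    fix e :: real assume "0 < e"
    \<comment> \<open>The slack \<open>e / c\<close> becomes an excess of exactly \<open>e\<close>
      after multiplication by \<open>c\<close>.\<close>
    have l: "lnorm g < ennreal (l + e / c)"
      using real \<open>0 < e\<close> assms by (simp add: ennreal_less_iff)
    have pos: "0 < l + e / c" using assms real \<open>0 < e\<close> by (simp add: add_nonneg_pos)
    have "lnorm (\<lambda>x. ennreal c * g x) \<le> ennreal (c * (l + e / c))"
    proof (rule lnorm_le)
      have eq: "ennreal c * g x / ennreal (c * (l + e / c)) = g x / ennreal (l + e / c)" for x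
        using assms pos divide_mult_eq[of "ennreal c" "g x" "ennreal (l + e / c)"]
        by (simp add: ennreal_mult mult.commute[of "ennreal c"] del: ennreal_times_divide)
      show "(\<integral>\<^sup>+x. Phi_ext (ennreal c * g x / ennreal (c * (l + e / c))) \<partial>lebesgue) \<le> 1"
        unfolding eq by (rule modular_le_1[OF l])
    qed (use assms pos in simp)
    also have "\<dots> = ennreal c * lnorm g + ennreal e"
    proof -
      have "c * (l + e / c) = c * l + e" using assms by (simp add: distrib_left)
      then show ?thesis
        using assms real \<open>0 < e\<close> ennreal_plus[of "c * l" e] ennreal_mult[of c l] by simp
    qed
    finally show "lnorm (\<lambda>x. ennreal c * g x) \<le> ennreal c * lnorm g + ennreal e" .
  qed
next
  case top
  then show ?thesis using assms by (simp add: ennreal_mult_top)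
qed

lemma lnorm_mult:
  assumes "0 \<le> c"
  shows "lnorm (\<lambda>x. ennreal c * g x) = ennreal c * lnorm g"
proof (cases "c = 0")
  case False
  with assms have c: "0 < c" by simp
  have "ennreal c * lnorm g = ennreal c * lnorm (\<lambda>x. ennreal (1 / c) * (ennreal c * g x))"
    using c by (simp flip: mult.assoc ennreal_mult)
  also have "\<dots> \<le> ennreal c * (ennreal (1 / c) * lnorm (\<lambda>x. ennreal c * g x))"
    using c by (intro mult_left_mono lnorm_mult_le) auto
  also have "\<dots> = lnorm (\<lambda>x. ennreal c * g x)"
    using c by (simp flip: mult.assoc ennreal_mult)
  finally show ?thesis using lnorm_mult_le[OF c, of g] by (rule antisym[rotated])
qed simp

lemma Phi_ext_qtri:
  assumes "0 < a" "0 < b" "qtri r u v w"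
  shows "Phi_ext (w / ennreal (qadd r a b)) \<le>
     ennreal (a powr r / (a powr r + b powr r)) * Phi_ext (u / ennreal a) +
     ennreal (b powr r / (a powr r + b powr r)) * Phi_ext (v / ennreal b)"
proof (cases "u = top \<or> v = top")
  case True
  \<comment> \<open>With both weights positive, an infinite \<open>u\<close> or \<open>v\<close>
    makes the right-hand side infinite.\<close>
  have "0 < a powr r / (a powr r + b powr r)" "0 < b powr r / (a powr r + b powr r)"
    using assms by (auto intro!: divide_pos_pos add_pos_pos)
  then show ?thesis using True by (auto simp: ennreal_top_divide ennreal_mult_top)
next
  case False
  then obtain u' v' where uv: "u = ennreal u'" "v = ennreal v'" "0 \<le> u'" "0 \<le> v'"
    by (cases u; cases v) auto
  then have w: "w \<le> ennreal (qadd r u' v')" using assms by (simp add: qtri_def)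
  then obtain w' where w': "w = ennreal w'" "0 \<le> w'" by (cases w) (auto simp: top_unique)
  have "w' \<le> qadd r u' v'" using w w' by (simp add: ennreal_le_iff)
  from Phi_qadd[OF assms(1,2) uv(3,4) w'(2) this] show ?thesis
    using uv w' assms by (simp add: divide_ennreal qadd_pos)
qed

lemma qadd_tendsto:
  "0 \<le> a \<Longrightarrow> 0 \<le> b \<Longrightarrow> ((\<lambda>e. qadd r (a + e) (b + e)) \<longlongrightarrow> qadd r a b) (at_right 0)"
  unfolding qadd_def using r_pos
  by (intro tendsto_powr' tendsto_add tendsto_const tendsto_eq_intros)
     (auto simp: eventually_at_filter intro!: tendsto_eq_intros)

text \<open>For \<open>a\<close> and \<open>b\<close> strictly above the two quasi-norms both
  modulars are at most 1. By \<open>Phi_ext_qtri\<close> the modular of \<open>h\<close> at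
  \<open>qadd r a b\<close> is at most a weighted average of them, hence at most 1. Continuity of
  \<open>qadd\<close> removes the slack.\<close>

lemma lnorm_qtri:
  fixes f g h :: "'a::euclidean_space \<Rightarrow> ennreal"
  assumes [measurable]: "f \<in> borel_measurable lebesgue" "g \<in> borel_measurable lebesgue"
    and tri: "AE x in lebesgue. qtri r (f x) (g x) (h x)"
  shows "qtri r (lnorm f) (lnorm g) (lnorm h)"
  unfolding qtri_def
proof (intro impI)
  assume "lnorm f < \<infinity>" "lnorm g < \<infinity>"
  then obtain u v where uv: "lnorm f = ennreal u" "lnorm g = ennreal v" "0 \<le> u" "0 \<le> v"
    by (cases "lnorm f"; cases "lnorm g") auto
  have le: "lnorm h \<le> ennreal (qadd r (u + e) (v + e))" if e: "0 < e" for e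
  proof (rule lnorm_le)
    define a b where "a = u + e" and "b = v + e"
    have ab: "0 < a" "0 < b" using uv e by (auto simp: a_def b_def)
    define s t where "s = a powr r / (a powr r + b powr r)" and "t = b powr r / (a powr r + b powr r)"
    have st: "0 \<le> s" "0 \<le> t" "s + t = 1"
      using ab unfolding s_def t_def
      by (auto simp flip: add_divide_distrib simp: add_pos_pos less_imp_neq[symmetric])
    have f: "(\<integral>\<^sup>+x. Phi_ext (f x / ennreal a) \<partial>lebesgue) \<le> 1"
      using e uv by (intro modular_le_1) (simp add: a_def ennreal_less_iff)
    have g: "(\<integral>\<^sup>+x. Phi_ext (g x / ennreal b) \<partial>lebesgue) \<le> 1"
      using e uv by (intro modular_le_1) (simp add: b_def ennreal_less_iff)
    have "(\<integral>\<^sup>+x. Phi_ext (h x / ennreal (qadd r a b)) \<partial>lebesgue) \<le>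
       (\<integral>\<^sup>+x. ennreal s * Phi_ext (f x / ennreal a) + ennreal t * Phi_ext (g x / ennreal b) \<partial>lebesgue)"
      by (rule nn_integral_mono_AE)
         (use tri in \<open>eventually_elim, auto simp: s_def t_def intro!: Phi_ext_qtri ab\<close>)
    also have "\<dots> = ennreal s * (\<integral>\<^sup>+x. Phi_ext (f x / ennreal a) \<partial>lebesgue) +
       ennreal t * (\<integral>\<^sup>+x. Phi_ext (g x / ennreal b) \<partial>lebesgue)"
      by (simp add: nn_integral_add nn_integral_cmult)
    also have "\<dots> \<le> ennreal s * 1 + ennreal t * 1"
      by (intro add_mono mult_left_mono f g) auto
    also have "\<dots> = 1" using st by (simp flip: ennreal_plus)
    finally show "(\<integral>\<^sup>+x. Phi_ext (h x / ennreal (qadd r (u + e) (v + e))) \<partial>lebesgue) \<le> 1"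
      by (simp add: a_def b_def)
  qed (use uv e in \<open>auto intro!: qadd_pos\<close>)
  have "((\<lambda>e. ennreal (qadd r (u + e) (v + e))) \<longlongrightarrow> ennreal (qadd r u v)) (at_right 0)"
    using uv by (intro tendsto_ennrealI qadd_tendsto)
  then have "lnorm h \<le> ennreal (qadd r u v)"
    by (rule tendsto_lowerbound) (auto intro!: le eventually_mono[OF eventually_at_right_less[of "0::real"]])
  then show "lnorm h \<le> ennreal (qadd r (enn2real (lnorm f)) (enn2real (lnorm g)))"
    using uv by simp
qed

text \<open>\<open>\<Phi>\<close> need not be left-continuous, so Fatou's lemma is applied with a slack factor
  \<open>s > 1\<close> in the dilation.\<close>

lemma lnorm_liminf:
  fixes f :: "nat \<Rightarrow> 'a::euclidean_space \<Rightarrow> ennreal"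
  assumes [measurable]: "\<And>n. f n \<in> borel_measurable lebesgue"
    and le: "AE x in lebesgue. g x \<le> liminf (\<lambda>n. f n x)"
  shows "lnorm g \<le> liminf (\<lambda>n. lnorm (f n))"
proof (rule dense_ge)
  fix C assume C: "liminf (\<lambda>n. lnorm (f n)) < C"
  show "lnorm g \<le> C"
  proof (cases C)
    case (real c)
    then have c: "0 < c" using C by (cases "c = 0") auto
    have freq: "\<exists>\<^sub>F n in sequentially. lnorm (f n) < ennreal c"
    proof (rule ccontr)
      assume "\<not> ?thesis"
      then have "eventually (\<lambda>n. C \<le> lnorm (f n)) sequentially"
        using real by (auto simp: frequently_def not_less)
      then have "C \<le> liminf (\<lambda>n. lnorm (f n))" by (rule Liminf_bounded)
      with C show False by simp
    qed
    then have freq: "\<exists>\<^sub>F n in sequentially. (\<integral>\<^sup>+x. Phi_ext (f n x / ennreal c) \<partial>lebesgue) \<le> 1"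
      by (rule frequently_elim1) (rule modular_le_1)
    have "liminf (\<lambda>n. \<integral>\<^sup>+x. Phi_ext (f n x / ennreal c) \<partial>lebesgue) \<le> 1"
    proof (rule ccontr)
      assume "\<not> ?thesis"
      then have "eventually (\<lambda>n. 1 < (\<integral>\<^sup>+x. Phi_ext (f n x / ennreal c) \<partial>lebesgue)) sequentially"
        by (intro less_LiminfD) auto
      with freq show False by (auto simp: frequently_def not_le elim: eventually_mono)
    qed
    then have lim: "(\<integral>\<^sup>+x. liminf (\<lambda>n. Phi_ext (f n x / ennreal c)) \<partial>lebesgue) \<le> 1"
      by (intro order_trans[OF nn_integral_liminf]) auto
    have "lnorm g \<le> ennreal (s * c)" if s: "1 < s" for s
    proof (rule lnorm_le)
      \<comment> \<open>For finite positive \<open>y\<close> the factor \<open>s\<close> makes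
        \<open>y / s < liminf F\<close> strict, so the bound holds eventually along
        \<open>F\<close>. At \<open>y = top\<close> no slack exists; there \<open>F\<close> tends to
        \<open>top\<close>, and so does its image under \<open>Phi_ext\<close>.\<close>
      have pt: "Phi_ext (y / ennreal (s * c)) \<le> liminf (\<lambda>n. Phi_ext (F n / ennreal c))"
        if y: "y \<le> liminf F" for y and F :: "nat \<Rightarrow> ennreal"
      proof (cases "y = top")
        case True
        with y have "liminf F = top" by (simp add: top_unique)
        then have "F \<longlonglongrightarrow> top" 
          using Liminf_le_Limsup[of sequentially F] by (simp add: tendsto_iff_Liminf_eq_Limsup top_unique)
        then have "(\<lambda>n. F n * (1 / ennreal c)) \<longlonglongrightarrow> top * (1 / ennreal c)"
          using c by (intro tendsto_mult_ennreal tendsto_const) auto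
        then have "(\<lambda>n. F n / ennreal c) \<longlonglongrightarrow> top"
          using c by (simp add: divide_ennreal_def ennreal_top_mult)
        from lim_imp_Liminf[OF _ Phi_ext_filterlim_top[OF this]] show ?thesis by simp
      next
        case False
        show ?thesis
        proof (cases "y = 0")
          case ynz: False
          have "y / ennreal s < y"
          proof -
            obtain y' where y': "y = ennreal y'" "0 < y'"
              using False ynz by (cases y) auto
            then show ?thesis using s by (simp add: divide_ennreal ennreal_less_iff divide_less_eq)
          qed
          also have "\<dots> \<le> liminf F" by fact
          finally have "eventually (\<lambda>n. y / ennreal s < F n) sequentially" by (rule less_LiminfD)
          then show ?thesis
          proof (intro Liminf_bounded, elim eventually_mono)
            fix n assume n: "y / ennreal s < F n"
            have "y / ennreal (s * c) = y / ennreal s / ennreal c"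
              using s c by (cases y) (auto simp: divide_ennreal ennreal_top_divide)
            also have "\<dots> \<le> F n / ennreal c"
              using n by (intro divide_right_mono_ennreal) auto
            finally show "Phi_ext (y / ennreal (s * c)) \<le> Phi_ext (F n / ennreal c)"
              by (rule monoD[OF mono_Phi_ext])
          qed
        qed simp
      qed
      have "(\<integral>\<^sup>+x. Phi_ext (g x / ennreal (s * c)) \<partial>lebesgue) \<le>
         (\<integral>\<^sup>+x. liminf (\<lambda>n. Phi_ext (f n x / ennreal c)) \<partial>lebesgue)"
        by (rule nn_integral_mono_AE) (use le in \<open>eventually_elim, intro pt\<close>)
      with lim show "(\<integral>\<^sup>+x. Phi_ext (g x / ennreal (s * c)) \<partial>lebesgue) \<le> 1" by simp
    qed (use s c in auto)
    then have "eventually (\<lambda>s. lnorm g \<le> ennreal (s * c)) (at_right 1)"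
      by (auto simp: eventually_at_filter)
    moreover have "((\<lambda>s. ennreal (s * c)) \<longlongrightarrow> ennreal (1 * c)) (at_right 1)"
      by (intro tendsto_ennrealI tendsto_intros)
    ultimately have "lnorm g \<le> ennreal (1 * c)" by (intro tendsto_lowerbound) auto
    then show ?thesis using real by simp
  qed simp
qed

text \<open>Some modular is finite, so its integrand is finite almost everywhere, while
  \<open>Phi_ext top = top\<close>.\<close>

lemma AE_finite_if_lnorm_finite:
  assumes [measurable]: "g \<in> borel_measurable lebesgue" and "lnorm g < \<infinity>"
  shows "AE x in lebesgue. g x < \<infinity>"
proof -
  obtain a where a: "0 < a" "(\<integral>\<^sup>+x. Phi_ext (g x / ennreal a) \<partial>lebesgue) \<le> 1"
    using assms(2) unfolding orlicz_norm_def INF_less_iff by auto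
  then have "AE x in lebesgue. Phi_ext (g x / ennreal a) \<noteq> \<infinity>"
    by (intro nn_integral_PInf_AE) (auto simp: top_unique)
  then show ?thesis
  proof eventually_elim
    case (elim x)
    then show ?case by (cases "g x") (auto simp: ennreal_top_divide)
  qed
qed

text \<open>All multiples \<open>n * g\<close> have quasi-norm 0, so by the Fatou property
  \<open>top * g\<close> has too and is finite almost everywhere. In \<open>ennreal\<close>,
  \<open>top * 0 = 0\<close> and every other product with \<open>top\<close> is
  \<open>top\<close>.\<close>

lemma AE_0_if_lnorm_0:
  assumes [measurable]: "g \<in> borel_measurable lebesgue" and "lnorm g = 0"
  shows "AE x in lebesgue. g x = 0"
proof -
  have "lnorm (\<lambda>x. top * g x) \<le> liminf (\<lambda>n. lnorm (\<lambda>x. ennreal (real n) * g x))"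
  proof (rule lnorm_liminf)
    have "(\<lambda>n. ennreal (real n)) \<longlonglongrightarrow> top"
      using of_nat_tendsto_top_ennreal by (simp add: ennreal_of_nat_eq_real_of_nat)
    then have *: "(\<lambda>n. ennreal (real n) * g x) \<longlonglongrightarrow> top * g x" if "g x \<noteq> 0" for x
      using that by (intro tendsto_mult_ennreal tendsto_const) auto
    show "AE x in lebesgue. top * g x \<le> liminf (\<lambda>n. ennreal (real n) * g x)"
    proof (intro AE_I2)
      fix x show "top * g x \<le> liminf (\<lambda>n. ennreal (real n) * g x)"
        using lim_imp_Liminf[OF _ *, of x] by (cases "g x = 0") auto
    qed
  qed auto
  also have "\<dots> = 0"
    using assms by (simp add: lnorm_mult Liminf_const)
  finally have "AE x in lebesgue. top * g x < \<infinity>"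
    by (intro AE_finite_if_lnorm_finite) auto
  then show ?thesis
  proof eventually_elim
    case (elim x)
    then show ?case by (cases "g x = 0") (simp_all add: ennreal_top_mult)
  qed
qed

end

section \<open>Mixed Orlicz quasi-norms\<close>

text \<open>Lebesgue measure is a completion, so the exceptional set is first enclosed in a null set
  of the uncompleted product, to which Fubini applies. The order of the quantifiers is swapped
  because the inner quasi-norm integrates over the first coordinate.\<close>

lemma AE_lebesgue_sections:
  fixes P :: "'a::euclidean_space \<times> 'b::euclidean_space \<Rightarrow> bool"
  assumes "AE p in lebesgue. P p"
  shows "AE \<xi> in lebesgue. AE x in lebesgue. P (x, \<xi>)"
proof -
  have "AE p in (lborel \<Otimes>\<^sub>M lborel). P p"
    using assms unfolding AE_completion_iff lborel_prod .
  then obtain N where N: "N \<in> sets (lborel \<Otimes>\<^sub>M lborel)" "emeasure (lborel \<Otimes>\<^sub>M lborel) N = 0"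
      "{p. \<not> P p} \<subseteq> N"
    by (rule AE_E) (auto simp: space_pair_measure)
  have m: "{p \<in> space (lborel \<Otimes>\<^sub>M lborel). (fst p, snd p) \<notin> N} \<in> sets (lborel \<Otimes>\<^sub>M lborel)"
  proof -
    have "{p \<in> space (lborel \<Otimes>\<^sub>M lborel). (fst p, snd p) \<notin> N} = space (lborel \<Otimes>\<^sub>M lborel) - N" by auto
    then show ?thesis using sets.compl_sets[OF N(1)] by simp
  qed
  have "AE p in (lborel \<Otimes>\<^sub>M lborel). (fst p, snd p) \<notin> N"
    using N by (intro AE_I[of _ _ N]) auto
  then have "AE x in lborel. AE \<xi> in lborel. (x, \<xi>) \<notin> N"
    using lborel_pair.AE_pair_iff[of "\<lambda>x \<xi>. (x, \<xi>) \<notin> N", OF m] by simp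
  then have "AE \<xi> in lborel. AE x in lborel. (x, \<xi>) \<notin> N"
    using lborel_pair.AE_commute[of "\<lambda>x \<xi>. (x, \<xi>) \<notin> N", OF m] by simp
  then show ?thesis
    unfolding AE_completion_iff
    by (rule eventually_mono) (use N(3) in \<open>auto elim: eventually_mono\<close>)
qed

text \<open>Null sections alone do not make a set null, as nonmeasurable planar sets meeting each
  line in at most two points show; hence the measurability assumption that Fubini requires.\<close>

lemma AE_lebesgue_if_sections:
  fixes P :: "'a::euclidean_space \<times> 'b::euclidean_space \<Rightarrow> bool"
  assumes "AE \<xi> in lebesgue. AE x in lebesgue. P (x, \<xi>)" and "{p. P p} \<in> sets lborel"
  shows "AE p in lebesgue. P p"
proof -
  have m: "{p \<in> space (lborel \<Otimes>\<^sub>M lborel). P (fst p, snd p)} \<in> sets (lborel \<Otimes>\<^sub>M lborel)"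
    using assms(2) unfolding lborel_prod by simp
  have "AE \<xi> in lborel. AE x in lborel. P (x, \<xi>)"
    using assms(1) by (simp add: AE_completion_iff)
  then have "AE x in lborel. AE \<xi> in lborel. P (x, \<xi>)"
    using m by (subst lborel_pair.AE_commute) auto
  then have "AE p in (lborel \<Otimes>\<^sub>M lborel). P (fst p, snd p)"
    using m by (subst (asm) lborel_pair.AE_pair_iff) auto
  then show ?thesis unfolding AE_completion_iff lborel_prod by simp
qed

text \<open>Every section of a Borel representative is measurable, and the mixed quasi-norm does not
  see the change on a null set. The facts about mixed quasi-norms below pass to such
  representatives.\<close>

lemma lebesgue_ex_borel_ennreal:
  fixes f :: "'a::euclidean_space \<Rightarrow> ennreal"
  assumes "f \<in> borel_measurable lebesgue"
  obtains g where "g \<in> borel_measurable borel" "AE x in lebesgue. f x = g x"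
proof -
  from completion_ex_borel_measurable[OF assms] obtain g
    where "g \<in> borel_measurable lborel" "AE x in lborel. f x = g x" by blast
  then show ?thesis by (intro that[of g]) (auto simp: AE_completion_iff)
qed

context orlicz begin

text \<open>Serves the measurability of the inner quasi-norm in the outer variable: the index set
  becomes countable and independent of \<open>g\<close>, the constraint moving into the
  \<open>if\<close>. Rational dilations suffice because admissible ones are up-closed.\<close>

lemma lnorm_eq_INF_rat:
  "lnorm g = (INF a\<in>{a \<in> \<rat>. 0 < a}. if (\<integral>\<^sup>+x. Phi_ext (g x / ennreal a) \<partial>lebesgue) \<le> 1 then ennreal a else \<infinity>)"
  (is "_ = (INF a\<in>_. ?h a)")
proof (rule antisym)
  show "lnorm g \<le> (INF a\<in>{a \<in> \<rat>. 0 < a}. ?h a)"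
    by (rule INF_greatest) (auto intro: lnorm_le)
  show "(INF a\<in>{a \<in> \<rat>. 0 < a}. ?h a) \<le> lnorm g"
    unfolding orlicz_norm_def
  proof (rule INF_greatest)
    fix a assume "a \<in> {a. 0 < a \<and> (\<integral>\<^sup>+x. Phi_ext (g x / ennreal a) \<partial>lebesgue) \<le> 1}"
    then have a: "0 < a" "(\<integral>\<^sup>+x. Phi_ext (g x / ennreal a) \<partial>lebesgue) \<le> 1" by auto
    show "(INF a\<in>{a \<in> \<rat>. 0 < a}. ?h a) \<le> ennreal a"
    proof (rule ennreal_le_epsilon)
      fix e :: real assume e: "0 < e"
      obtain q where q: "q \<in> \<rat>" "a < q" "q < a + e"
        using Rats_dense_in_real[of a "a + e"] e by auto
      have "(INF a\<in>{a \<in> \<rat>. 0 < a}. ?h a) \<le> ?h q"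
        using q a by (intro INF_lower) auto
      also have "?h q = ennreal q"
        using order_trans[OF modular_antimono[of a q g] a(2)] a q by simp
      also have "\<dots> \<le> ennreal a + ennreal e"
        using q a e by (simp flip: ennreal_plus)
      finally show "(INF a\<in>{a \<in> \<rat>. 0 < a}. ?h a) \<le> ennreal a + ennreal e" .
    qed
  qed
qed

lemma measurable_lnorm_section:
  fixes F :: "'a::euclidean_space \<times> 'b::euclidean_space \<Rightarrow> ennreal"
  assumes "F \<in> borel_measurable borel"
  shows "(\<lambda>\<xi>. lnorm (\<lambda>x. F (x, \<xi>))) \<in> borel_measurable borel"
proof -
  have [measurable]: "F \<in> borel_measurable (borel \<Otimes>\<^sub>M borel)"
    using assms by (simp add: borel_prod)
  show ?thesis
    unfolding lnorm_eq_INF_rat nn_integral_completion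
    by (intro borel_measurable_INF)
       (auto intro!: countable_subset[OF _ countable_rat] lborel.borel_measurable_nn_integral)
qed

end

section \<open>The mixed quasi-norm\<close>

locale mixed_orlicz = o1: orlicz r \<Phi>1 + o2: orlicz r \<Phi>2
  for r :: real and \<Phi>1 \<Phi>2 :: "real \<Rightarrow> ennreal"
begin

definition mix :: "('a::euclidean_space \<times> 'b::euclidean_space \<Rightarrow> ennreal) \<Rightarrow> ennreal" where
  "mix H = o2.lnorm (\<lambda>\<xi>. o1.lnorm (\<lambda>x. H (x, \<xi>)))"

lemma mix_mono_AE:
  assumes "AE p in lebesgue. f p \<le> g p"
  shows "mix f \<le> mix g"
  unfolding mix_def
  by (rule o2.lnorm_mono_AE, rule eventually_mono[OF AE_lebesgue_sections[OF assms]])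
     (rule o1.lnorm_mono_AE)

lemma mix_cong_AE:
  assumes "AE p in lebesgue. f p = g p"
  shows "mix f = mix g"
  by (intro antisym mix_mono_AE) (use assms in \<open>auto elim: eventually_mono\<close>)

lemma mix_mult: "0 \<le> c \<Longrightarrow> mix (\<lambda>p. ennreal c * g p) = ennreal c * mix g"
  unfolding mix_def by (simp add: o1.lnorm_mult o2.lnorm_mult)

lemma mix_0 [simp]: "mix (\<lambda>p. 0) = 0"
  unfolding mix_def by simp

lemma measurable_section_lebesgue:
  fixes f :: "'a::euclidean_space \<times> 'b::euclidean_space \<Rightarrow> ennreal"
  assumes "f \<in> borel_measurable borel"
  shows "(\<lambda>x. f (x, \<xi>)) \<in> borel_measurable lebesgue"
  using measurable_compose[OF _ assms, of "\<lambda>x. (x, \<xi>)" lborel]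
  by (auto intro!: measurable_completion borel_measurable_Pair simp flip: borel_prod)

text \<open>Each Orlicz quasi-norm preserves \<open>qtri\<close>, so the inner conclusion, valid for
  almost every \<xi>, is the hypothesis of the outer step. Infinite inner quasi-norms cause no
  trouble because \<open>qtri\<close> is vacuous there.\<close>

lemma mix_qtri:
  fixes f g h :: "'a::euclidean_space \<times> 'b::euclidean_space \<Rightarrow> ennreal"
  assumes "f \<in> borel_measurable lebesgue" "g \<in> borel_measurable lebesgue"
    and tri: "AE p in lebesgue. qtri r (f p) (g p) (h p)"
  shows "qtri r (mix f) (mix g) (mix h)"
proof -
  obtain f' where f': "f' \<in> borel_measurable borel" "AE p in lebesgue. f p = f' p"
    using lebesgue_ex_borel_ennreal[OF assms(1)] by blast
  obtain g' where g': "g' \<in> borel_measurable borel" "AE p in lebesgue. g p = g' p"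
    using lebesgue_ex_borel_ennreal[OF assms(2)] by blast
  have "AE p in lebesgue. qtri r (f' p) (g' p) (h p)"
    using tri f'(2) g'(2) by eventually_elim simp
  from AE_lebesgue_sections[OF this]
  have "AE \<xi> in lebesgue. qtri r (o1.lnorm (\<lambda>x. f' (x, \<xi>))) (o1.lnorm (\<lambda>x. g' (x, \<xi>))) (o1.lnorm (\<lambda>x. h (x, \<xi>)))"
    by (rule eventually_mono) (intro o1.lnorm_qtri measurable_section_lebesgue f' g')
  then have "qtri r (mix f') (mix g') (mix h)"
    unfolding mix_def
    by (intro o2.lnorm_qtri measurable_completion) (use o1.measurable_lnorm_section f' g' in auto)
  then show ?thesis using mix_cong_AE[OF f'(2)] mix_cong_AE[OF g'(2)] by simp
qed

lemma mix_liminf: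
  fixes f :: "nat \<Rightarrow> 'a::euclidean_space \<times> 'b::euclidean_space \<Rightarrow> ennreal"
  assumes "\<And>n. f n \<in> borel_measurable lebesgue"
    and le: "AE p in lebesgue. g p \<le> liminf (\<lambda>n. f n p)"
  shows "mix g \<le> liminf (\<lambda>n. mix (f n))"
proof -
  have "\<exists>f'. f' \<in> borel_measurable borel \<and> (AE p in lebesgue. f n p = f' p)" for n
    using lebesgue_ex_borel_ennreal[OF assms(1)[of n]] by blast
  then obtain f' where f': "\<And>n. f' n \<in> borel_measurable borel" "\<And>n. AE p in lebesgue. f n p = f' n p"
    by metis
  have "AE p in lebesgue. \<forall>n. f n p = f' n p" using f'(2) by (simp add: AE_all_countable)
  with le have "AE p in lebesgue. g p \<le> liminf (\<lambda>n. f' n p)" by eventually_elim simp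
  from AE_lebesgue_sections[OF this]
  have "AE \<xi> in lebesgue. o1.lnorm (\<lambda>x. g (x, \<xi>)) \<le> liminf (\<lambda>n. o1.lnorm (\<lambda>x. f' n (x, \<xi>)))"
    by (rule eventually_mono) (intro o1.lnorm_liminf measurable_section_lebesgue f')
  then have "mix g \<le> liminf (\<lambda>n. mix (f' n))"
    unfolding mix_def
    by (intro o2.lnorm_liminf measurable_completion) (use o1.measurable_lnorm_section f' in auto)
  then show ?thesis using mix_cong_AE[OF f'(2)] by simp
qed

lemma AE_finite_if_mix_finite:
  fixes f :: "'a::euclidean_space \<times> 'b::euclidean_space \<Rightarrow> ennreal"
  assumes "f \<in> borel_measurable lebesgue" "mix f < \<infinity>"
  shows "AE p in lebesgue. f p < \<infinity>"
proof -
  obtain f' where f': "f' \<in> borel_measurable borel" "AE p in lebesgue. f p = f' p"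
    using lebesgue_ex_borel_ennreal[OF assms(1)] by blast
  have "mix f' < \<infinity>" using assms mix_cong_AE[OF f'(2)] by simp
  then have "AE \<xi> in lebesgue. o1.lnorm (\<lambda>x. f' (x, \<xi>)) < \<infinity>"
    unfolding mix_def
    by (intro o2.AE_finite_if_lnorm_finite measurable_completion) (use o1.measurable_lnorm_section f' in auto)
  then have "AE \<xi> in lebesgue. AE x in lebesgue. f' (x, \<xi>) < \<infinity>"
    by (rule eventually_mono) (intro o1.AE_finite_if_lnorm_finite measurable_section_lebesgue f')
  then have "AE p in lebesgue. f' p < \<infinity>"
    by (rule AE_lebesgue_if_sections) (use f' in measurable)
  with f'(2) show ?thesis by eventually_elim simp
qed

lemma AE_0_if_mix_0:
  fixes f :: "'a::euclidean_space \<times> 'b::euclidean_space \<Rightarrow> ennreal"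
  assumes "f \<in> borel_measurable lebesgue" "mix f = 0"
  shows "AE p in lebesgue. f p = 0"
proof -
  obtain f' where f': "f' \<in> borel_measurable borel" "AE p in lebesgue. f p = f' p"
    using lebesgue_ex_borel_ennreal[OF assms(1)] by blast
  have "mix f' = 0" using assms mix_cong_AE[OF f'(2)] by simp
  then have "AE \<xi> in lebesgue. o1.lnorm (\<lambda>x. f' (x, \<xi>)) = 0"
    unfolding mix_def
    by (intro o2.AE_0_if_lnorm_0 measurable_completion) (use o1.measurable_lnorm_section f' in auto)
  then have "AE \<xi> in lebesgue. AE x in lebesgue. f' (x, \<xi>) = 0"
    by (rule eventually_mono) (intro o1.AE_0_if_lnorm_0 measurable_section_lebesgue f')
  then have "AE p in lebesgue. f' p = 0"
    by (rule AE_lebesgue_if_sections) (use f' in measurable)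
  with f'(2) show ?thesis by eventually_elim simp
qed

text \<open>The maximum of two moduli satisfies the \<open>r\<close>-triangle inequality, so the function
  \<open>sup\<^sub>k 2\<^sup>k |s\<^sub>k\<^sub>+\<^sub>1 - s\<^sub>k|\<close> has finite quasi-norm and dominates the increments geometrically.\<close>

lemma AE_convergent_if_mix_geometric:
  fixes s :: "nat \<Rightarrow> 'a::euclidean_space \<times> 'b::euclidean_space \<Rightarrow> complex"
  assumes [measurable]: "\<And>n. s n \<in> borel_measurable lebesgue"
    and small: "\<And>k. mix (\<lambda>p. ennreal (cmod (s (Suc k) p - s k p))) \<le> ennreal ((1/4) ^ k)"
  shows "AE p in lebesgue. convergent (\<lambda>k. s k p)"
proof -
  define d where "d k p = ennreal (2 ^ k) * ennreal (cmod (s (Suc k) p - s k p))" for k p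
  define G where "G K p = (SUP k\<in>{..K}. d k p)" for K :: nat and p
  \<comment> \<open>The \<open>r\<close>-th power of 1/2. The factor \<open>2 ^ k\<close> in
    \<open>d\<close> leaves the decay \<open>(1/2) ^ k\<close> of the assumed
    \<open>(1/4) ^ k\<close>, and combining these bounds by \<open>qadd\<close> produces
    \<open>E K\<close>, controlled by the geometric series in \<open>q\<close>.\<close>
  define q where "q = 2 powr (- r)"
  define E where "E K = (\<Sum>k\<le>K. q ^ k) powr (1 / r)" for K :: nat
  have d_meas [measurable]: "d k \<in> borel_measurable lebesgue" for k unfolding d_def by measurable
  have G_meas [measurable]: "G k \<in> borel_measurable lebesgue" for k unfolding G_def by measurable
  have q: "0 < q" "q < 1" using o1.r_pos by (auto simp: q_def powr_less_one)
  have d_le: "mix (d k) \<le> ennreal ((1/2) ^ k)" for k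
  proof -
    have "mix (d k) \<le> ennreal (2 ^ k) * ennreal ((1/4) ^ k)"
      unfolding d_def using small[of k] by (subst mix_mult) (auto intro: mult_left_mono)
    also have "\<dots> = ennreal ((1/2) ^ k)" by (simp flip: ennreal_mult power_mult_distrib)
    finally show ?thesis .
  qed
  have half: "((1/2) ^ k) powr r = q ^ k" for k :: nat
    by (simp add: q_def powr_minus powr_divide powr_power inverse_eq_divide flip: powr_realpow)
       (simp add: powr_powr mult.commute)
  have E: "mix (G K) \<le> ennreal (E K)" for K
  proof (induction K)
    case 0
    have "G 0 = d 0" by (auto simp: G_def)
    then show ?case using d_le[of 0] by (simp add: E_def)
  next
    case (Suc K)
    have "G (Suc K) p = max (G K p) (d (Suc K) p)" for p
      by (simp add: G_def atMost_Suc sup_max max.commute)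
    then have "qtri r (mix (G K)) (mix (d (Suc K))) (mix (G (Suc K)))"
      by (intro mix_qtri) (auto intro: qtri_max o1.r_pos o1.r_le_1)
    moreover have fin: "mix (G K) < \<infinity>" "mix (d (Suc K)) < \<infinity>"
      using Suc d_le[of "Suc K"] by (auto simp: top_unique less_top[symmetric])
    ultimately have "mix (G (Suc K)) \<le> ennreal (qadd r (enn2real (mix (G K))) (enn2real (mix (d (Suc K)))))"
      by (simp add: qtri_def)
    also have "\<dots> \<le> ennreal (qadd r (E K) ((1/2) ^ Suc K))"
      using Suc d_le[of "Suc K"] o1.r_pos
      by (intro ennreal_leI qadd_mono enn2real_leI) (auto simp: E_def)
    also have "qadd r (E K) ((1/2) ^ Suc K) = E (Suc K)"
      unfolding qadd_def half using o1.r_pos q by (simp add: E_def powr_powr sum_nonneg)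
    finally show ?case .
  qed
  define M where "M = (1 / (1 - q)) powr (1 / r)"
  have EM: "E K \<le> M" for K
    unfolding E_def M_def using q o1.r_pos
    by (intro powr_mono2 sum_nonneg)
       (auto simp: sum_gp0 intro!: divide_right_mono)
  define g where "g p = (SUP k. d k p)" for p
  have [measurable]: "g \<in> borel_measurable lebesgue" unfolding g_def by measurable
  have "mix g \<le> liminf (\<lambda>K. mix (G K))"
  proof (rule mix_liminf)
    show "AE p in lebesgue. g p \<le> liminf (\<lambda>K. G K p)"
    proof (intro AE_I2)
      fix p
      show "g p \<le> liminf (\<lambda>K. G K p)"
        unfolding g_def
        by (intro SUP_least Liminf_bounded)
           (auto simp: G_def eventually_sequentially intro!: exI SUP_upper)
    qed
  qed auto
  also have "\<dots> \<le> ennreal M"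
    using E EM by (intro Liminf_le) (auto intro!: always_eventually order_trans[OF E] ennreal_leI)
  finally have "mix g < \<infinity>" by (auto simp: less_top[symmetric] top_unique)
  then have "AE p in lebesgue. g p < \<infinity>" by (intro AE_finite_if_mix_finite) auto
  then show ?thesis
  proof eventually_elim
    case (elim p)
    then obtain c where c: "g p = ennreal c" "0 \<le> c" by (cases "g p") auto
    have le: "cmod (s (Suc k) p - s k p) \<le> c * (1/2) ^ k" for k
    proof -
      have "ennreal (2 ^ k * cmod (s (Suc k) p - s k p)) \<le> g p"
        unfolding g_def by (rule SUP_upper2[of k]) (auto simp: d_def ennreal_mult)
      then have "2 ^ k * cmod (s (Suc k) p - s k p) \<le> c" using c by (simp add: ennreal_le_iff)
      then show ?thesis by (simp add: field_simps)
    qed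
    have "summable (\<lambda>k. s (Suc k) p - s k p)"
      by (rule summable_comparison_test'[OF summable_mult[OF summable_geometric[of "1/2::real"]]]) (use le in auto)
    then have "convergent (\<lambda>n. \<Sum>k<n. s (Suc k) p - s k p)"
      by (simp add: summable_iff_convergent)
    then have "convergent (\<lambda>n. s n p - s 0 p)" by (simp only: sum_lessThan_telescope[of "\<lambda>k. s k p"])
    then show ?case by (simp add: convergent_diff_const_right_iff)
  qed
qed

end

section \<open>Entire functions of several variables\<close>

lemma norm_vector_scalar_mult: "norm (a *s (v :: complex^'d)) = cmod a * norm v"
  by (simp add: norm_vec_def norm_mult L2_set_right_distrib)

lemma bounded_linear_scalar_mult_left: "bounded_linear (\<lambda>t. t *s (v :: complex^'d))"
  by (rule bounded_linear_intro[where K = "norm v"])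
     (auto simp: norm_vector_scalar_mult vec_eq_iff algebra_simps)

lemma entireI:
  assumes "\<And>z. (F has_derivative D z) (at z)" "\<And>z a v. D z (a *s v) = a * D z v"
  shows "entire F"
  unfolding entire_def using assms by blast

lemma entire_has_derivative:
  "entire F \<Longrightarrow> (F has_derivative frechet_derivative F (at z)) (at z)"
  unfolding entire_def by (metis differentiable_def frechet_derivative_works)

lemma entire_derivative_scale:
  "entire F \<Longrightarrow> frechet_derivative F (at z) (a *s v) = a * frechet_derivative F (at z) v"
  unfolding entire_def by (metis frechet_derivative_at)

lemma entire_continuous_on: "entire F \<Longrightarrow> continuous_on S F"
  by (meson continuous_at_imp_continuous_on entire_has_derivative has_derivative_continuous)

lemma entire_bounded:
  assumes "entire F"
  obtains M where "\<And>z. norm z \<le> R \<Longrightarrow> cmod (F z) \<le> M"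
proof -
  have "bounded (F ` cball 0 R)"
    by (intro compact_imp_bounded compact_continuous_image entire_continuous_on assms compact_cball)
  then show ?thesis using that unfolding bounded_iff by (metis imageI mem_cball_0)
qed

lemma entire_const: "entire (\<lambda>z. c)"
  by (rule entireI[where D = "\<lambda>z v. 0"]) auto

lemma entire_coord: "entire (\<lambda>z. z $ j)"
  by (rule entireI[where D = "\<lambda>z v. v $ j"])
     (auto intro!: bounded_linear_imp_has_derivative bounded_linear_vec_nth)

lemma entire_add: "entire F \<Longrightarrow> entire G \<Longrightarrow> entire (\<lambda>z. F z + G z)"
  by (rule entireI, rule has_derivative_add)
     (auto intro: entire_has_derivative simp: entire_derivative_scale distrib_left)

lemma entire_diff: "entire F \<Longrightarrow> entire G \<Longrightarrow> entire (\<lambda>z. F z - G z)"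
  by (rule entireI, rule has_derivative_diff)
     (auto intro: entire_has_derivative simp: entire_derivative_scale right_diff_distrib)

lemma entire_mult: "entire F \<Longrightarrow> entire G \<Longrightarrow> entire (\<lambda>z. F z * G z)"
  by (rule entireI, rule has_derivative_mult)
     (auto intro: entire_has_derivative simp: entire_derivative_scale algebra_simps)

lemma entire_sum: "(\<And>i. i \<in> A \<Longrightarrow> entire (F i)) \<Longrightarrow> entire (\<lambda>z. \<Sum>i\<in>A. F i z)"
  by (induction A rule: infinite_finite_induct) (auto intro: entire_const entire_add)

lemma entire_prod: "(\<And>i. i \<in> A \<Longrightarrow> entire (F i)) \<Longrightarrow> entire (\<lambda>z. \<Prod>i\<in>A. F i z)"
  by (induction A rule: infinite_finite_induct) (auto intro: entire_const entire_mult)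

lemma entire_power: "entire F \<Longrightarrow> entire (\<lambda>z. F z ^ n)"
  by (induction n) (auto intro: entire_const entire_mult)

lemma entire_compose_linear:
  assumes "entire F" "linear L" "\<And>a v. L (a *s v) = a *s L v"
  shows "entire (\<lambda>z. F (L z + b))"
proof (rule entireI)
  fix z
  have "(L has_derivative L) (at z)"
    using assms(2) by (simp add: linear_conv_bounded_linear bounded_linear_imp_has_derivative)
  then have "((\<lambda>z. L z + b) has_derivative L) (at z)"
    by (simp add: has_derivative_add_const)
  from has_derivative_compose[OF this entire_has_derivative[OF assms(1)]]
  show "((\<lambda>z. F (L z + b)) has_derivative (\<lambda>v. frechet_derivative F (at (L z + b)) (L v))) (at z)" .
qed (simp add: assms entire_derivative_scale)

lemma entire_line:
  assumes "entire F"
  shows "((\<lambda>t. F (z + t *s v)) has_field_derivative frechet_derivative F (at (z + t *s v)) v) (at t)"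
proof -
  have "((\<lambda>t. z + t *s v) has_derivative (\<lambda>t. t *s v)) (at t)"
    using bounded_linear_imp_has_derivative[OF bounded_linear_scalar_mult_left]
    by (auto intro!: derivative_eq_intros)
  from has_derivative_compose[OF this entire_has_derivative[OF assms]]
  show ?thesis
    unfolding has_field_derivative_def
    by (rule has_derivative_eq_rhs) (auto simp: entire_derivative_scale[OF assms])

qed

lemma entire_line_holomorphic: "entire F \<Longrightarrow> (\<lambda>t. F (z + t *s v)) holomorphic_on S"
  unfolding holomorphic_on_def field_differentiable_def
  by (blast intro: has_field_derivative_at_within entire_line)

text \<open>Cauchy's inequality for the restriction of \<open>F\<close> to the complex line through
  \<open>z\<close> in direction \<open>v\<close>. The parameter radius
  \<open>\<delta> / norm v\<close> corresponds to distance \<delta> from \<open>z\<close>.\<close>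

lemma entire_derivative_bound:
  assumes F: "entire F" and "0 < \<delta>" and M: "\<And>w. w \<in> cball z \<delta> \<Longrightarrow> cmod (F w) \<le> M"
  shows "cmod (frechet_derivative F (at z) v) \<le> M / \<delta> * norm v"
proof (cases "v = 0")
  case True
  then have "frechet_derivative F (at z) v = 0"
    using entire_derivative_scale[OF F, of z 0 v] by simp
  then show ?thesis using True by simp
next
  case False
  define \<rho> where "\<rho> = \<delta> / norm v"
  have \<rho>: "0 < \<rho>" using False assms by (simp add: \<rho>_def)
  let ?g = "\<lambda>t. F (z + t *s v)"
  have "cmod ((deriv ^^ 1) ?g 0) \<le> fact 1 * M / \<rho> ^ 1"
  proof (rule Cauchy_inequality)
    show "continuous_on (cball 0 \<rho>) ?g"
      by (intro holomorphic_on_imp_continuous_on entire_line_holomorphic F)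
    fix t :: complex assume "cmod (0 - t) = \<rho>"
    then show "cmod (?g t) \<le> M"
      using False by (intro M) (simp add: \<rho>_def norm_vector_scalar_mult dist_norm)
  qed (use \<rho> F in \<open>auto intro: entire_line_holomorphic\<close>)
  moreover have "deriv ?g 0 = frechet_derivative F (at z) v"
    using DERIV_imp_deriv[OF entire_line[OF F, of z v 0]] by simp
  ultimately show ?thesis by (simp add: \<rho>_def)
qed

lemma uniformly_convergent_Cauchy_bound:
  fixes f :: "nat \<Rightarrow> 'a \<Rightarrow> complex"
  assumes "uniform_limit S f F sequentially" "0 < e"
  obtains N where "\<And>m n x. m \<ge> N \<Longrightarrow> n \<ge> N \<Longrightarrow> x \<in> S \<Longrightarrow> cmod (f m x - f n x) \<le> e"
proof -
  have "eventually (\<lambda>n. \<forall>x\<in>S. dist (f n x) (F x) < e / 2) sequentially"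
    using uniform_limitD[OF assms(1), of "e / 2"] assms(2) by simp
  then obtain N where N: "\<And>n x. n \<ge> N \<Longrightarrow> x \<in> S \<Longrightarrow> dist (f n x) (F x) < e / 2"
    by (auto simp: eventually_sequentially)
  show ?thesis
  proof (rule that)
    fix m n x assume "m \<ge> N" "n \<ge> N" "x \<in> S"
    then have "dist (f m x) (f n x) < e"
      using N[of m x] N[of n x] by (metis dist_triangle_half_l)
    then show "cmod (f m x - f n x) \<le> e" by (simp add: dist_norm)
  qed
qed

text \<open>By the Cauchy estimate, uniform closeness of the functions forces uniform closeness of
  their derivatives on a smaller ball. Differentiation then commutes with the limit, and complex
  linearity of the derivative passes to it.\<close>

lemma entire_uniform_limit:
  fixes f :: "nat \<Rightarrow> complex^'d \<Rightarrow> complex"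
  assumes f: "\<And>n::nat. entire (f n)"
    and lim: "\<And>R. uniform_limit (cball 0 R) f F sequentially"
  shows "entire F"
  unfolding entire_def
proof
  fix z :: "complex^'d"
  let ?D = "\<lambda>n w. frechet_derivative (f n) (at w)"
  define S where "S = cball z 1"
  have cauchy: "\<exists>N. \<forall>m\<ge>N. \<forall>n\<ge>N. \<forall>w\<in>S. \<forall>h. cmod (?D m w h - ?D n w h) \<le> e * norm h" if "0 < e" for e
  proof -
    \<comment> \<open>Radius 1 for the ball \<open>S\<close> plus radius 1 for the Cauchy estimate
      around its points.\<close>
    from uniformly_convergent_Cauchy_bound[OF lim[of "norm z + 2"] \<open>0 < e\<close>]
    obtain N where N: "\<And>m n x. m \<ge> N \<Longrightarrow> n \<ge> N \<Longrightarrow> x \<in> cball 0 (norm z + 2) \<Longrightarrow> cmod (f m x - f n x) \<le> e"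
      by blast
    have "cmod (?D m w h - ?D n w h) \<le> e * norm h" if "m \<ge> N" "n \<ge> N" "w \<in> S" for m n w h
    proof -
      have "((\<lambda>w. f m w - f n w) has_derivative (\<lambda>h. ?D m w h - ?D n w h)) (at w)"
        by (intro has_derivative_diff entire_has_derivative f)
      then have "(\<lambda>h. ?D m w h - ?D n w h) = frechet_derivative (\<lambda>w. f m w - f n w) (at w)"
        by (rule frechet_derivative_at)
      then have eq: "frechet_derivative (\<lambda>w. f m w - f n w) (at w) h = ?D m w h - ?D n w h"
        by (simp only: fun_eq_iff)
      have "cmod (frechet_derivative (\<lambda>w. f m w - f n w) (at w) h) \<le> e / 1 * norm h"
      proof (rule entire_derivative_bound)
        fix x assume "x \<in> cball w 1"
        then have "norm x \<le> norm z + 2"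
          using \<open>w \<in> S\<close> unfolding S_def mem_cball dist_norm
          by (smt (verit, ccfv_threshold) norm_minus_commute norm_triangle_sub)
        then show "cmod (f m x - f n x) \<le> e" using N that by simp
      qed (auto intro: entire_diff f)
      then show ?thesis by (simp add: eq)
    qed
    then show ?thesis by blast
  qed
  define g' where "g' w h = lim (\<lambda>n. ?D n w h)" for w h
  have tends: "(\<lambda>n. ?D n w h) \<longlonglongrightarrow> g' w h" if "w \<in> S" for w h
  proof -
    have "Cauchy (\<lambda>n. ?D n w h)"
    proof (rule CauchyI)
      fix e :: real assume "0 < e"
      then have "0 < e / (norm h + 1)" by (simp add: add_nonneg_pos)
      from cauchy[OF this] obtain N where
        N: "\<And>m n. m \<ge> N \<Longrightarrow> n \<ge> N \<Longrightarrow> cmod (?D m w h - ?D n w h) \<le> e / (norm h + 1) * norm h"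
        using \<open>w \<in> S\<close> by blast
      have "e / (norm h + 1) * norm h < e"
        using \<open>0 < e\<close> by (simp add: divide_simps add_nonneg_pos)
      then show "\<exists>M. \<forall>m\<ge>M. \<forall>n\<ge>M. cmod (?D m w h - ?D n w h) < e"
        by (intro exI[of _ N] allI impI order_le_less_trans[OF N])
    qed
    then show ?thesis
      unfolding g'_def using Cauchy_convergent convergent_LIMSEQ_iff by blast
  qed
  have "\<exists>g. \<forall>x\<in>S. (\<lambda>n. f n x) \<longlonglongrightarrow> g x \<and> (g has_derivative g' x) (at x within S)"
  proof (rule has_derivative_sequence)
    show "convex S" by (simp add: S_def)
    show "(f n has_derivative ?D n x) (at x within S)" for n x
      by (rule has_derivative_at_withinI) (rule entire_has_derivative[OF f])
    show "z \<in> S" by (simp add: S_def)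
    show "(\<lambda>n. f n z) \<longlonglongrightarrow> F z"
      by (rule tendsto_uniform_limitI[OF lim[of "norm z"]]) simp
    fix e :: real assume "0 < e"
    from cauchy[OF this] obtain N where
      N: "\<And>m n w h. m \<ge> N \<Longrightarrow> n \<ge> N \<Longrightarrow> w \<in> S \<Longrightarrow> cmod (?D m w h - ?D n w h) \<le> e * norm h"
      by blast
    show "\<forall>\<^sub>F n in sequentially. \<forall>x\<in>S. \<forall>h. norm (?D n x h - g' x h) \<le> e * norm h"
      unfolding eventually_sequentially
    proof (intro exI[of _ N] allI impI ballI)
      fix n x h assume "N \<le> n" "x \<in> S"
      have "(\<lambda>m. cmod (?D n x h - ?D m x h)) \<longlonglongrightarrow> cmod (?D n x h - g' x h)"
        by (intro tendsto_intros tends \<open>x \<in> S\<close>)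
      then show "norm (?D n x h - g' x h) \<le> e * norm h"
        by (rule LIMSEQ_le_const2) (use N \<open>N \<le> n\<close> \<open>x \<in> S\<close> in blast)
    qed
  qed
  then obtain g where g: "\<And>x. x \<in> S \<Longrightarrow> (\<lambda>n. f n x) \<longlonglongrightarrow> g x"
      "\<And>x. x \<in> S \<Longrightarrow> (g has_derivative g' x) (at x within S)" by blast
  have gF: "g x = F x" if "x \<in> S" for x
    using g(1)[OF that] tendsto_uniform_limitI[OF lim[of "norm x"], of x]
    by (intro LIMSEQ_unique) auto
  have z: "z \<in> interior S" by (simp add: S_def)
  have "(g has_derivative g' z) (at z)"
    using g(2)[of z] at_within_interior[OF z] by (simp add: S_def)
  then have "(F has_derivative g' z) (at z)"
    by (rule has_derivative_transform_within_open[where s = "interior S"])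
       (use z gF interior_subset in auto)
  moreover have "g' z (a *s v) = a * g' z v" for a v
  proof (rule LIMSEQ_unique)
    show "(\<lambda>n. ?D n z (a *s v)) \<longlonglongrightarrow> g' z (a *s v)" by (rule tends) (simp add: S_def)
    have "(\<lambda>n. a * ?D n z v) \<longlonglongrightarrow> a * g' z v"
      by (intro tendsto_intros tends) (simp add: S_def)
    then show "(\<lambda>n. ?D n z (a *s v)) \<longlonglongrightarrow> a * g' z v" by (simp add: entire_derivative_scale[OF f])
  qed
  ultimately show "\<exists>D. (F has_derivative D) (at z) \<and> (\<forall>a v. D (a *s v) = a * D v)" by blast
qed

section \<open>Complex partial derivatives\<close>

definition cderiv :: "'d \<Rightarrow> (complex^'d \<Rightarrow> complex) \<Rightarrow> complex^'d \<Rightarrow> complex" where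
  "cderiv j F z = frechet_derivative F (at z) (axis j 1)"

text \<open>The complex difference quotients are entire and converge locally uniformly: Taylor's
  formula along the coordinate line leaves an error of the order of the increment, the second
  derivative being bounded by Cauchy's inequality.\<close>

lemma entire_cderiv:
  fixes F :: "complex^'d \<Rightarrow> complex"
  assumes F: "entire F"
  shows "entire (cderiv j F)"
proof (rule entire_uniform_limit)
  \<comment> \<open>The shift by 2 makes every increment nonzero and at most 1/2, inside the disc on
    which Taylor's formula is applied.\<close>
  define \<epsilon> :: "nat \<Rightarrow> complex" where "\<epsilon> n = of_real (1 / real (n + 2))" for n
  let ?e = "axis j 1 :: complex^'d"
  let ?f = "\<lambda>n z. (1 / \<epsilon> n) * (F (z + \<epsilon> n *s ?e) - F z)"
  show "entire (?f n)" for n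
    using entire_compose_linear[OF F linear_id, of "\<epsilon> n *s ?e"]
    by (intro entire_mult entire_diff entire_const F) auto
  fix R :: real
  obtain M where M: "\<And>z. norm z \<le> R + 1 \<Longrightarrow> cmod (F z) \<le> M" using entire_bounded[OF F] by blast
  have eps: "\<epsilon> n \<noteq> 0" "cmod (\<epsilon> n) = 1 / real (n + 2)" "\<epsilon> n \<in> cball 0 (1/2)" for n
  proof -
    show e: "cmod (\<epsilon> n) = 1 / real (n + 2)" unfolding \<epsilon>_def norm_of_real by simp
    then show "\<epsilon> n \<noteq> 0" by auto
    show "\<epsilon> n \<in> cball 0 (1/2)" 
    proof -
      have "1 / real (n + 2) \<le> 1 / 2" by (rule divide_left_mono) auto
      then show ?thesis unfolding mem_cball_0 e .
    qed
  qed
  have bound: "cmod (?f n z - cderiv j F z) \<le> 8 * M / real (n + 2)" if "z \<in> cball 0 R" for n z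
  proof -
    let ?g = "\<lambda>t. F (z + t *s ?e)"
    have holo: "?g holomorphic_on S" for S by (rule entire_line_holomorphic[OF F])
    have "cmod ((deriv ^^ 0) ?g (\<epsilon> n) - (\<Sum>i\<le>1. (deriv ^^ i) ?g 0 * (\<epsilon> n - 0) ^ i / fact i)) \<le> 8 * M * cmod (\<epsilon> n - 0) ^ Suc 1 / fact 1"
    proof (rule complex_Taylor[of "cball 0 (1/2)" 1 "\<lambda>i. (deriv ^^ i) ?g"])
      show "((deriv ^^ i) ?g has_field_derivative (deriv ^^ Suc i) ?g x) (at x within cball 0 (1/2))" for i x
      proof -
        have "((deriv ^^ i) ?g has_field_derivative deriv ((deriv ^^ i) ?g) x) (at x)"
          by (rule holomorphic_derivI[OF holomorphic_higher_deriv[OF holo[of UNIV] open_UNIV]]) auto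
        then show ?thesis by (simp add: has_field_derivative_at_within)
      qed
      fix x :: complex assume x: "x \<in> cball 0 (1/2)"
      \<comment> \<open>Circles of radius 1/2 about points of this disc stay in the unit disc, where
        \<open>F\<close> is bounded by \<open>M\<close> along the line. The resulting bound is the
        origin of the constant \<open>8 * M\<close>.\<close>
      have "cmod ((deriv ^^ 2) ?g x) \<le> fact 2 * M / (1/2) ^ 2"
      proof (rule Cauchy_inequality)
        fix t assume t: "cmod (x - t) = 1/2"
        have "cmod t \<le> 1"
          using t x norm_triangle_ineq3[of x t] norm_triangle_ineq4[of x "x - t"] by simp
        then have "norm (z + t *s ?e) \<le> R + 1"
          using norm_triangle_ineq[of z "t *s ?e"] that by (simp add: norm_vector_scalar_mult)
        then show "cmod (?g t) \<le> M" by (rule M)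
      qed (auto intro: holo holomorphic_on_imp_continuous_on)
      then show "cmod ((deriv ^^ Suc 1) ?g x) \<le> 8 * M"
        by (simp add: numeral_2_eq_2 power2_eq_square)
    qed (use eps in auto)
    moreover have "deriv ?g 0 = cderiv j F z"
      using DERIV_imp_deriv[OF entire_line[OF F, of z ?e 0]] by (simp add: cderiv_def)
    ultimately have 1: "cmod (?g (\<epsilon> n) - (F z + cderiv j F z * \<epsilon> n)) \<le> 8 * M * cmod (\<epsilon> n) ^ 2"
      by (simp add: power2_eq_square)
    have "?f n z - cderiv j F z = (?g (\<epsilon> n) - (F z + cderiv j F z * \<epsilon> n)) / \<epsilon> n"
      using eps(1)[of n] by (simp add: field_simps)
    then have "cmod (?f n z - cderiv j F z) = cmod (?g (\<epsilon> n) - (F z + cderiv j F z * \<epsilon> n)) / cmod (\<epsilon> n)"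
      by (simp add: norm_divide)
    also have "\<dots> \<le> 8 * M * cmod (\<epsilon> n) ^ 2 / cmod (\<epsilon> n)"
      by (intro divide_right_mono 1) auto
    also have "\<dots> = 8 * M / real (n + 2)"
      using eps(1)[of n] eps(2)[of n] by (simp add: power2_eq_square)
    finally show ?thesis .
  qed
  have "(\<lambda>n. 8 * M / real (n + 2)) \<longlonglongrightarrow> 0" by real_asymp
  then show "uniform_limit (cball 0 R) ?f (cderiv j F) sequentially"
    unfolding uniform_limit_iff
  proof (intro allI impI)
    fix e :: real assume "0 < e"
    with \<open>(\<lambda>n. 8 * M / real (n + 2)) \<longlonglongrightarrow> 0\<close>
    have "eventually (\<lambda>n. 8 * M / real (n + 2) < e) sequentially"
      by (rule order_tendstoD)
    then show "\<forall>\<^sub>F n in sequentially. \<forall>z\<in>cball 0 R. dist (?f n z) (cderiv j F z) < e"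
    proof eventually_elim
      case (elim n)
      then show ?case using bound[of _ n] unfolding dist_norm by (meson order_le_less_trans)
    qed
  qed
qed

section \<open>Taylor coefficients\<close>

definition set_coord :: "'d \<Rightarrow> complex \<Rightarrow> complex^'d \<Rightarrow> complex^'d" where
  "set_coord j w z = (\<chi> k. if k = j then w else z $ k)"

lemma set_coord_nth [simp]: "set_coord j w z $ k = (if k = j then w else z $ k)"
  by (simp add: set_coord_def)

lemma set_coord_self [simp]: "set_coord j (z $ j) z = z"
  by (simp add: vec_eq_iff)

lemma set_coord_twice [simp]: "set_coord j w (set_coord j w' z) = set_coord j w z"
  by (simp add: vec_eq_iff)

lemma set_coord_eq: "set_coord j w z = set_coord j 0 z + w *s axis j 1"
  by (simp add: vec_eq_iff axis_def)

lemma entire_coord_line: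
  assumes "entire F"
  shows "((\<lambda>w. F (set_coord j w z)) has_field_derivative cderiv j F (set_coord j w z)) (at w)"
  using entire_line[OF assms, of "set_coord j 0 z" "axis j 1" w]
  unfolding cderiv_def set_coord_eq[symmetric] .

lemma entire_coord_line_holomorphic: "entire F \<Longrightarrow> (\<lambda>w. F (set_coord j w z)) holomorphic_on S"
  unfolding holomorphic_on_def field_differentiable_def
  by (blast intro: has_field_derivative_at_within entire_coord_line)

lemma entire_cderiv_funpow: "entire F \<Longrightarrow> entire ((cderiv j ^^ n) F)"
  by (induction n) (auto intro: entire_cderiv)

text \<open>One-variable derivatives in one coordinate thereby become values of iterated partial
  derivatives, which are entire in all variables; this is what makes coefficient extraction
  iterable.\<close>

lemma higher_deriv_coord_line:
  assumes "entire F"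
  shows "(deriv ^^ n) (\<lambda>w. F (set_coord j w z)) = (\<lambda>w. (cderiv j ^^ n) F (set_coord j w z))"
proof (induction n)
  case (Suc n)
  show ?case
    by (simp add: Suc fun_eq_iff DERIV_imp_deriv[OF entire_coord_line[OF entire_cderiv_funpow[OF assms]]])
qed simp

text \<open>The \<open>n\<close>-th Taylor coefficient in the \<open>j\<close>-th variable at \<open>0\<close>, as an entire function of the
  remaining variables.\<close>

definition coord_coeff :: "'d \<Rightarrow> nat \<Rightarrow> (complex^'d \<Rightarrow> complex) \<Rightarrow> complex^'d \<Rightarrow> complex" where
  "coord_coeff j n F z = (deriv ^^ n) (\<lambda>w. F (set_coord j w z)) 0 / fact n"

lemma coord_coeff_set_coord [simp]: "coord_coeff j n F (set_coord j w z) = coord_coeff j n F z"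
  by (simp add: coord_coeff_def)

lemma entire_coord_coeff:
  fixes F :: "complex^'d \<Rightarrow> complex"
  assumes "entire F"
  shows "entire (coord_coeff j n F)"
proof -
  have "linear (set_coord j 0 :: complex^'d \<Rightarrow> complex^'d)"
    by (intro linearI) (simp_all add: vec_eq_iff)
  moreover have "set_coord j 0 (a *s v) = a *s set_coord j 0 v" for a and v :: "complex^'d"
    by (simp add: vec_eq_iff)
  ultimately have "entire (\<lambda>z. (cderiv j ^^ n) F (set_coord j 0 z + 0))"
    by (rule entire_compose_linear[OF entire_cderiv_funpow[OF assms]])
  from entire_mult[OF entire_const[of "1 / fact n"] this] show ?thesis
    by (simp add: coord_coeff_def[abs_def] higher_deriv_coord_line[OF assms])
qed

lemma coord_coeff_bound:
  assumes "entire F" "0 < R" "\<And>w. cmod w \<le> R \<Longrightarrow> cmod (F (set_coord j w z)) \<le> M"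
  shows "cmod (coord_coeff j n F z) \<le> M / R ^ n"
proof -
  have "cmod ((deriv ^^ n) (\<lambda>w. F (set_coord j w z)) 0) \<le> fact n * M / R ^ n"
    by (rule Cauchy_inequality)
       (use assms in \<open>auto intro: entire_coord_line_holomorphic holomorphic_on_imp_continuous_on\<close>)
  then show ?thesis by (simp add: coord_coeff_def norm_divide field_simps)
qed

lemma coord_coeff_add:
  assumes "entire F" "entire G"
  shows "coord_coeff j n (\<lambda>z. F z + G z) = (\<lambda>z. coord_coeff j n F z + coord_coeff j n G z)"
  unfolding coord_coeff_def[abs_def]
  by (subst higher_deriv_add[of _ UNIV])
     (auto intro: entire_coord_line_holomorphic assms simp: add_divide_distrib)

lemma coord_coeff_diff:
  assumes "entire F" "entire G"
  shows "coord_coeff j n (\<lambda>z. F z - G z) = (\<lambda>z. coord_coeff j n F z - coord_coeff j n G z)"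
  unfolding coord_coeff_def[abs_def]
  by (subst higher_deriv_diff[of _ UNIV])
     (auto intro: entire_coord_line_holomorphic assms simp: diff_divide_distrib)

lemma eq_0_if_coord_coeff_0:
  assumes F: "entire F" and "\<And>n. coord_coeff j n F z = 0"
  shows "F z = 0"
proof -
  have "(\<lambda>n. (deriv ^^ n) (\<lambda>w. F (set_coord j w z)) 0 / fact n * (z $ j - 0) ^ n) sums F (set_coord j (z $ j) z)"
    by (rule holomorphic_power_series[of _ 0 "cmod (z $ j) + 1"])
       (auto intro: entire_coord_line_holomorphic F)
  moreover have "(deriv ^^ n) (\<lambda>w. F (set_coord j w z)) 0 / fact n = 0" for n
    using assms(2)[of n] by (simp add: coord_coeff_def)
  ultimately have "(\<lambda>n. 0) sums F z" by simp
  then show ?thesis using sums_unique2[OF _ sums_zero] by blast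
qed

section \<open>Monomials and iterated coefficient extraction\<close>

definition vmonom :: "nat^'d \<Rightarrow> complex^'d \<Rightarrow> complex" where
  "vmonom \<beta> z = (\<Prod>k\<in>UNIV. z $ k ^ (\<beta> $ k))"

lemma entire_vmonom: "entire (vmonom \<beta>)"
  unfolding vmonom_def[abs_def] by (intro entire_prod entire_power entire_coord)

lemma norm_vmonom_le:
  assumes "\<And>k. cmod (z $ k) \<le> R"
  shows "cmod (vmonom \<beta> z) \<le> R ^ mi_abs \<beta>"
proof -
  have "cmod (vmonom \<beta> z) = (\<Prod>k\<in>UNIV. cmod (z $ k) ^ (\<beta> $ k))"
    by (simp add: vmonom_def norm_power flip: prod_norm)
  also have "\<dots> \<le> (\<Prod>k\<in>UNIV. R ^ (\<beta> $ k))"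
    by (intro prod_mono) (auto intro: power_mono assms)
  also have "\<dots> = R ^ mi_abs \<beta>" by (simp add: mi_abs_def power_sum)
  finally show ?thesis .
qed

lemma higher_deriv_monomial_0:
  "(deriv ^^ n) (\<lambda>w. c * w ^ m) 0 / fact n = (if m = n then c else (0::complex))"
proof -
  have "(deriv ^^ n) (\<lambda>w. c * w ^ m) 0 = c * (deriv ^^ n) (\<lambda>w. w ^ m) 0"
    by (rule higher_deriv_cmult[of _ UNIV]) (auto intro!: holomorphic_intros)
  also have "(deriv ^^ n) (\<lambda>w. w ^ m) 0 = pochhammer (of_nat (Suc m - n)) n * (0::complex) ^ (m - n)"
    using higher_deriv_power[of n "0::complex" m 0] by simp
  also have "\<dots> = (if m = n then fact n else 0)"
  proof (cases m n rule: linorder_cases)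
    case less
    then have "Suc m - n = 0" "n > 0" by auto
    then show ?thesis using less by (simp add: pochhammer_0_left)
  next
    case equal
    have "Suc n - n = 1" by simp
    then show ?thesis using equal by (simp add: pochhammer_fact)
  next
    case greater
    then show ?thesis by simp
  qed
  finally show ?thesis by (auto simp: field_simps)
qed

text \<open>Records the exponents left in a monomial once the variables in \<open>J\<close> have
  been expanded.\<close>

definition zero_on :: "'d set \<Rightarrow> nat^'d \<Rightarrow> nat^'d" where
  "zero_on J \<beta> = (\<chi> k. if k \<in> J then 0 else \<beta> $ k)"

lemma coord_coeff_vmonom:
  "coord_coeff j n (\<lambda>z. a * vmonom \<beta> z) = (\<lambda>z. (if \<beta> $ j = n then a else 0) * vmonom (zero_on {j} \<beta>) z)"
proof
  fix z
  have "vmonom \<beta> (set_coord j w z) = vmonom (zero_on {j} \<beta>) z * w ^ (\<beta> $ j)" for w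
    unfolding vmonom_def
    by (subst (1 2) prod.remove[of UNIV j]) (auto simp: zero_on_def intro!: prod.cong)
  then have "(\<lambda>w. a * vmonom \<beta> (set_coord j w z)) = (\<lambda>w. a * vmonom (zero_on {j} \<beta>) z * w ^ (\<beta> $ j))"
    by (simp add: fun_eq_iff mult.assoc)
  then show "coord_coeff j n (\<lambda>z. a * vmonom \<beta> z) z = (if \<beta> $ j = n then a else 0) * vmonom (zero_on {j} \<beta>) z"
    by (simp add: coord_coeff_def higher_deriv_monomial_0)
qed

text \<open>The multivariate coefficient as successive one-variable coefficients. The result is kept
  as a function of the whole vector so that a variable can be expanded without changing the
  type.\<close>

fun coeff_list :: "'d list \<Rightarrow> nat^'d \<Rightarrow> (complex^'d \<Rightarrow> complex) \<Rightarrow> complex^'d \<Rightarrow> complex" where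
  "coeff_list [] \<alpha> F = F"
| "coeff_list (j # js) \<alpha> F = coeff_list js \<alpha> (coord_coeff j (\<alpha> $ j) F)"

lemma coeff_list_cong:
  "(\<And>j. j \<in> set js \<Longrightarrow> \<alpha> $ j = \<beta> $ j) \<Longrightarrow> coeff_list js \<alpha> F = coeff_list js \<beta> F"
  by (induction js arbitrary: F) auto

lemma coeff_list_add:
  "entire F \<Longrightarrow> entire G \<Longrightarrow>
    coeff_list js \<alpha> (\<lambda>z. F z + G z) = (\<lambda>z. coeff_list js \<alpha> F z + coeff_list js \<alpha> G z)"
  by (induction js arbitrary: F G) (auto simp: coord_coeff_add entire_coord_coeff)

lemma coeff_list_diff:
  "entire F \<Longrightarrow> entire G \<Longrightarrow>
    coeff_list js \<alpha> (\<lambda>z. F z - G z) = (\<lambda>z. coeff_list js \<alpha> F z - coeff_list js \<alpha> G z)"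
  by (induction js arbitrary: F G) (auto simp: coord_coeff_diff entire_coord_coeff)

text \<open>One Cauchy estimate per coordinate. A polydisc is the right domain because replacing one
  coordinate within radius \<open>R\<close> does not leave it.\<close>

lemma coeff_list_bound:
  assumes "entire F" "0 < R" "\<And>z. (\<And>k. cmod (z $ k) \<le> R) \<Longrightarrow> cmod (F z) \<le> M"
    and "\<And>k. cmod (z $ k) \<le> R"
  shows "cmod (coeff_list js \<alpha> F z) \<le> M / R ^ (\<Sum>j\<leftarrow>js. \<alpha> $ j)"
  using assms
proof (induction js arbitrary: F M)
  case (Cons j js)
  have "cmod (coeff_list js \<alpha> (coord_coeff j (\<alpha> $ j) F) z) \<le> M / R ^ (\<alpha> $ j) / R ^ (\<Sum>j\<leftarrow>js. \<alpha> $ j)"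
    by (rule Cons.IH) (use Cons.prems in \<open>auto intro!: entire_coord_coeff coord_coeff_bound\<close>)
  then show ?case by (simp add: power_add)
qed simp

lemma coeff_list_vmonom:
  "distinct js \<Longrightarrow> coeff_list js \<alpha> (\<lambda>z. a * vmonom \<beta> z) =
    (\<lambda>z. (if \<forall>j\<in>set js. \<alpha> $ j = \<beta> $ j then a else 0) * vmonom (zero_on (set js) \<beta>) z)"
proof (induction js arbitrary: a \<beta>)
  case Nil
  have "zero_on {} \<beta> = \<beta>" by (simp add: zero_on_def vec_eq_iff)
  then show ?case by simp
next
  case (Cons j js)
  have "zero_on (set js) (zero_on {j} \<beta>) = zero_on (insert j (set js)) \<beta>"
    by (auto simp: zero_on_def vec_eq_iff)
  moreover have "(\<forall>k\<in>set js. \<alpha> $ k = zero_on {j} \<beta> $ k) \<longleftrightarrow> (\<forall>k\<in>set js. \<alpha> $ k = \<beta> $ k)"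
    using Cons.prems by (auto simp: zero_on_def)
  ultimately show ?case
    using Cons by (auto simp: coord_coeff_vmonom)
qed

text \<open>\<open>F\<close> is recovered from its expansion in the first listed variable. The
  coefficients no longer depend on that variable, so it may be reset to its value in
  \<open>w\<close>, which brings the induction hypothesis into play with one coordinate
  fewer.\<close>

lemma eq_0_if_coeff_list_0:
  assumes "entire F" "distinct js" "\<And>\<alpha>. coeff_list js \<alpha> F w = 0" "\<And>k. k \<notin> set js \<Longrightarrow> z $ k = w $ k"
  shows "F z = 0"
  using assms
proof (induction js arbitrary: F z)
  case Nil
  then have "z = w" by (simp add: vec_eq_iff)
  then show ?case using Nil.prems(3) by simp
next
  case (Cons j js)
  show ?case
  proof (rule eq_0_if_coord_coeff_0[OF \<open>entire F\<close>])
    fix n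
    have "coord_coeff j n F (set_coord j (w $ j) z) = 0"
    proof (rule Cons.IH)
      fix \<alpha> :: "nat^'a"
      \<comment> \<open>Prescribes the order \<open>n\<close> in the coordinate already expanded; by
        distinctness the remaining list does not see this change.\<close>
      define \<beta> where "\<beta> = (\<chi> k. if k = j then n else \<alpha> $ k)"
      have "coeff_list js \<alpha> (coord_coeff j n F) = coeff_list js \<beta> (coord_coeff j n F)"
        using Cons.prems(2) by (intro coeff_list_cong) (auto simp: \<beta>_def)
      then show "coeff_list js \<alpha> (coord_coeff j n F) w = 0"
        using Cons.prems(3)[of \<beta>] by (simp add: \<beta>_def)
    qed (use Cons.prems in \<open>auto intro: entire_coord_coeff\<close>)
    then show "coord_coeff j n F z = 0" by simp
  qed
qed

definition taylor_coeff :: "nat^'d \<Rightarrow> (complex^'d \<Rightarrow> complex) \<Rightarrow> complex" where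
  "taylor_coeff \<alpha> F = coeff_list (SOME js. distinct js \<and> set js = UNIV) \<alpha> F 0"

lemma some_enumeration:
  defines "js \<equiv> SOME js. distinct js \<and> set js = (UNIV :: 'd::finite set)"
  shows "distinct js" "set js = UNIV"
proof -
  have "\<exists>js. distinct js \<and> set js = (UNIV :: 'd set)"
    using finite_distinct_list[of "UNIV :: 'd set"] by auto
  from someI_ex[OF this] show "distinct js" "set js = UNIV" by (auto simp: js_def)
qed

lemma taylor_coeff_add:
  "entire F \<Longrightarrow> entire G \<Longrightarrow> taylor_coeff \<alpha> (\<lambda>z. F z + G z) = taylor_coeff \<alpha> F + taylor_coeff \<alpha> G"
  by (simp add: taylor_coeff_def coeff_list_add)

lemma taylor_coeff_diff:
  "entire F \<Longrightarrow> entire G \<Longrightarrow> taylor_coeff \<alpha> (\<lambda>z. F z - G z) = taylor_coeff \<alpha> F - taylor_coeff \<alpha> G"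
  by (simp add: taylor_coeff_def coeff_list_diff)

lemma taylor_coeff_bound:
  assumes "entire F" "0 < R" "\<And>z. (\<And>k. cmod (z $ k) \<le> R) \<Longrightarrow> cmod (F z) \<le> M"
  shows "cmod (taylor_coeff \<alpha> F) \<le> M / R ^ mi_abs \<alpha>"
proof -
  have "mi_abs \<alpha> = (\<Sum>j\<leftarrow>(SOME js. distinct js \<and> set js = UNIV). \<alpha> $ j)"
    unfolding mi_abs_def by (subst sum_list_distinct_conv_sum_set) (auto simp: some_enumeration)
  then show ?thesis
    unfolding taylor_coeff_def using coeff_list_bound[OF assms(1,2)] assms(2,3) by simp
qed

lemma taylor_coeff_vmonom: "taylor_coeff \<alpha> (\<lambda>z. a * vmonom \<beta> z) = (if \<alpha> = \<beta> then a else 0)"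
  unfolding taylor_coeff_def
  by (simp add: coeff_list_vmonom some_enumeration vec_eq_iff) (simp add: vmonom_def zero_on_def)

lemma taylor_coeff_sum_vmonom:
  "finite A \<Longrightarrow> taylor_coeff \<alpha> (\<lambda>z. \<Sum>\<beta>\<in>A. a \<beta> * vmonom \<beta> z) = (if \<alpha> \<in> A then a \<alpha> else 0)"
proof (induction A rule: finite_induct)
  case empty
  show ?case using taylor_coeff_vmonom[of \<alpha> 0 0] by simp
next
  case (insert \<beta> A)
  then show ?case
    by (auto simp: taylor_coeff_add taylor_coeff_vmonom entire_mult entire_const entire_vmonom entire_sum)
qed

lemma eq_0_if_taylor_coeff_0:
  assumes "entire F" "\<And>\<alpha>. taylor_coeff \<alpha> F = 0"
  shows "F z = 0"
  by (rule eq_0_if_coeff_list_0[OF assms(1), where w = 0 and js = "SOME js. distinct js \<and> set js = UNIV"])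
     (use assms(2) in \<open>auto simp: some_enumeration taylor_coeff_def\<close>)

section \<open>Power series with coefficients in the dual of \<open>H\<^sub>\<flat>\<close>\<close>

text \<open>Cubes exhaust the multi-indices, and sums of \<open>q ^ mi_abs \<alpha>\<close> over
  them factor into one-variable geometric sums.\<close>

definition box_indices :: "nat \<Rightarrow> (nat^'d) set" where
  "box_indices N = {\<alpha>. \<forall>k. \<alpha> $ k < N}"

lemma bij_betw_box_indices:
  "bij_betw (\<lambda>f. \<chi> k. f k) (Pi\<^sub>E (UNIV :: 'd::finite set) (\<lambda>_. {..<N})) (box_indices N)"
  by (rule bij_betwI[where g = "\<lambda>\<alpha> k. \<alpha> $ k"]) (auto simp: box_indices_def PiE_iff vec_eq_iff)

lemma finite_box_indices: "finite (box_indices N)"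
  by (rule iffD1[OF bij_betw_finite[OF bij_betw_box_indices]]) (simp add: finite_PiE)

lemma sum_power_box_indices:
  fixes q :: real
  shows "(\<Sum>\<alpha>\<in>(box_indices N :: (nat^'d) set). q ^ mi_abs \<alpha>) = (\<Sum>n<N. q ^ n) ^ CARD('d)"
proof -
  have "(\<Sum>\<alpha>\<in>(box_indices N :: (nat^'d) set). q ^ mi_abs \<alpha>) =
      (\<Sum>f\<in>Pi\<^sub>E (UNIV :: 'd set) (\<lambda>_. {..<N}). \<Prod>k\<in>UNIV. q ^ f k)"
    by (subst sum.reindex_bij_betw[OF bij_betw_box_indices, symmetric]) (simp add: mi_abs_def power_sum)
  also have "\<dots> = (\<Prod>k\<in>(UNIV :: 'd set). \<Sum>n<N. q ^ n)"
    by (rule prod_sum_PiE[symmetric]) auto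
  finally show ?thesis by simp
qed

lemma nth_le_mi_abs: "\<alpha> $ k \<le> mi_abs \<alpha>"
  unfolding mi_abs_def by (rule member_le_sum) auto

lemma summable_power_mi_abs:
  fixes q :: real
  assumes "0 \<le> q" "q < 1"
  shows "(\<lambda>\<alpha>::nat^'d. q ^ mi_abs \<alpha>) summable_on UNIV"
proof (rule nonneg_bdd_above_summable_on)
  show "bdd_above (sum (\<lambda>\<alpha>::nat^'d. q ^ mi_abs \<alpha>) ` {F. F \<subseteq> UNIV \<and> finite F})"
  proof (intro bdd_aboveI2[where M = "(1 / (1 - q)) ^ CARD('d)"], clarify)
    fix F :: "(nat^'d) set" assume F: "finite F"
    define N where "N = Suc (\<Sum>\<alpha>\<in>F. mi_abs \<alpha>)"
    have "F \<subseteq> box_indices N"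
    proof
      fix \<alpha> assume "\<alpha> \<in> F"
      then have "mi_abs \<alpha> < N" using F member_le_sum[of \<alpha> F mi_abs] by (simp add: N_def)
      then show "\<alpha> \<in> box_indices N"
        using order_le_less_trans[OF nth_le_mi_abs] by (auto simp: box_indices_def)
    qed
    have "(\<Sum>\<alpha>\<in>F. q ^ mi_abs \<alpha>) \<le> (\<Sum>\<alpha>\<in>(box_indices N :: (nat^'d) set). q ^ mi_abs \<alpha>)"
      using assms by (intro sum_mono2[OF finite_box_indices \<open>F \<subseteq> box_indices N\<close>]) auto
    also have "\<dots> \<le> (1 / (1 - q)) ^ CARD('d)"
      unfolding sum_power_box_indices
      using assms by (intro power_mono sum_nonneg) (auto simp: sum_gp_strict divide_right_mono)
    finally show "(\<Sum>\<alpha>\<in>F. q ^ mi_abs \<alpha>) \<le> (1 / (1 - q)) ^ CARD('d)" .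
  qed
qed (use assms in auto)

lemma mi_fact_pos: "0 < mi_fact \<alpha>"
  unfolding mi_fact_def by (intro prod_pos) auto

text \<open>Normalised monomials \<open>vmonom \<alpha> z / sqrt (mi_fact \<alpha>)\<close> are the
  Bargmann transforms of the Hermite functions, the standard orthonormal basis of the Fock
  space.\<close>

definition flat_term :: "(nat^'d \<Rightarrow> complex) \<Rightarrow> complex^'d \<Rightarrow> nat^'d \<Rightarrow> complex" where
  "flat_term c z \<alpha> = c \<alpha> * of_real (1 / sqrt (mi_fact \<alpha>)) * vmonom \<alpha> z"

definition flat_series :: "(nat^'d \<Rightarrow> complex) \<Rightarrow> complex^'d \<Rightarrow> complex" where
  "flat_series c z = (\<Sum>\<^sub>\<infinity>\<alpha>. flat_term c z \<alpha>)"

lemma flat_term_bound: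
  fixes c :: "nat^'d \<Rightarrow> complex"
  assumes c: "c \<in> H_flat_dual" and "0 < R"
  obtains C where "0 \<le> C"
    "\<And>(z :: complex^'d) \<alpha>. (\<And>k. cmod (z $ k) \<le> R) \<Longrightarrow> cmod (flat_term c z \<alpha>) \<le> C * (1/4) ^ mi_abs \<alpha>"
proof -
  \<comment> \<open>This growth rate absorbs the factor \<open>R ^ mi_abs \<alpha>\<close> from the
    monomial and still leaves \<open>(1/4) ^ mi_abs \<alpha>\<close>.\<close>
  define \<rho> where "\<rho> = 1 / (4 * R)"
  have "0 < \<rho>" using \<open>0 < R\<close> by (simp add: \<rho>_def)
  then obtain C where C: "\<And>\<alpha>. cmod (c \<alpha>) \<le> C * \<rho> ^ mi_abs \<alpha> * sqrt (mi_fact \<alpha>)"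
    using c by (auto simp: H_flat_dual_def)
  show ?thesis
  proof (rule that)
    show "0 \<le> max C 0" by simp
    fix z :: "complex^'d" and \<alpha> assume z: "\<And>k. cmod (z $ k) \<le> R"
    have "cmod (c \<alpha>) / sqrt (mi_fact \<alpha>) \<le> C * \<rho> ^ mi_abs \<alpha>"
      using C[of \<alpha>] mi_fact_pos[of \<alpha>] by (simp add: divide_le_eq)
    also have "\<dots> \<le> max C 0 * \<rho> ^ mi_abs \<alpha>"
      using \<open>0 < \<rho>\<close> by (intro mult_right_mono) auto
    finally have 1: "cmod (c \<alpha>) / sqrt (mi_fact \<alpha>) \<le> max C 0 * \<rho> ^ mi_abs \<alpha>" .
    have "cmod (flat_term c z \<alpha>) = cmod (c \<alpha>) / sqrt (mi_fact \<alpha>) * cmod (vmonom \<alpha> z)"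
      using mi_fact_pos[of \<alpha>] by (simp add: flat_term_def norm_mult norm_divide)
    also have "\<dots> \<le> (max C 0 * \<rho> ^ mi_abs \<alpha>) * R ^ mi_abs \<alpha>"
      using \<open>0 < \<rho>\<close> by (intro mult_mono 1 norm_vmonom_le z) auto
    also have "\<dots> = max C 0 * (1/4) ^ mi_abs \<alpha>"
      using \<open>0 < R\<close> by (simp add: \<rho>_def mult.assoc flip: power_mult_distrib)
    finally show "cmod (flat_term c z \<alpha>) \<le> max C 0 * (1/4) ^ mi_abs \<alpha>" .
  qed
qed

lemma cmod_nth_le_norm: "cmod (z $ k) \<le> norm (z :: complex^'d)"
  by (rule Finite_Cartesian_Product.norm_nth_le)

lemma flat_term_abs_summable:
  fixes c :: "nat^'d \<Rightarrow> complex"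
  assumes "c \<in> H_flat_dual"
  shows "(\<lambda>\<alpha>. cmod (flat_term c z \<alpha>)) summable_on A"
proof -
  have "0 < norm z + 1" by (simp add: add_nonneg_pos)
  then obtain C where C: "\<And>(w :: complex^'d) \<alpha>. (\<And>k. cmod (w $ k) \<le> norm z + 1) \<Longrightarrow> cmod (flat_term c w \<alpha>) \<le> C * (1/4) ^ mi_abs \<alpha>"
    using flat_term_bound[OF assms] by blast
  have "(\<lambda>\<alpha>. cmod (flat_term c z \<alpha>)) summable_on UNIV"
  proof (rule summable_on_comparison_test)
    show "(\<lambda>\<alpha>. C * (1/4) ^ mi_abs \<alpha>) summable_on UNIV"
      by (intro summable_on_cmult_right summable_power_mi_abs) auto
    have "cmod (z $ k) \<le> norm z + 1" for k using cmod_nth_le_norm[of z k] by simp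
    then show "cmod (flat_term c z \<alpha>) \<le> C * (1/4) ^ mi_abs \<alpha>" for \<alpha> by (rule C)
  qed auto
  then show ?thesis by (rule summable_on_subset_banach) simp
qed

lemma flat_term_summable: "c \<in> H_flat_dual \<Longrightarrow> flat_term c z summable_on A"
  by (rule abs_summable_summable) (rule flat_term_abs_summable)

text \<open>Outside the box the order is at least \<open>N\<close>. Splitting \<open>1/4\<close>
  into \<open>1/2 * 1/2\<close>, one factor yields \<open>(1/2) ^ N\<close> and the other remains
  summable.\<close>

lemma flat_series_tail:
  fixes c :: "nat^'a \<Rightarrow> complex"
  assumes c: "c \<in> H_flat_dual" and "0 < R"
  obtains K where
    "\<And>(z :: complex^'a) N. (\<And>k. cmod (z $ k) \<le> R) \<Longrightarrow>
      cmod (flat_series c z - (\<Sum>\<alpha>\<in>box_indices N. flat_term c z \<alpha>)) \<le> K * (1/2) ^ N"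
proof -
  obtain C where C: "0 \<le> C"
    "\<And>(z :: complex^'a) \<alpha>. (\<And>k. cmod (z $ k) \<le> R) \<Longrightarrow> cmod (flat_term c z \<alpha>) \<le> C * (1/4) ^ mi_abs \<alpha>"
    using flat_term_bound[OF assms] by blast
  define S where "S = (\<Sum>\<^sub>\<infinity>\<alpha>::nat^'a. (1/2::real) ^ mi_abs \<alpha>)"
  have sum_half: "(\<lambda>\<alpha>::nat^'a. (1/2::real) ^ mi_abs \<alpha>) summable_on UNIV"
    by (rule summable_power_mi_abs) auto
  show ?thesis
  proof (rule that)
    fix z :: "complex^'a" and N assume z: "\<And>k. cmod (z $ k) \<le> R"
    have "flat_series c z = infsum (flat_term c z) (box_indices N \<union> - box_indices N)"
      by (simp add: flat_series_def)
    also have "\<dots> = infsum (flat_term c z) (box_indices N) + infsum (flat_term c z) (- box_indices N)"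
      by (rule infsum_Un_disjoint) (auto intro: flat_term_summable c)
    finally have "flat_series c z - (\<Sum>\<alpha>\<in>box_indices N. flat_term c z \<alpha>) = infsum (flat_term c z) (- box_indices N)"
      by (simp add: finite_box_indices)
    also have "cmod \<dots> \<le> infsum (\<lambda>\<alpha>. cmod (flat_term c z \<alpha>)) (- box_indices N)"
      by (rule norm_infsum_bound) (rule flat_term_abs_summable[OF c])
    also have "\<dots> \<le> infsum (\<lambda>\<alpha>. C * (1/2) ^ N * (1/2) ^ mi_abs \<alpha>) (UNIV :: (nat^'a) set)"
    proof (rule infsum_mono_neutral)
      show "(\<lambda>\<alpha>. C * (1/2) ^ N * (1/2) ^ mi_abs \<alpha>) summable_on (UNIV :: (nat^'a) set)"
        by (intro summable_on_cmult_right sum_half)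
      fix \<alpha> :: "nat^'a" assume "\<alpha> \<in> - box_indices N \<inter> UNIV"
      then obtain k where "N \<le> \<alpha> $ k" by (auto simp: box_indices_def not_less)
      then have N: "N \<le> mi_abs \<alpha>" using nth_le_mi_abs[of \<alpha> k] by simp
      have "(1/4::real) ^ mi_abs \<alpha> = (1/2) ^ mi_abs \<alpha> * (1/2) ^ mi_abs \<alpha>"
        by (simp flip: power_mult_distrib)
      also have "\<dots> \<le> (1/2) ^ N * (1/2) ^ mi_abs \<alpha>"
        using N by (intro mult_right_mono power_decreasing) auto
      finally have "C * (1/4) ^ mi_abs \<alpha> \<le> C * ((1/2) ^ N * (1/2) ^ mi_abs \<alpha>)"
        using C(1) by (rule mult_left_mono)
      with C(2)[of z \<alpha>, OF z] show "cmod (flat_term c z \<alpha>) \<le> C * (1/2) ^ N * (1/2) ^ mi_abs \<alpha>"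
        by (simp add: mult.assoc)
    qed (use C(1) in \<open>auto intro: flat_term_abs_summable[OF c]\<close>)
    also have "\<dots> = C * S * (1/2) ^ N"
      by (simp add: infsum_cmult_right' S_def)
    finally show "cmod (flat_series c z - (\<Sum>\<alpha>\<in>box_indices N. flat_term c z \<alpha>)) \<le> C * S * (1/2) ^ N" .
  qed
qed

lemma flat_partial_sum:
  "(\<Sum>\<alpha>\<in>A. flat_term c z \<alpha>) = (\<Sum>\<alpha>\<in>A. (c \<alpha> * of_real (1 / sqrt (mi_fact \<alpha>))) * vmonom \<alpha> z)"
  by (simp add: flat_term_def)

lemma entire_flat_partial_sum: "entire (\<lambda>z. \<Sum>\<alpha>\<in>A. flat_term c z \<alpha>)"
  unfolding flat_partial_sum by (intro entire_sum entire_mult entire_const entire_vmonom)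

lemma tendsto_half_power: "(\<lambda>N. K * (1/2::real) ^ N) \<longlonglongrightarrow> 0"
  by real_asymp

lemma entire_flat_series:
  fixes c :: "nat^'a \<Rightarrow> complex"
  assumes c: "c \<in> H_flat_dual"
  shows "entire (flat_series c)"
proof (rule entire_uniform_limit)
  show "entire (\<lambda>z. \<Sum>\<alpha>\<in>box_indices N. flat_term c z \<alpha>)" for N by (rule entire_flat_partial_sum)
  fix R :: real
  have "0 < max R 1" by simp
  then obtain K where K: "\<And>(z :: complex^'a) N. (\<And>k. cmod (z $ k) \<le> max R 1) \<Longrightarrow>
      cmod (flat_series c z - (\<Sum>\<alpha>\<in>box_indices N. flat_term c z \<alpha>)) \<le> K * (1/2) ^ N"
    using flat_series_tail[OF c] by blast
  show "uniform_limit (cball 0 R) (\<lambda>N z. \<Sum>\<alpha>\<in>box_indices N. flat_term c z \<alpha>) (flat_series c) sequentially"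
    unfolding uniform_limit_iff
  proof (intro allI impI)
    fix e :: real assume "0 < e"
    then have "eventually (\<lambda>N. K * (1/2) ^ N < e) sequentially"
      by (rule order_tendstoD(2)[OF tendsto_half_power])
    then show "\<forall>\<^sub>F N in sequentially. \<forall>z\<in>cball 0 R. dist (\<Sum>\<alpha>\<in>box_indices N. flat_term c z \<alpha>) (flat_series c z) < e"
    proof eventually_elim
      case (elim N)
      show ?case
      proof
        fix z :: "complex^'a" assume "z \<in> cball 0 R"
        then have "cmod (z $ k) \<le> max R 1" for k using cmod_nth_le_norm[of z k] by simp
        from K[of z N, OF this] elim
        show "dist (\<Sum>\<alpha>\<in>box_indices N. flat_term c z \<alpha>) (flat_series c z) < e"
          by (simp add: dist_norm norm_minus_commute)
      qed
    qed
  qed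
qed

text \<open>Partial sums over boxes containing \<alpha> have exactly this coefficient, and the
  coefficient of the remainder is bounded by its supremum on the unit polydisc, which tends to
  0.\<close>

lemma taylor_coeff_flat_series:
  fixes c :: "nat^'a \<Rightarrow> complex"
  assumes c: "c \<in> H_flat_dual"
  shows "taylor_coeff \<alpha> (flat_series c) = c \<alpha> * of_real (1 / sqrt (mi_fact \<alpha>))"
proof -
  obtain K where K: "\<And>(z :: complex^'a) N. (\<And>k. cmod (z $ k) \<le> 1) \<Longrightarrow>
      cmod (flat_series c z - (\<Sum>\<alpha>\<in>box_indices N. flat_term c z \<alpha>)) \<le> K * (1/2) ^ N"
    using flat_series_tail[OF c, of 1] by auto
  let ?x = "taylor_coeff \<alpha> (flat_series c) - c \<alpha> * of_real (1 / sqrt (mi_fact \<alpha>))"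
  have "cmod ?x \<le> K * (1/2) ^ N" if N: "mi_abs \<alpha> < N" for N
  proof -
    let ?P = "\<lambda>z. \<Sum>\<alpha>\<in>box_indices N. flat_term c z \<alpha>"
    have "\<alpha> \<in> box_indices N"
      using order_le_less_trans[OF nth_le_mi_abs N] by (simp add: box_indices_def)
    then have "taylor_coeff \<alpha> ?P = c \<alpha> * of_real (1 / sqrt (mi_fact \<alpha>))"
      unfolding flat_partial_sum by (subst taylor_coeff_sum_vmonom) (auto simp: finite_box_indices)
    then have "?x = taylor_coeff \<alpha> (\<lambda>z. flat_series c z - ?P z)"
      by (simp add: taylor_coeff_diff entire_flat_series[OF c] entire_flat_partial_sum)
    also have "cmod \<dots> \<le> K * (1/2) ^ N / 1 ^ mi_abs \<alpha>"
      by (rule taylor_coeff_bound[OF entire_diff[OF entire_flat_series[OF c] entire_flat_partial_sum]])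
         (auto intro: K)
    finally show ?thesis by simp
  qed
  then have "cmod ?x \<le> 0"
    by (intro LIMSEQ_le_const[OF tendsto_half_power[of K]] exI[of _ "Suc (mi_abs \<alpha>)"]) auto
  then show ?thesis by simp
qed

lemma norm_le_polydisc:
  assumes "\<And>k. cmod (z $ k) \<le> R"
  shows "norm (z :: complex^'d) \<le> real CARD('d) * R"
proof -
  have "norm z \<le> (\<Sum>k\<in>UNIV. cmod (z $ k))"
    unfolding norm_vec_def by (rule L2_set_le_sum) auto
  also have "\<dots> \<le> (\<Sum>k\<in>(UNIV :: 'd set). R)" by (intro sum_mono assms)
  finally show ?thesis by simp
qed

text \<open>An entire function is bounded on polydiscs of every radius \<open>1 / r\<close>, which
  by Cauchy's estimates matches the quantifier over all \<open>r\<close> in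
  \<open>H_flat_dual\<close>. The series and \<open>F\<close> then agree because all their Taylor
  coefficients do.\<close>

lemma flat_series_surj:
  fixes F :: "complex^'d \<Rightarrow> complex"
  assumes F: "entire F"
  obtains c where "c \<in> H_flat_dual" "flat_series c = F"
proof
  define c where "c \<alpha> = taylor_coeff \<alpha> F * of_real (sqrt (mi_fact \<alpha>))" for \<alpha>
  show c: "c \<in> H_flat_dual"
    unfolding H_flat_dual_def
  proof (intro CollectI allI impI)
    fix r :: real assume r: "0 < r"
    obtain M where M: "\<And>z. norm z \<le> real CARD('d) * (1/r) \<Longrightarrow> cmod (F z) \<le> M"
      using entire_bounded[OF F] by blast
    have "cmod (c \<alpha>) \<le> M * r ^ mi_abs \<alpha> * sqrt (mi_fact \<alpha>)" for \<alpha>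
    proof -
      have "cmod (taylor_coeff \<alpha> F) \<le> M / (1 / r) ^ mi_abs \<alpha>"
        by (rule taylor_coeff_bound[OF F]) (use r in \<open>auto intro: M norm_le_polydisc\<close>)
      also have "\<dots> = M * r ^ mi_abs \<alpha>" using r by (simp add: power_divide)
      finally show ?thesis
        using mi_fact_pos[of \<alpha>] by (simp add: c_def norm_mult mult_right_mono)
    qed
    then show "\<exists>C. \<forall>\<alpha>. cmod (c \<alpha>) \<le> C * r ^ mi_abs \<alpha> * sqrt (mi_fact \<alpha>)" by blast
  qed
  show "flat_series c = F"
  proof
    fix z
    have "taylor_coeff \<alpha> (\<lambda>z. flat_series c z - F z) = 0" for \<alpha>
    proof -
      have "sqrt (mi_fact \<alpha>) \<noteq> 0" using mi_fact_pos[of \<alpha>] by simp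
      then have "complex_of_real (sqrt (mi_fact \<alpha>)) \<noteq> 0" unfolding of_real_eq_0_iff .
      then show ?thesis
        by (simp add: taylor_coeff_diff entire_flat_series c F taylor_coeff_flat_series) (simp add: c_def)
    qed
    with eq_0_if_taylor_coeff_0[OF entire_diff[OF entire_flat_series[OF c] F], of z]
    show "flat_series c z = F z" by simp
  qed
qed

lemma inj_on_flat_series: "inj_on flat_series H_flat_dual"
proof (rule inj_onI)
  fix c c' :: "nat^'d \<Rightarrow> complex"
  assume eq: "c \<in> H_flat_dual" "c' \<in> H_flat_dual" "flat_series c = flat_series c'"
  show "c = c'"
  proof
    fix \<alpha>
    have "c \<alpha> * of_real (1 / sqrt (mi_fact \<alpha>)) = c' \<alpha> * of_real (1 / sqrt (mi_fact \<alpha>))"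
      using taylor_coeff_flat_series[OF eq(1), of \<alpha>] taylor_coeff_flat_series[OF eq(2), of \<alpha>]
      unfolding eq(3) by (rule trans[OF sym])
    moreover have "complex_of_real (1 / sqrt (mi_fact \<alpha>)) \<noteq> 0"
      unfolding of_real_eq_0_iff using mi_fact_pos[of \<alpha>] by simp
    ultimately show "c \<alpha> = c' \<alpha>" by (simp only: mult_cancel_right simp_thms)
  qed
qed

lemma bij_betw_flat_series: "bij_betw flat_series H_flat_dual {F. entire F}"
proof (rule bij_betw_imageI[OF inj_on_flat_series])
  show "flat_series ` H_flat_dual = {F. entire F}"
    by (auto intro: entire_flat_series elim!: flat_series_surj)
qed

lemma flat_series_add:
  assumes "c \<in> H_flat_dual" "c' \<in> H_flat_dual"
  shows "flat_series (c + c') = flat_series c + flat_series c'"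
proof
  fix z
  have "flat_term (c + c') z = (\<lambda>\<alpha>. flat_term c z \<alpha> + flat_term c' z \<alpha>)"
    by (simp add: flat_term_def fun_eq_iff algebra_simps add_divide_distrib)
  then show "flat_series (c + c') z = (flat_series c + flat_series c') z"
    using infsum_add[OF flat_term_summable[OF assms(1)] flat_term_summable[OF assms(2)]]
    by (simp add: flat_series_def)
qed

lemma flat_series_scale: "flat_series (fun_scale a c) = fun_scale a (flat_series c)"
proof
  fix z
  have "flat_term (fun_scale a c) z = (\<lambda>\<alpha>. a * flat_term c z \<alpha>)"
    by (simp add: flat_term_def fun_eq_iff fun_scale_def algebra_simps)
  then show "flat_series (fun_scale a c) z = fun_scale a (flat_series c) z"
    by (simp add: flat_series_def infsum_cmult_right' fun_scale_def)
qed

lemma H_flat_dual_add: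
  assumes "c \<in> H_flat_dual" "c' \<in> H_flat_dual"
  shows "c + c' \<in> H_flat_dual"
  unfolding H_flat_dual_def
proof (intro CollectI allI impI)
  fix r :: real assume "0 < r"
  then obtain C C' where C: "\<And>\<alpha>. cmod (c \<alpha>) \<le> C * r ^ mi_abs \<alpha> * sqrt (mi_fact \<alpha>)"
    and C': "\<And>\<alpha>. cmod (c' \<alpha>) \<le> C' * r ^ mi_abs \<alpha> * sqrt (mi_fact \<alpha>)"
    using assms unfolding H_flat_dual_def by blast
  have "cmod ((c + c') \<alpha>) \<le> (C + C') * r ^ mi_abs \<alpha> * sqrt (mi_fact \<alpha>)" for \<alpha>
    using norm_triangle_ineq[of "c \<alpha>" "c' \<alpha>"] C[of \<alpha>] C'[of \<alpha>] by (simp add: distrib_right)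
  then show "\<exists>C. \<forall>\<alpha>. cmod ((c + c') \<alpha>) \<le> C * r ^ mi_abs \<alpha> * sqrt (mi_fact \<alpha>)" by blast
qed

lemma H_flat_dual_scale:
  assumes "c \<in> H_flat_dual"
  shows "fun_scale a c \<in> H_flat_dual"
  unfolding H_flat_dual_def
proof (intro CollectI allI impI)
  fix r :: real assume "0 < r"
  then obtain C where C: "\<And>\<alpha>. cmod (c \<alpha>) \<le> C * r ^ mi_abs \<alpha> * sqrt (mi_fact \<alpha>)"
    using assms unfolding H_flat_dual_def by blast
  have "cmod (fun_scale a c \<alpha>) \<le> (cmod a * C) * r ^ mi_abs \<alpha> * sqrt (mi_fact \<alpha>)" for \<alpha>
    using mult_left_mono[OF C[of \<alpha>], of "cmod a"] by (simp add: fun_scale_def norm_mult mult.assoc)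
  then show "\<exists>C. \<forall>\<alpha>. cmod (fun_scale a c \<alpha>) \<le> C * r ^ mi_abs \<alpha> * sqrt (mi_fact \<alpha>)" by blast
qed

section \<open>Hermite coefficients of the Bargmann kernel\<close>

text \<open>The recursion of the polynomial factor in the derivatives of
  \<open>exp (- t\<^sup>2)\<close>: up to the sign \<open>(-1) ^ n\<close>, the physicists' Hermite
  polynomials.\<close>

fun gauss_poly :: "nat \<Rightarrow> real poly" where
  "gauss_poly 0 = 1"
| "gauss_poly (Suc n) = pderiv (gauss_poly n) - [:0, 2:] * gauss_poly n"

definition gauss_deriv :: "nat \<Rightarrow> real \<Rightarrow> real" where
  "gauss_deriv n t = poly (gauss_poly n) t * exp (- t\<^sup>2)"

lemma DERIV_gauss_deriv: "(gauss_deriv n has_real_derivative gauss_deriv (Suc n) t) (at t)"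
  unfolding gauss_deriv_def[abs_def]
  by (auto intro!: derivative_eq_intros simp: algebra_simps)

lemma continuous_on_gauss_deriv: "continuous_on S (gauss_deriv n)"
  by (meson DERIV_gauss_deriv DERIV_isCont continuous_at_imp_continuous_on)

text \<open>Completing the square exhibits a multiple of a normal density with mean
  \<open>a / 2\<close> and variance 1/2.\<close>

lemma integrable_exp_quadratic: "integrable lborel (\<lambda>t::real. exp (a * t - t\<^sup>2))"
proof -
  have "integrable lborel (\<lambda>t. exp (a\<^sup>2 / 4) * sqrt pi * normal_density (a / 2) (1 / sqrt 2) t)"
    by (intro integrable_mult_right integrable_normal_density) auto
  moreover have "exp (a\<^sup>2 / 4) * sqrt pi * normal_density (a / 2) (1 / sqrt 2) t = exp (a * t - t\<^sup>2)" for t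
  proof -
    have "exp (a\<^sup>2 / 4) * exp (- (t - a / 2)\<^sup>2) = exp (a * t - t\<^sup>2)"
      by (simp flip: exp_add) (simp add: power2_eq_square algebra_simps)
    then show ?thesis
      by (simp add: normal_density_def power_divide)
  qed
  ultimately show ?thesis by simp
qed

text \<open>One factor \<open>t\<close> is paid for by
  \<open>\<bar>t\<bar> \<le> exp t + exp (- t)\<close>, which shifts \<open>a\<close> by 1 in both
  directions; hence the induction over all \<open>a\<close>.\<close>

lemma integrable_power_exp_quadratic: "integrable lborel (\<lambda>t::real. t ^ n * exp (a * t - t\<^sup>2))"
proof (induction n arbitrary: a)
  case 0
  then show ?case using integrable_exp_quadratic by simp
next
  case (Suc n)
  have "integrable lborel (\<lambda>t. \<bar>t ^ n * exp ((a + 1) * t - t\<^sup>2)\<bar> + \<bar>t ^ n * exp ((a - 1) * t - t\<^sup>2)\<bar>)"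
    by (intro Bochner_Integration.integrable_add integrable_abs Suc)
  then show ?case
  proof (rule Bochner_Integration.integrable_bound)
    show "AE t in lborel. norm (t ^ Suc n * exp (a * t - t\<^sup>2)) \<le>
        norm (\<bar>t ^ n * exp ((a + 1) * t - t\<^sup>2)\<bar> + \<bar>t ^ n * exp ((a - 1) * t - t\<^sup>2)\<bar>)"
    proof (intro AE_I2)
      fix t :: real
      have "\<bar>t\<bar> \<le> exp t + exp (- t)"
        using exp_ge_add_one_self[of t] exp_ge_add_one_self[of "- t"] exp_gt_zero[of t] exp_gt_zero[of "-t"]
        by linarith
      then have "\<bar>t\<bar> * (\<bar>t\<bar> ^ n * exp (a * t - t\<^sup>2)) \<le> (exp t + exp (- t)) * (\<bar>t\<bar> ^ n * exp (a * t - t\<^sup>2))"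
        by (intro mult_right_mono) auto
      also have "\<dots> = \<bar>t\<bar> ^ n * exp ((a + 1) * t - t\<^sup>2) + \<bar>t\<bar> ^ n * exp ((a - 1) * t - t\<^sup>2)"
        by (simp add: algebra_simps flip: exp_add)
      finally show "norm (t ^ Suc n * exp (a * t - t\<^sup>2)) \<le>
        norm (\<bar>t ^ n * exp ((a + 1) * t - t\<^sup>2)\<bar> + \<bar>t ^ n * exp ((a - 1) * t - t\<^sup>2)\<bar>)"
        by (simp add: abs_mult power_abs mult.assoc)
    qed
  qed measurable
qed

text \<open>Separates a factor of modulus 1 from real terms, so that integrability and decay at
  infinity both reduce to real estimates.\<close>

lemma exp_times_gauss_deriv:
  "exp (s * of_real t) * of_real (gauss_deriv n t) =
    (\<Sum>i\<le>degree (gauss_poly n). of_real (coeff (gauss_poly n) i) *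
      (exp (\<i> * of_real (Im s * t)) * of_real (t ^ i * exp (Re s * t - t\<^sup>2))))"
proof -
  have "exp (s * of_real t) * of_real (exp (- t\<^sup>2)) = exp (\<i> * of_real (Im s * t)) * of_real (exp (Re s * t - t\<^sup>2))"
  proof -
    have "s * of_real t + of_real (- t\<^sup>2) = \<i> * of_real (Im s * t) + of_real (Re s * t - t\<^sup>2)"
      by (simp add: complex_eq_iff)
    then show ?thesis by (simp only: exp_of_real[symmetric] exp_add[symmetric])
  qed
  then have "exp (s * of_real t) * of_real (gauss_deriv n t) =
      of_real (poly (gauss_poly n) t) * (exp (\<i> * of_real (Im s * t)) * of_real (exp (Re s * t - t\<^sup>2)))"
    by (simp add: gauss_deriv_def)
  also have "\<dots> = (\<Sum>i\<le>degree (gauss_poly n). of_real (coeff (gauss_poly n) i) *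
      (exp (\<i> * of_real (Im s * t)) * of_real (t ^ i * exp (Re s * t - t\<^sup>2))))"
    by (simp add: poly_altdef sum_distrib_right sum_distrib_left mult_ac)
  finally show ?thesis .
qed

lemma integrable_exp_gauss_deriv:
  "integrable lborel (\<lambda>t. exp (s * of_real t) * of_real (gauss_deriv n t) :: complex)"
  unfolding exp_times_gauss_deriv
proof (intro Bochner_Integration.integrable_sum integrable_mult_right)
  fix i
  show "integrable lborel (\<lambda>t. exp (\<i> * complex_of_real (Im s * t)) * of_real (t ^ i * exp (Re s * t - t\<^sup>2)))"
    by (rule Bochner_Integration.integrable_bound[OF integrable_power_exp_quadratic[of i "Re s"]])
       (auto simp: norm_mult norm_power abs_mult power_abs)
qed

lemma tendsto_power_exp_quadratic:
  "((\<lambda>t::real. t ^ i * exp (a * t - t\<^sup>2)) \<longlongrightarrow> 0) at_top"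
  "((\<lambda>t::real. t ^ i * exp (a * t - t\<^sup>2)) \<longlongrightarrow> 0) at_bot"
  by real_asymp+

lemma tendsto_exp_gauss_deriv:
  assumes "F = at_top \<or> F = at_bot"
  shows "((\<lambda>t. exp (s * of_real t) * of_real (gauss_deriv n t) :: complex) \<longlongrightarrow> 0) F"
  unfolding exp_times_gauss_deriv
proof (intro tendsto_null_sum tendsto_mult_right_zero)
  fix i
  have "((\<lambda>t::real. t ^ i * exp (Re s * t - t\<^sup>2)) \<longlongrightarrow> 0) F"
    using assms tendsto_power_exp_quadratic by blast
  then show "((\<lambda>t. exp (\<i> * complex_of_real (Im s * t)) * of_real (t ^ i * exp (Re s * t - t\<^sup>2))) \<longlongrightarrow> 0) F"
    using tendsto_rabs_zero[of "\<lambda>t. t ^ i * exp (Re s * t - t\<^sup>2)" F]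
    by (subst tendsto_norm_zero_iff[symmetric]) (simp add: norm_mult norm_power abs_mult power_abs)
qed

text \<open>Integration by parts: the derivative of \<open>exp (s * t) * gauss_deriv n t\<close> is
  integrable, and the boundary values at both infinities vanish.\<close>

lemma integral_exp_gauss_deriv_Suc:
  "(LINT t|lborel. exp (s * of_real t) * of_real (gauss_deriv (Suc n) t)) =
    - s * (LINT t|lborel. exp (s * of_real t) * of_real (gauss_deriv n t) :: complex)"
proof -
  let ?G = "\<lambda>t::real. exp (s * of_real t) * of_real (gauss_deriv n t) :: complex"
  let ?H = "\<lambda>t::real. exp (s * of_real t) * of_real (gauss_deriv (Suc n) t) :: complex"
  let ?g = "\<lambda>t. s * ?G t + ?H t"
  have int: "integrable lborel ?g"
    by (intro Bochner_Integration.integrable_add integrable_mult_right integrable_exp_gauss_deriv)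
  have "(LBINT t=-\<infinity>..\<infinity>. ?g t) = 0 - 0"
  proof (rule interval_integral_FTC_integrable)
    fix t :: real
    have "((\<lambda>t. complex_of_real (gauss_deriv n t)) has_vector_derivative of_real (gauss_deriv (Suc n) t)) (at t)"
      using DERIV_gauss_deriv[of n t] by (auto intro!: derivative_eq_intros has_vector_derivative_of_real simp: has_real_derivative_iff_has_vector_derivative)
    moreover have "((\<lambda>t. exp (s * of_real t)) has_vector_derivative s * exp (s * of_real t)) (at t)"
    proof -
      have "((\<lambda>w. exp (s * w)) has_field_derivative s * exp (s * of_real t)) (at (of_real t))"
        by (auto intro!: derivative_eq_intros)
      from has_vector_derivative_real_field[OF this] show ?thesis by simp
    qed
    ultimately have "(?G has_vector_derivative (exp (s * of_real t) * of_real (gauss_deriv (Suc n) t) +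
        s * exp (s * of_real t) * of_real (gauss_deriv n t))) (at t)"
      by (rule has_vector_derivative_mult[rotated])
    then show "(?G has_vector_derivative ?g t) (at t)"
      by (simp add: algebra_simps)
    show "isCont ?g t"
      by (rule continuous_on_interior[where S = UNIV])
         (auto intro!: continuous_intros continuous_on_gauss_deriv)
  next
    show "((?G \<circ> real_of_ereal) \<longlongrightarrow> 0) (at_right (-\<infinity>))" "((?G \<circ> real_of_ereal) \<longlongrightarrow> 0) (at_left \<infinity>)"
      using tendsto_exp_gauss_deriv by (auto simp: ereal_tendsto_simps)
    show "set_integrable lborel (einterval (-\<infinity>) \<infinity>) ?g"
      using int by (simp add: set_integrable_def)
  qed simp
  then have "integral\<^sup>L lborel ?g = 0"
    by (simp add: interval_integral_to_infinity_eq interval_lebesgue_integral_def set_lebesgue_integral_def)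
  moreover have "integral\<^sup>L lborel ?g = s * integral\<^sup>L lborel ?G + integral\<^sup>L lborel ?H"
    by (subst Bochner_Integration.integral_add) (auto intro: integrable_exp_gauss_deriv)
  ultimately show ?thesis by (simp add: add_eq_0_iff)
qed

text \<open>The real part of \<open>s\<close> is absorbed by completing the square; the imaginary
  part leaves the characteristic function of the standard normal distribution.\<close>

lemma integral_exp_gauss:
  "(LINT t|lborel. exp (s * of_real t) * of_real (gauss_deriv 0 t)) = of_real (sqrt pi) * exp (s\<^sup>2 / 4)"
  for s :: complex
proof -
  define a b where "a = Re s" and "b = Im s"
  define \<beta> where "\<beta> = b / sqrt 2"
  have s: "s = of_real a + \<i> * of_real b" by (simp add: a_def b_def complex_eq_iff)
  let ?f = "\<lambda>t. exp (s * of_real t) * of_real (gauss_deriv 0 t)"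
  \<comment> \<open>The substitution centres the Gaussian at \<open>a / 2\<close> and rescales it to
    \<open>exp (- x\<^sup>2 / 2)\<close>, which turns the frequency \<open>b\<close> into
    \<beta>.\<close>
  have "(LINT t|lborel. ?f t) = \<bar>1 / sqrt 2\<bar> *\<^sub>R (LINT x|lborel. ?f (a / 2 + (1 / sqrt 2) * x))"
    by (rule lborel_integral_real_affine) simp
  also have "(\<lambda>x. ?f (a / 2 + (1 / sqrt 2) * x)) =
      (\<lambda>x. (exp (of_real (a\<^sup>2 / 4) + \<i> * of_real (a * b / 2)) * of_real (sqrt (2 * pi))) *
        (std_normal_density x *\<^sub>R exp (\<i> * of_real (\<beta> * x))))"
  proof
    fix x :: real
    let ?t = "a / 2 + (1 / sqrt 2) * x"
    have sq: "?t\<^sup>2 = a\<^sup>2 / 4 + a * x / sqrt 2 + x\<^sup>2 / 2"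
      by (simp add: power2_eq_square algebra_simps add_divide_distrib)
    have ex: "s * of_real ?t - of_real (?t\<^sup>2) =
        (of_real (a\<^sup>2 / 4) + \<i> * of_real (a * b / 2)) + (of_real (- x\<^sup>2 / 2) + \<i> * of_real (\<beta> * x))"
      unfolding sq s \<beta>_def
      by (simp add: complex_eq_iff power2_eq_square field_simps)
    have "?f u = exp (s * of_real u - of_real (u\<^sup>2))" for u
    proof -
      have "s * of_real u - of_real (u\<^sup>2) = s * of_real u + of_real (- u\<^sup>2)" by simp
      then show ?thesis by (simp only: exp_add exp_of_real) (simp add: gauss_deriv_def)
    qed
    then have "?f ?t = exp (s * of_real ?t - of_real (?t\<^sup>2))" .
    also have "\<dots> = exp (of_real (a\<^sup>2 / 4) + \<i> * of_real (a * b / 2)) *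
        (of_real (exp (- x\<^sup>2 / 2)) * exp (\<i> * of_real (\<beta> * x)))"
      unfolding ex exp_add by (simp only: exp_of_real)
    also have "exp (- x\<^sup>2 / 2) = sqrt (2 * pi) * std_normal_density x"
      by (simp add: std_normal_density_def)
    finally show "?f ?t = (exp (of_real (a\<^sup>2 / 4) + \<i> * of_real (a * b / 2)) * of_real (sqrt (2 * pi))) *
        (std_normal_density x *\<^sub>R exp (\<i> * of_real (\<beta> * x)))"
      by (simp add: scaleR_conv_of_real mult.assoc)
  qed
  also have "(LINT x|lborel. (exp (of_real (a\<^sup>2 / 4) + \<i> * of_real (a * b / 2)) * of_real (sqrt (2 * pi))) *
        (std_normal_density x *\<^sub>R exp (\<i> * of_real (\<beta> * x)))) =
      (exp (of_real (a\<^sup>2 / 4) + \<i> * of_real (a * b / 2)) * of_real (sqrt (2 * pi))) *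
        (LINT x|lborel. std_normal_density x *\<^sub>R exp (\<i> * of_real (\<beta> * x)))"
    by (rule integral_mult_right_zero)
  also have "(LINT x|lborel. std_normal_density x *\<^sub>R exp (\<i> * of_real (\<beta> * x))) = of_real (exp (- \<beta>\<^sup>2 / 2))"
  proof -
    have "(LINT x|lborel. std_normal_density x *\<^sub>R exp (\<i> * of_real (\<beta> * x))) = char std_normal_distribution \<beta>"
      unfolding char_def by (subst integral_density) auto
    then show ?thesis by (simp add: char_std_normal_distribution)
  qed
  also have "\<bar>1 / sqrt 2\<bar> *\<^sub>R ((exp (of_real (a\<^sup>2 / 4) + \<i> * of_real (a * b / 2)) * of_real (sqrt (2 * pi))) *
      of_real (exp (- \<beta>\<^sup>2 / 2))) = of_real (sqrt pi) * exp (s\<^sup>2 / 4)"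
  proof -
    have "s\<^sup>2 / 4 = (of_real (a\<^sup>2 / 4) + \<i> * of_real (a * b / 2)) + of_real (- \<beta>\<^sup>2 / 2)"
      unfolding s \<beta>_def by (simp add: complex_eq_iff power2_eq_square field_simps)
    then have "exp (s\<^sup>2 / 4) = exp (of_real (a\<^sup>2 / 4) + \<i> * of_real (a * b / 2)) * of_real (exp (- \<beta>\<^sup>2 / 2))"
      by (simp only: exp_add exp_of_real)
    then show ?thesis
      by (simp add: scaleR_conv_of_real real_sqrt_mult)
  qed
  finally show ?thesis .
qed

lemma integral_exp_gauss_deriv:
  "(LINT t|lborel. exp (s * of_real t) * of_real (gauss_deriv n t)) = (- s) ^ n * (of_real (sqrt pi) * exp (s\<^sup>2 / 4))"
  for s :: complex
  by (induction n) (simp_all add: integral_exp_gauss integral_exp_gauss_deriv_Suc)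

text \<open>Lebesgue measure on \<open>real^'d\<close> is the image of a product measure indexed by
  \<open>Basis\<close>; reindexing by the coordinate axes makes the product formula
  applicable.\<close>

lemma integral_prod_vec:
  fixes f :: "'d::finite \<Rightarrow> real \<Rightarrow> complex"
  assumes f: "\<And>j. integrable lborel (f j)"
  shows "(LINT y|(lborel :: (real^'d) measure). (\<Prod>j\<in>UNIV. f j (y $ j))) = (\<Prod>j\<in>UNIV. (LINT t|lborel. f j t))"
proof -
  interpret product_sigma_finite "\<lambda>b :: real^'d. lborel :: real measure" by standard
  have [measurable]: "f j \<in> borel_measurable borel" for j
    using borel_measurable_integrable[OF f[of j]] by simp
  have bij: "bij_betw (\<lambda>j. axis j 1) UNIV (Basis :: (real^'d) set)"
    by (rule bij_betw_imageI) (auto simp: inj_on_def axis_eq_axis Basis_vec_def)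
  have m: "(\<lambda>y :: real^'d. \<Prod>j\<in>UNIV. f j (y $ j)) \<in> borel_measurable borel"
  proof (rule borel_measurable_prod)
    fix j
    have "(\<lambda>y :: real^'d. y $ j) \<in> borel_measurable borel"
      by (intro borel_measurable_continuous_onI continuous_intros)
    then show "(\<lambda>y :: real^'d. f j (y $ j)) \<in> borel_measurable borel" by measurable
  qed
  have "(LINT y|(lborel :: (real^'d) measure). (\<Prod>j\<in>UNIV. f j (y $ j))) =
      (LINT g|Pi\<^sub>M Basis (\<lambda>b :: real^'d. lborel). (\<Prod>j\<in>UNIV. f j ((\<Sum>b\<in>Basis. g b *\<^sub>R b) $ j)))"
    by (subst lborel_def, subst integral_distr) (use m in \<open>auto simp: lborel_eq_real\<close>)
  also have "\<dots> = (LINT g|Pi\<^sub>M Basis (\<lambda>b :: real^'d. lborel). (\<Prod>b\<in>Basis. f (axis_index b) (g b)))"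
  proof (rule Bochner_Integration.integral_cong[OF refl])
    fix g :: "real^'d \<Rightarrow> real"
    have "(\<Sum>b\<in>Basis. g b *\<^sub>R b) $ j = g (axis j 1)" for j
    proof -
      have "(\<Sum>b\<in>Basis. g b *\<^sub>R b) $ j = (\<Sum>b\<in>Basis. g b *\<^sub>R b) \<bullet> axis j 1"
        by (simp add: inner_axis)
      also have "\<dots> = g (axis j 1)"
        by (simp add: inner_sum_left_Basis axis_in_Basis_iff)
      finally show ?thesis .
    qed
    then have "(\<Prod>j\<in>UNIV. f j ((\<Sum>b\<in>Basis. g b *\<^sub>R b) $ j)) = (\<Prod>j\<in>UNIV. f (axis_index (axis j 1 :: real^'d)) (g (axis j 1)))"
      by (simp add: axis_index_axis)
    also have "\<dots> = (\<Prod>b\<in>Basis. f (axis_index b) (g b))"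
      by (rule prod.reindex_bij_betw[OF bij])
    finally show "(\<Prod>j\<in>UNIV. f j ((\<Sum>b\<in>Basis. g b *\<^sub>R b) $ j)) = (\<Prod>b\<in>Basis. f (axis_index b) (g b))" .
  qed
  also have "\<dots> = (\<Prod>b\<in>(Basis :: (real^'d) set). (LINT t|lborel. f (axis_index b) t))"
    by (rule product_integral_prod) (auto intro: f)
  also have "\<dots> = (\<Prod>j\<in>UNIV. (LINT t|lborel. f (axis_index (axis j 1 :: real^'d)) t))"
    by (rule prod.reindex_bij_betw[OF bij, symmetric])
  finally show ?thesis by (simp add: axis_index_axis)
qed

section \<open>Derivatives of the Gaussian in several variables and the kernel integral\<close>

lemma gauss_product: "exp (- (norm y)\<^sup>2) = (\<Prod>k\<in>UNIV. gauss_deriv 0 (y $ k))" for y :: "real^'d"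
proof -
  have "(norm y)\<^sup>2 = (\<Sum>k\<in>UNIV. (y $ k)\<^sup>2)"
    by (simp only: power2_norm_eq_inner inner_vec_def) (simp add: power2_eq_square)
  then have "- (norm y)\<^sup>2 = (\<Sum>k\<in>UNIV. - (y $ k)\<^sup>2)" by (simp add: sum_negf)
  then show ?thesis by (simp add: gauss_deriv_def exp_sum)
qed

lemma partial_deriv_gauss_product:
  "partial_deriv j (\<lambda>y. \<Prod>k\<in>UNIV. gauss_deriv (\<beta> k) (y $ k)) =
    (\<lambda>y. \<Prod>k\<in>UNIV. gauss_deriv (if k = j then Suc (\<beta> k) else \<beta> k) (y $ k))"
proof
  fix x :: "real^'a"
  define C where "C = (\<Prod>k\<in>UNIV - {j}. gauss_deriv (\<beta> k) (x $ k))"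
  have "(\<Prod>k\<in>UNIV. gauss_deriv (\<beta> k) ((x + t *\<^sub>R axis j 1) $ k)) = gauss_deriv (\<beta> j) (x $ j + t) * C" for t
    unfolding C_def by (subst prod.remove[of UNIV j]) (auto simp: axis_def intro!: prod.cong)
  moreover have "((\<lambda>t. gauss_deriv (\<beta> j) (x $ j + t) * C) has_real_derivative gauss_deriv (Suc (\<beta> j)) (x $ j) * C) (at 0)"
  proof (rule DERIV_cmult_right)
    have "((\<lambda>t. gauss_deriv (\<beta> j) (t + x $ j)) has_real_derivative gauss_deriv (Suc (\<beta> j)) (x $ j)) (at 0)"
      unfolding DERIV_shift[symmetric] using DERIV_gauss_deriv[of "\<beta> j" "x $ j"] by simp
    then show "((\<lambda>t. gauss_deriv (\<beta> j) (x $ j + t)) has_real_derivative gauss_deriv (Suc (\<beta> j)) (x $ j)) (at 0)"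
      by (simp add: add.commute)
  qed
  moreover have "(\<Prod>k\<in>UNIV. gauss_deriv (if k = j then Suc (\<beta> k) else \<beta> k) (x $ k)) = gauss_deriv (Suc (\<beta> j)) (x $ j) * C"
    unfolding C_def by (subst prod.remove[of UNIV j]) (auto intro!: prod.cong)
  ultimately show "partial_deriv j (\<lambda>y. \<Prod>k\<in>UNIV. gauss_deriv (\<beta> k) (y $ k)) x =
      (\<Prod>k\<in>UNIV. gauss_deriv (if k = j then Suc (\<beta> k) else \<beta> k) (x $ k))"
    unfolding partial_deriv_def by (simp add: DERIV_imp_deriv)
qed

lemma partial_deriv_funpow_gauss_product:
  "(partial_deriv j ^^ n) (\<lambda>y. \<Prod>k\<in>UNIV. gauss_deriv (\<beta> k) (y $ k)) =
    (\<lambda>y. \<Prod>k\<in>UNIV. gauss_deriv (if k = j then \<beta> k + n else \<beta> k) (y $ k))"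
proof (induction n)
  case (Suc n)
  have "(\<lambda>k. if k = j then Suc (if k = j then \<beta> k + n else \<beta> k) else if k = j then \<beta> k + n else \<beta> k) =
      (\<lambda>k. if k = j then \<beta> k + Suc n else \<beta> k)" by auto
  then show ?case
    using partial_deriv_gauss_product[of j "\<lambda>k. if k = j then \<beta> k + n else \<beta> k"]
    by (simp add: Suc fun_eq_iff)
qed (auto intro!: ext prod.cong)

text \<open>Each step raises the order in a single factor, and distinctness ensures that no
  coordinate is treated twice. Thus the arbitrary enumeration in \<open>mi_deriv\<close> does not
  affect the result.\<close>

lemma foldr_partial_deriv_gauss:
  "distinct js \<Longrightarrow> foldr (\<lambda>j. partial_deriv j ^^ (\<alpha> $ j)) js (\<lambda>y. \<Prod>k\<in>UNIV. gauss_deriv 0 (y $ k)) =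
    (\<lambda>y. \<Prod>k\<in>UNIV. gauss_deriv (if k \<in> set js then \<alpha> $ k else 0) (y $ k))"
proof (induction js)
  case (Cons j js)
  have "(\<lambda>k. if k = j then (if k \<in> set js then \<alpha> $ k else 0) + \<alpha> $ j else if k \<in> set js then \<alpha> $ k else 0) =
      (\<lambda>k. if k \<in> set (j # js) then \<alpha> $ k else 0)" using Cons.prems by auto
  from fun_cong[OF this] show ?case
    using Cons partial_deriv_funpow_gauss_product[of "\<alpha> $ j" j "\<lambda>k. if k \<in> set js then \<alpha> $ k else 0"]
    by simp
qed simp

lemma mi_deriv_gauss:
  "mi_deriv \<alpha> (\<lambda>y. exp (- (norm y)\<^sup>2)) = (\<lambda>y. \<Prod>k\<in>UNIV. gauss_deriv (\<alpha> $ k) (y $ k))"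
  unfolding mi_deriv_def gauss_product
  by (subst foldr_partial_deriv_gauss) (simp_all add: some_enumeration)

lemma bil_self: "bil z z = (\<Sum>j\<in>UNIV. (z $ j)\<^sup>2)"
  by (simp add: bil_def power2_eq_square)

text \<open>Collects the normalising constants of kernel and Hermite function: \<open>p\<close> and
  \<open>q\<close> stand for the powers of \<pi>, \<open>u\<close> for the sign, \<open>w\<close>
  and \<open>s\<close> for the factorial and the powers of 2.\<close>

lemma mult_cancel_reciprocals:
  fixes p q s w u m :: real
  assumes "p * p * q = 1" "w * s = m" "u * u = 1"
  shows "(p * (p * u * w)) * (u * s * q) = m"
proof -
  have "(p * (p * u * w)) * (u * s * q) = (p * p * q) * (u * u) * (w * s)" by (simp only: mult_ac)
  then show ?thesis using assms by simp
qed

text \<open>The factor \<open>exp ((norm y)\<^sup>2 / 2)\<close> of the Hermite function cancels the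
  Gaussian of the kernel, leaving one-dimensional integrals at \<open>s = sqrt 2 * z $ j\<close>.
  Their factors \<open>exp ((z $ j)\<^sup>2 / 2)\<close> cancel
  \<open>exp (- (1/2) * bil z z)\<close>.\<close>

lemma integral_bargmann_kernel_hermite:
  fixes z :: "complex^'d"
  shows "(LINT y|lebesgue. bargmann_kernel z y * of_real (hermite_fun \<alpha> y)) =
    of_real (1 / sqrt (mi_fact \<alpha>)) * vmonom \<alpha> z"
proof -
  define K :: complex where "K = of_real (pi powr (- (real CARD('d) / 4)) * (pi powr (- (real CARD('d) / 4)) *
      (-1) ^ mi_abs \<alpha> * (2 ^ mi_abs \<alpha> * mi_fact \<alpha>) powr (- (1/2)))) * exp (- (1/2) * bil z z)"
  let ?f = "\<lambda>j t. exp (of_real (sqrt 2) * z $ j * of_real t) * of_real (gauss_deriv (\<alpha> $ j) t)"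
  have eq: "bargmann_kernel z y * of_real (hermite_fun \<alpha> y) = K * (\<Prod>j\<in>UNIV. ?f j (y $ j))" for y
  proof -
    have e: "- (1/2) * (bil z z + of_real ((norm y)\<^sup>2)) + of_real (sqrt 2) * bil z (cvec y) =
        - (1/2) * bil z z + of_real (- (norm y)\<^sup>2 / 2) + (\<Sum>j\<in>UNIV. of_real (sqrt 2) * z $ j * of_real (y $ j))"
      by (simp add: bil_def cvec_def sum_distrib_left mult.assoc algebra_simps)
    have "exp (- (1/2) * (bil z z + of_real ((norm y)\<^sup>2)) + of_real (sqrt 2) * bil z (cvec y)) * of_real (exp ((norm y)\<^sup>2 / 2)) =
        exp (- (1/2) * bil z z) * (\<Prod>j\<in>UNIV. exp (of_real (sqrt 2) * z $ j * of_real (y $ j)))"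
    proof -
      have "exp (of_real (- (norm y)\<^sup>2 / 2)) * complex_of_real (exp ((norm y)\<^sup>2 / 2)) = 1"
        by (simp only: exp_of_real[symmetric] exp_add[symmetric] of_real_add[symmetric]) simp
      then show ?thesis unfolding e exp_add by (simp add: exp_sum mult_ac)
    qed
    then show ?thesis
      unfolding bargmann_kernel_def hermite_fun_def mi_deriv_gauss K_def
      by (simp add: prod.distrib mult_ac)
  qed
  have "(LINT y|lebesgue. bargmann_kernel z y * of_real (hermite_fun \<alpha> y)) =
      K * (LINT y|(lebesgue :: (real^'d) measure). (\<Prod>j\<in>UNIV. ?f j (y $ j)))"
    unfolding eq by simp
  also have "(LINT y|(lebesgue :: (real^'d) measure). (\<Prod>j\<in>UNIV. ?f j (y $ j))) =
      (LINT y|(lborel :: (real^'d) measure). (\<Prod>j\<in>UNIV. ?f j (y $ j)))"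
  proof (rule integral_completion)
    have "(\<lambda>y :: real^'d. \<Prod>j\<in>UNIV. ?f j (y $ j)) \<in> borel_measurable borel"
    proof (rule borel_measurable_continuous_onI)
      have "continuous_on UNIV (\<lambda>y :: real^'d. gauss_deriv (\<alpha> $ j) (y $ j))" for j
        by (rule continuous_on_compose2[OF continuous_on_gauss_deriv[of UNIV]]) (auto intro!: continuous_intros)
      then show "continuous_on UNIV (\<lambda>y :: real^'d. \<Prod>j\<in>UNIV. ?f j (y $ j))"
        by (intro continuous_intros)
    qed
    then show "(\<lambda>y :: real^'d. \<Prod>j\<in>UNIV. ?f j (y $ j)) \<in> borel_measurable lborel" by simp
  qed
  also have "\<dots> = (\<Prod>j\<in>UNIV. (LINT t|lborel. ?f j t))"
    by (rule integral_prod_vec) (rule integrable_exp_gauss_deriv)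
  also have "\<dots> = (\<Prod>j\<in>UNIV. (- of_real (sqrt 2) * z $ j) ^ (\<alpha> $ j) * (of_real (sqrt pi) * exp ((z $ j)\<^sup>2 / 2)))"
    by (rule prod.cong[OF refl], subst integral_exp_gauss_deriv)
       (simp add: power_mult_distrib flip: of_real_power)
  also have "\<dots> = of_real ((-1) ^ mi_abs \<alpha> * sqrt 2 ^ mi_abs \<alpha> * sqrt pi ^ CARD('d)) * vmonom \<alpha> z * exp ((1/2) * bil z z)"
    by (simp add: prod.distrib power_mult_distrib power_sum mi_abs_def vmonom_def exp_sum bil_self
        sum_distrib_left power_minus[of "complex_of_real _"] power_minus[of "_ * _"])
  also have "K * \<dots> = of_real (1 / sqrt (mi_fact \<alpha>)) * vmonom \<alpha> z"
  proof -
    have e: "exp (- (1/2) * bil z z) * exp ((1/2) * bil z z) = 1"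
      by (simp flip: exp_add)
    have "pi powr (- (real CARD('d) / 4)) * pi powr (- (real CARD('d) / 4)) * sqrt pi ^ CARD('d) = 1"
    proof -
      have "sqrt pi ^ CARD('d) = pi powr (real CARD('d) / 2)"
        by (simp add: powr_half_sqrt[symmetric] powr_powr flip: powr_realpow)
      then show ?thesis by (simp flip: powr_add)
    qed
    moreover have "(2 ^ mi_abs \<alpha> * mi_fact \<alpha>) powr (- (1/2)) * sqrt 2 ^ mi_abs \<alpha> = 1 / sqrt (mi_fact \<alpha>)"
    proof -
      have "(2 ^ mi_abs \<alpha> * mi_fact \<alpha>) powr (- (1/2)) = 1 / (sqrt 2 ^ mi_abs \<alpha> * sqrt (mi_fact \<alpha>))"
        using mi_fact_pos[of \<alpha>]
        by (simp add: powr_minus powr_half_sqrt real_sqrt_mult real_sqrt_power inverse_eq_divide)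
      then show ?thesis by (simp add: field_simps)
    qed
    moreover have "((-1::real) ^ mi_abs \<alpha>) * (-1) ^ mi_abs \<alpha> = 1" by (simp flip: power_mult_distrib)
    ultimately have r: "(pi powr (- (real CARD('d) / 4)) * (pi powr (- (real CARD('d) / 4)) *
      (-1) ^ mi_abs \<alpha> * (2 ^ mi_abs \<alpha> * mi_fact \<alpha>) powr (- (1/2)))) *
      ((-1) ^ mi_abs \<alpha> * sqrt 2 ^ mi_abs \<alpha> * sqrt pi ^ CARD('d)) = 1 / sqrt (mi_fact \<alpha>)"
      by (rule mult_cancel_reciprocals)
    have "K * (of_real ((-1) ^ mi_abs \<alpha> * sqrt 2 ^ mi_abs \<alpha> * sqrt pi ^ CARD('d)) * vmonom \<alpha> z * exp ((1/2) * bil z z)) =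
      of_real ((pi powr (- (real CARD('d) / 4)) * (pi powr (- (real CARD('d) / 4)) *
      (-1) ^ mi_abs \<alpha> * (2 ^ mi_abs \<alpha> * mi_fact \<alpha>) powr (- (1/2)))) *
      ((-1) ^ mi_abs \<alpha> * sqrt 2 ^ mi_abs \<alpha> * sqrt pi ^ CARD('d))) * vmonom \<alpha> z *
      (exp (- (1/2) * bil z z) * exp ((1/2) * bil z z))"
      by (simp only: K_def of_real_mult mult_ac)
    then show ?thesis unfolding r e by simp
  qed
  finally show ?thesis .
qed

lemma hermite_coeff_cnj_bargmann_kernel:
  "hermite_coeff (\<lambda>y. cnj (bargmann_kernel z y)) \<alpha> = cnj (of_real (1 / sqrt (mi_fact \<alpha>)) * vmonom \<alpha> z)"
proof -
  have "hermite_coeff (\<lambda>y. cnj (bargmann_kernel z y)) \<alpha> =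
      (LINT y|lebesgue. cnj (bargmann_kernel z y * of_real (hermite_fun \<alpha> y)))"
    by (simp add: hermite_coeff_def)
  then show ?thesis unfolding Bochner_Integration.integral_cnj integral_bargmann_kernel_hermite .
qed

lemma bargmann_eq_flat_series: "bargmann c = flat_series c"
  by (rule ext)
     (simp add: bargmann_def bil_pairing_def sesq_pairing_def hermite_coeff_cnj_bargmann_kernel
       flat_series_def flat_term_def mult.assoc del: complex_cnj_mult)

section \<open>The short-time Fourier transform in terms of the Bargmann transform\<close>

definition phase_factor :: "real^'d \<Rightarrow> real^'d \<Rightarrow> complex" where
  "phase_factor x \<xi> = exp (of_real (- (norm x)\<^sup>2 / 4 - (norm \<xi>)\<^sup>2 / 4) - \<i> * of_real (x \<bullet> \<xi> / 2))"

lemma norm_phase_factor: "cmod (phase_factor x \<xi>) = exp (- (norm x)\<^sup>2 / 4) * exp (- (norm \<xi>)\<^sup>2 / 4)"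
  by (simp add: phase_factor_def flip: exp_add)

lemma of_real_2_powr_neg_half: "2 powr (- (1/2)) = 1 / sqrt (2::real)"
  by (simp add: powr_minus powr_half_sqrt inverse_eq_divide)

lemma bil_phase_point_self:
  "bil (phase_point x \<xi>) (phase_point x \<xi>) =
    of_real ((norm x)\<^sup>2 / 2 - (norm \<xi>)\<^sup>2 / 2) - \<i> * of_real (x \<bullet> \<xi>)"
proof -
  have "phase_point x \<xi> $ j * phase_point x \<xi> $ j =
      of_real (x $ j * x $ j / 2 - \<xi> $ j * \<xi> $ j / 2) - \<i> * of_real (x $ j * \<xi> $ j)" for j
    by (simp add: phase_point_def cvec_def of_real_2_powr_neg_half complex_eq_iff field_simps)
  then show ?thesis
    by (simp add: bil_def sum_subtractf power2_norm_eq_inner inner_vec_def sum_divide_distrib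
        flip: sum_distrib_left)
qed

lemma sqrt2_bil_phase_point:
  "of_real (sqrt 2) * bil (phase_point x \<xi>) (cvec y) = of_real (x \<bullet> y) - \<i> * of_real (y \<bullet> \<xi>)"
proof -
  have "of_real (sqrt 2) * (phase_point x \<xi> $ j * cvec y $ j) =
      of_real (x $ j * y $ j) - \<i> * of_real (y $ j * \<xi> $ j)" for j
    by (simp add: phase_point_def cvec_def of_real_2_powr_neg_half complex_eq_iff field_simps)
  then show ?thesis
    by (simp add: bil_def sum_distrib_left sum_subtractf inner_vec_def)
qed

text \<open>The exponent \<open>- (1/2) * bil z z\<close> of the kernel contributes
  \<open>- (norm x)\<^sup>2 / 4 + (norm \<xi>)\<^sup>2 / 4\<close> and the phase
  \<open>x \<bullet> \<xi> / 2\<close>. The factor \<open>phase_factor\<close> completes the former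
  to \<open>- (norm x)\<^sup>2 / 2\<close> and cancels the latter.\<close>

lemma modulated_gauss_eq:
  "exp (\<i> * of_real (y \<bullet> \<xi>)) * of_real (gauss (y - x)) =
    cnj (phase_factor x \<xi>) * cnj (bargmann_kernel (phase_point x \<xi>) y)"
proof -
  have n: "(norm (y - x))\<^sup>2 = (norm y)\<^sup>2 - 2 * (x \<bullet> y) + (norm x)\<^sup>2"
    by (simp add: power2_norm_eq_inner inner_diff_left inner_diff_right inner_commute)
  have "(of_real (- (norm x)\<^sup>2 / 4 - (norm \<xi>)\<^sup>2 / 4) - \<i> * of_real (x \<bullet> \<xi> / 2)) +
      (- (1/2) * (bil (phase_point x \<xi>) (phase_point x \<xi>) + of_real ((norm y)\<^sup>2)) +
       of_real (sqrt 2) * bil (phase_point x \<xi>) (cvec y)) =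
      of_real (- (norm (y - x))\<^sup>2 / 2) - \<i> * of_real (y \<bullet> \<xi>)"
    unfolding bil_phase_point_self sqrt2_bil_phase_point n
    by (simp add: complex_eq_iff field_simps)
  then have "phase_factor x \<xi> * bargmann_kernel (phase_point x \<xi>) y =
      of_real (pi powr (- (real CARD('a) / 4))) * exp (of_real (- (norm (y - x))\<^sup>2 / 2) - \<i> * of_real (y \<bullet> \<xi>))"
    unfolding phase_factor_def bargmann_kernel_def by (simp only: mult.left_commute exp_add[symmetric])
  then have "cnj (phase_factor x \<xi> * bargmann_kernel (phase_point x \<xi>) y) =
      of_real (pi powr (- (real CARD('a) / 4))) * exp (of_real (- (norm (y - x))\<^sup>2 / 2) + \<i> * of_real (y \<bullet> \<xi>))"
    by (simp add: exp_cnj)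
  also have "\<dots> = exp (\<i> * of_real (y \<bullet> \<xi>)) * of_real (gauss (y - x))"
    unfolding gauss_def exp_add by (simp only: exp_of_real of_real_mult mult_ac)
  finally show ?thesis by simp
qed

lemma stft_eq_bargmann:
  "stft c (x, \<xi>) = of_real ((2 * pi) powr (- (real CARD('d) / 2))) * phase_factor x \<xi> *
    bargmann c (phase_point x \<xi>)" for x \<xi> :: "real^'d"
proof -
  let ?p = "phase_point x \<xi>"
  have "hermite_coeff (\<lambda>y. exp (\<i> * of_real (y \<bullet> \<xi>)) * of_real (gauss (y - x))) \<alpha> =
      cnj (phase_factor x \<xi>) * hermite_coeff (\<lambda>y. cnj (bargmann_kernel ?p y)) \<alpha>" for \<alpha>
    unfolding modulated_gauss_eq hermite_coeff_def by (simp add: mult.assoc)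
  then have "sesq_pairing c (\<lambda>y. exp (\<i> * of_real (y \<bullet> \<xi>)) * of_real (gauss (y - x))) =
      (\<Sum>\<^sub>\<infinity>\<alpha>. phase_factor x \<xi> * (c \<alpha> * cnj (hermite_coeff (\<lambda>y. cnj (bargmann_kernel ?p y)) \<alpha>)))"
    by (simp add: sesq_pairing_def mult_ac)
  also have "\<dots> = phase_factor x \<xi> * bargmann c ?p"
    by (simp add: infsum_cmult_right' bargmann_def bil_pairing_def sesq_pairing_def)
  finally show ?thesis by (simp add: stft_def mult.assoc)
qed

section \<open>Lower bounds on balls and the maximum of an entire function\<close>

context orlicz begin

text \<open>The Young function exceeds 1 at some \<tau>, and convexity with value 0 at the origin
  keeps it above the line of slope \<open>1 / \<tau>\<close> from there on.\<close>

lemma Phi_linear_lower_bound: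
  obtains \<tau> where "0 < \<tau>" "\<And>t. 0 \<le> t \<Longrightarrow> \<tau> \<le> t powr r \<Longrightarrow> ennreal (t powr r / \<tau>) \<le> \<Phi> t"
proof (rule quasi_youngE)
  fix \<Phi>\<^sub>0 assume y: "young \<Phi>\<^sub>0" and e: "\<And>t. 0 \<le> t \<Longrightarrow> \<Phi> t = \<Phi>\<^sub>0 (t powr r)"
  have "eventually (\<lambda>u. 1 < \<Phi>\<^sub>0 u) at_top"
    using y by (auto simp: young_def order_tendsto_iff)
  then have "eventually (\<lambda>u. 1 < \<Phi>\<^sub>0 u \<and> 0 < u) at_top"
    using eventually_gt_at_top[of 0] by eventually_elim auto
  then obtain \<tau> where \<tau>: "0 < \<tau>" "1 < \<Phi>\<^sub>0 \<tau>"
    using eventually_happens'[OF trivial_limit_at_top_linorder] by blast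
  show ?thesis
  proof (rule that[OF \<tau>(1)])
    fix t :: real assume t: "0 \<le> t" "\<tau> \<le> t powr r"
    define u \<theta> where "u = t powr r" and "\<theta> = \<tau> / u"
    have "0 < u" "\<tau> \<le> u" using t \<tau> by (auto simp: u_def)
    then have u: "0 < u" "\<theta> \<in> {0..1}" "0 < \<theta>" using \<tau> by (auto simp: \<theta>_def)
    have "1 \<le> \<Phi>\<^sub>0 ((1 - \<theta>) * 0 + \<theta> * u)" using u \<tau> by (simp add: \<theta>_def)
    also have "\<dots> \<le> ennreal (1 - \<theta>) * \<Phi>\<^sub>0 0 + ennreal \<theta> * \<Phi>\<^sub>0 u"
      using y u unfolding young_def by (meson less_imp_le order_refl)
    also have "\<dots> = ennreal \<theta> * \<Phi>\<^sub>0 u" using y by (simp add: young_def)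
    finally have 1: "1 \<le> ennreal \<theta> * \<Phi>\<^sub>0 u" .
    have "ennreal (1 / \<theta>) * 1 \<le> ennreal (1 / \<theta>) * (ennreal \<theta> * \<Phi>\<^sub>0 u)"
      by (rule mult_left_mono[OF 1]) simp
    also have "\<dots> = \<Phi>\<^sub>0 u" using u by (simp flip: mult.assoc ennreal_mult)
    finally show "ennreal (t powr r / \<tau>) \<le> \<Phi> t"
      using e[OF t(1)] by (simp add: \<theta>_def u_def)
  qed
qed

text \<open>Admissibility of \<open>a\<close> means \<open>\<Phi> (1 / a) * m \<le> 1\<close>.
  Either \<open>(1 / a) powr r\<close> lies below the threshold \<tau>, or the linear lower bound
  applies; both cases bound \<open>a\<close> from below.\<close>

lemma lnorm_indicator_lower_bound:
  assumes "0 < V"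
  obtains c where "0 < c"
    "\<And>(S :: 'a::euclidean_space set) m. S \<in> sets lborel \<Longrightarrow> emeasure lborel S = ennreal m \<Longrightarrow> 0 < m \<Longrightarrow> m \<le> V \<Longrightarrow>
      ennreal (c * m powr (1 / r)) \<le> lnorm (indicator S)"
proof -
  obtain \<tau> where \<tau>: "0 < \<tau>" "\<And>t. 0 \<le> t \<Longrightarrow> \<tau> \<le> t powr r \<Longrightarrow> ennreal (t powr r / \<tau>) \<le> \<Phi> t"
    using Phi_linear_lower_bound by blast
  \<comment> \<open>Unifies the two cases: \<open>1 \<le> W\<close> serves the linear regime, and
    \<open>m \<le> V \<le> W\<close> serves the one below the threshold.\<close>
  define W where "W = max V 1"
  have W: "1 \<le> W" "V \<le> W" by (auto simp: W_def)
  define c where "c = (1 / (\<tau> * W)) powr (1 / r)"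
  show ?thesis
  proof (rule that)
    show "0 < c" using \<tau> W by (simp add: c_def)
    fix S :: "'a set" and m :: real
    assume S: "S \<in> sets lborel" "emeasure lborel S = ennreal m" "0 < m" "m \<le> V"
    show "ennreal (c * m powr (1 / r)) \<le> lnorm (indicator S)"
      unfolding orlicz_norm_def
    proof (rule INF_greatest)
      fix a assume "a \<in> {a. 0 < a \<and> (\<integral>\<^sup>+x. Phi_ext (indicator S x / ennreal a) \<partial>lebesgue) \<le> 1}"
      then have a: "0 < a" "(\<integral>\<^sup>+x. Phi_ext (indicator S x / ennreal a) \<partial>lebesgue) \<le> 1" by auto
      have "Phi_ext (indicator S x / ennreal a) = \<Phi> (1 / a) * indicator S x" for x
        using a(1) divide_ennreal[of 1 a] by (cases "x \<in> S") auto
      then have le: "\<Phi> (1 / a) * ennreal m \<le> 1"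
        using a(2) S by (simp add: nn_integral_completion nn_integral_cmult_indicator)
      have "(1 / a) powr r \<le> \<tau> * W / m"
      proof (cases "\<tau> \<le> (1 / a) powr r")
        case True
        have "ennreal ((1 / a) powr r / \<tau>) * ennreal m \<le> 1"
          using \<tau>(2)[OF _ True] a by (intro order_trans[OF mult_right_mono le]) auto
        then have "(1 / a) powr r / \<tau> * m \<le> 1"
          using \<tau> S by (simp flip: ennreal_mult ennreal_1)
        then have "(1 / a) powr r \<le> \<tau> / m" using \<tau> S by (simp add: field_simps)
        also have "\<dots> \<le> \<tau> * W / m" using \<tau> S W by (simp add: divide_right_mono)
        finally show ?thesis .
      next
        case False
        then have "(1 / a) powr r \<le> \<tau> * 1" by simp
        also have "\<dots> \<le> \<tau> * (W / m)" using \<tau> S W by (intro mult_left_mono) auto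
        finally show ?thesis by simp
      qed
      then have "m / (\<tau> * W) \<le> a powr r"
        using a S \<tau> W by (simp add: powr_divide field_simps)
      then have "(m / (\<tau> * W)) powr (1 / r) \<le> (a powr r) powr (1 / r)"
        using S \<tau> W r_pos by (intro powr_mono2) auto
      then have "c * m powr (1 / r) \<le> a"
        using a S \<tau> W r_pos by (simp add: c_def powr_powr powr_divide)
      then show "ennreal (c * m powr (1 / r)) \<le> ennreal a" by (rule ennreal_leI)
    qed
  qed
qed

text \<open>The natural exponent of the radius is the dimension divided by \<open>r\<close>. For
  radii at most 1 it may be raised to an integer, as needed for the integer power in
  \<open>entire_max_bound\<close>.\<close>

lemma lnorm_cball_lower_bound:
  obtains c where "0 < c"
    "\<And>(x :: 'a::euclidean_space) \<eta> t. 0 < \<eta> \<Longrightarrow> \<eta> \<le> 1 \<Longrightarrow> real DIM('a) / r \<le> real t \<Longrightarrow>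
      ennreal (c * \<eta> ^ t) \<le> lnorm (indicator (cball x \<eta>))"
proof -
  define v where "v = unit_ball_vol (real DIM('a))"
  have v: "0 < v" by (simp add: v_def)
  obtain c where c: "0 < c"
    "\<And>(S :: 'a set) m. S \<in> sets lborel \<Longrightarrow> emeasure lborel S = ennreal m \<Longrightarrow> 0 < m \<Longrightarrow> m \<le> v \<Longrightarrow>
      ennreal (c * m powr (1 / r)) \<le> lnorm (indicator S)"
    using lnorm_indicator_lower_bound[OF v] by blast
  show ?thesis
  proof (rule that)
    show "0 < c * v powr (1 / r)" using c v by simp
    fix x :: 'a and \<eta> :: real and t :: nat
    assume \<eta>: "0 < \<eta>" "\<eta> \<le> 1" and t: "real DIM('a) / r \<le> real t"
    have "\<eta> ^ t = \<eta> powr real t" using \<eta> by (simp add: powr_realpow)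
    also have "\<dots> \<le> \<eta> powr (real DIM('a) / r)" using \<eta> t by (intro powr_mono') auto
    also have "\<dots> = (\<eta> ^ DIM('a)) powr (1 / r)" using \<eta> by (simp add: powr_powr flip: powr_realpow)
    finally have "c * v powr (1 / r) * \<eta> ^ t \<le> c * v powr (1 / r) * (\<eta> ^ DIM('a)) powr (1 / r)"
      using c v by (intro mult_left_mono) auto
    also have "\<dots> = c * (v * \<eta> ^ DIM('a)) powr (1 / r)"
      using v \<eta> by (simp add: powr_mult)
    finally have "ennreal (c * v powr (1 / r) * \<eta> ^ t) \<le> ennreal (c * (v * \<eta> ^ DIM('a)) powr (1 / r))"
      by (rule ennreal_leI)
    also have "\<dots> \<le> lnorm (indicator (cball x \<eta>))"
    proof (rule c(2))
      show "emeasure lborel (cball x \<eta>) = ennreal (v * \<eta> ^ DIM('a))"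
        using \<eta> by (simp add: emeasure_cball v_def)
      show "v * \<eta> ^ DIM('a) \<le> v" using v \<eta> by (simp add: power_le_one)
    qed (use v \<eta> in auto)
    finally show "ennreal (c * v powr (1 / r) * \<eta> ^ t) \<le> lnorm (indicator (cball x \<eta>))" .
  qed
qed

end

section \<open>Phase-space coordinates on the complex domain\<close>

definition phase_map :: "(real^'d) \<times> (real^'d) \<Rightarrow> complex^'d" where
  "phase_map p = phase_point (fst p) (snd p)"

definition phase_inv :: "complex^'d \<Rightarrow> (real^'d) \<times> (real^'d)" where
  "phase_inv z = ((\<chi> j. sqrt 2 * Re (z $ j)), (\<chi> j. - sqrt 2 * Im (z $ j)))"

lemma phase_map_nth: "phase_map p $ j = Complex (fst p $ j / sqrt 2) (- (snd p $ j) / sqrt 2)"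
  by (simp add: phase_map_def phase_point_def cvec_def of_real_2_powr_neg_half complex_eq_iff)

lemma phase_map_inv [simp]: "phase_map (phase_inv z) = z"
  by (simp add: vec_eq_iff phase_map_nth phase_inv_def complex_eq_iff)

lemma phase_inv_map [simp]: "phase_inv (phase_map p) = p"
  by (simp add: phase_inv_def phase_map_nth prod_eq_iff vec_eq_iff)

lemma linear_phase_map: "linear phase_map"
  by (intro linearI) (auto simp: vec_eq_iff phase_map_nth complex_eq_iff add_divide_distrib diff_divide_distrib)

lemma linear_phase_inv: "linear phase_inv"
  by (intro linearI) (auto simp: phase_inv_def vec_eq_iff algebra_simps)

lemma norm_phase_map: "norm (phase_map p) = norm p / sqrt 2"
proof -
  have "(norm (phase_map p))\<^sup>2 = (\<Sum>j\<in>UNIV. (cmod (phase_map p $ j))\<^sup>2)"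
    by (simp add: norm_vec_def L2_set_def sum_nonneg)
  also have "\<dots> = (\<Sum>j\<in>UNIV. ((fst p $ j)\<^sup>2 + (snd p $ j)\<^sup>2) / 2)"
    by (simp add: phase_map_nth cmod_power2 power_divide add_divide_distrib)
  also have "\<dots> = ((norm (fst p))\<^sup>2 + (norm (snd p))\<^sup>2) / 2"
    by (simp add: norm_vec_def L2_set_def sum_nonneg sum.distrib flip: sum_divide_distrib)
  also have "\<dots> = (norm p / sqrt 2)\<^sup>2"
    by (simp add: norm_prod_def power_divide)
  finally show ?thesis by (rule power2_eq_imp_eq) auto
qed

lemma linear_differentiable_on: "linear f \<Longrightarrow> f differentiable_on S"
  for f :: "'a::euclidean_space \<Rightarrow> 'b::euclidean_space"
  by (simp add: linear_conv_bounded_linear bounded_linear_imp_differentiable_on)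

text \<open>Continuity gives Borel preimages of Borel sets only. Preimages of Lebesgue sets are
  handled as images under the linear inverse, which preserves Lebesgue measurability.\<close>

lemma measurable_phase_map: "phase_map \<in> lebesgue \<rightarrow>\<^sub>M lebesgue"
proof (rule measurableI)
  fix S :: "(complex^'a) set" assume "S \<in> sets lebesgue"
  then have "phase_inv ` S \<in> sets lebesgue"
    by (rule differentiable_image_in_sets_lebesgue) (auto intro: linear_differentiable_on linear_phase_inv)
  moreover have "phase_inv ` S = phase_map -` S"
    by (auto simp: image_iff) (metis phase_inv_map)
  ultimately show "phase_map -` S \<inter> space lebesgue \<in> sets lebesgue" by simp
qed simp

lemma AE_phase_map: "(AE z in lebesgue. P z) \<longleftrightarrow> (AE p in lebesgue. P (phase_map p))"
proof
  assume "AE z in lebesgue. P z"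
  then obtain N where N: "negligible N" "{z. \<not> P z} \<subseteq> N"
    by (auto simp: eventually_ae_filter_negligible)
  have "negligible (phase_inv ` N)"
    by (rule negligible_differentiable_image_negligible)
       (auto intro: linear_differentiable_on linear_phase_inv N)
  moreover have "{p. \<not> P (phase_map p)} \<subseteq> phase_inv ` N"
    using N(2) by (auto simp: image_iff intro!: bexI[of _ "phase_map _"])
  ultimately show "AE p in lebesgue. P (phase_map p)"
    by (auto simp: eventually_ae_filter_negligible)
next
  assume "AE p in lebesgue. P (phase_map p)"
  then obtain N where N: "negligible N" "{p. \<not> P (phase_map p)} \<subseteq> N"
    by (auto simp: eventually_ae_filter_negligible)
  have "negligible (phase_map ` N)"
    by (rule negligible_differentiable_image_negligible)
       (auto intro: linear_differentiable_on linear_phase_map N)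
  moreover have "{z. \<not> P z} \<subseteq> phase_map ` N"
  proof
    fix z assume "z \<in> {z. \<not> P z}"
    then have "phase_inv z \<in> N" using N(2) by auto
    then show "z \<in> phase_map ` N" by (metis imageI phase_map_inv)
  qed
  ultimately show "AE z in lebesgue. P z"
    by (auto simp: eventually_ae_filter_negligible)
qed

lemma entire_measurable: "entire F \<Longrightarrow> F \<in> borel_measurable lebesgue"
  by (intro measurable_completion) (simp add: borel_measurable_continuous_onI entire_continuous_on)

text \<open>The set of disagreement is open, and a null open set is empty. This is why equality, not
  equality almost everywhere, identifies elements of the \<open>A\<close> space.\<close>

lemma AE_eq_imp_eq_entire:
  assumes "entire F" "entire G" "AE z in lebesgue. F z = G z"
  shows "F = G"
proof
  fix z
  obtain N where N: "negligible N" "{z. F z \<noteq> G z} \<subseteq> N"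
    using assms(3) by (auto simp: eventually_ae_filter_negligible)
  have "open {z. F z \<noteq> G z}"
    by (intro open_Collect_neq entire_continuous_on assms)
  then show "F z = G z"
    using negligible_subset[OF N] open_not_negligible[of "{z. F z \<noteq> G z}"] by blast
qed

text \<open>This replaces the subharmonicity of \<open>|F|\<^sup>r\<close>. At a maximum point \<open>z\<^sub>0\<close> of
  \<open>|F(z)| (\<rho> - |z|)\<^sup>s\<close> the function is at most \<open>2\<^sup>s |F(z\<^sub>0)|\<close> on the ball of radius \<open>\<delta>\<close>, so the Cauchy
  estimates keep \<open>|F|\<close> above \<open>|F(z\<^sub>0)| / 2\<close> on a ball of comparable radius.\<close>

lemma entire_max_bound:
  fixes F :: "complex^'d \<Rightarrow> complex"
  assumes F: "entire F" and \<rho>: "0 < \<rho>" and s: "0 < s"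
  obtains z\<^sub>0 \<delta> where "0 < \<delta>" "norm z\<^sub>0 + 2 * \<delta> = \<rho>"
    "\<And>z. norm z \<le> \<rho> \<Longrightarrow> cmod (F z) * (\<rho> - norm z) ^ s \<le> cmod (F z\<^sub>0) * (2 * \<delta>) ^ s"
    "\<And>z. norm (z - z\<^sub>0) \<le> \<delta> / 2 ^ (s + 2) \<Longrightarrow> cmod (F z\<^sub>0) / 2 \<le> cmod (F z)"
proof -
  define h where "h z = cmod (F z) * (\<rho> - norm z) ^ s" for z
  have "continuous_on (cball 0 \<rho>) h"
    unfolding h_def by (intro continuous_intros entire_continuous_on F)
  moreover have "cball 0 \<rho> \<noteq> ({} :: (complex^'d) set)" using \<rho> by simp
  ultimately obtain z\<^sub>1 where z\<^sub>1: "norm z\<^sub>1 \<le> \<rho>" "\<And>z. norm z \<le> \<rho> \<Longrightarrow> h z \<le> h z\<^sub>1"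
    using continuous_attains_sup[of "cball 0 \<rho>" h] by auto
  show ?thesis
  proof (cases "h z\<^sub>1 = 0")
    case True
    have "h 0 \<le> 0" using z\<^sub>1(2)[of 0] \<rho> True by simp
    then have F0: "F 0 = 0" using zero_less_power[OF \<rho>, of s] by (simp add: h_def mult_le_0_iff)
    show ?thesis
    \<comment> \<open>The weighted maximum is 0 and \<open>F 0 = 0\<close>, so the centre with half
      the radius meets every requirement.\<close>
    proof (rule that[of "\<rho> / 2" 0])
      show "cmod (F z) * (\<rho> - norm z) ^ s \<le> cmod (F 0) * (2 * (\<rho> / 2)) ^ s" if "norm z \<le> \<rho>" for z
        using z\<^sub>1(2)[OF that] F0 unfolding True by (simp add: h_def)
    qed (use \<rho> F0 in auto)
  next
    case False
    define \<delta> where "\<delta> = (\<rho> - norm z\<^sub>1) / 2"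
    have "norm z\<^sub>1 \<noteq> \<rho>" using False s by (auto simp: h_def)
    moreover have "2 * \<delta> = \<rho> - norm z\<^sub>1" by (simp only: \<delta>_def field_sum_of_halves mult_2)
    ultimately have \<delta>: "0 < \<delta>" "norm z\<^sub>1 + 2 * \<delta> = \<rho>" using z\<^sub>1(1) by linarith+
    then have "\<rho> - norm z\<^sub>1 = 2 * \<delta>" by linarith
    then have hz: "h z\<^sub>1 = cmod (F z\<^sub>1) * (2 * \<delta>) ^ s" by (simp add: h_def)
    \<comment> \<open>Within \<delta> of the maximum point the distance to the sphere is at least
      half of \<open>2 * \<delta>\<close>, which costs the factor \<open>2 ^ s\<close>.\<close>
    define M where "M = 2 ^ s * cmod (F z\<^sub>1)"
    have M: "cmod (F w) \<le> M" if "norm (w - z\<^sub>1) \<le> \<delta>" for w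
    proof -
      have w: "norm w \<le> norm z\<^sub>1 + \<delta>" using that norm_triangle_sub[of w z\<^sub>1] by simp
      have "cmod (F w) * \<delta> ^ s \<le> h w"
        unfolding h_def using w \<delta> by (intro mult_left_mono power_mono) auto
      also have "\<dots> \<le> cmod (F z\<^sub>1) * (2 * \<delta>) ^ s"
        unfolding hz[symmetric] using w \<delta> by (intro z\<^sub>1(2)) linarith
      finally have "cmod (F w) * \<delta> ^ s \<le> M * \<delta> ^ s" by (simp add: M_def power_mult_distrib mult_ac)
      then show ?thesis using \<delta> by simp
    qed
    have D: "cmod (frechet_derivative F (at w) v) \<le> M / (\<delta> / 2) * norm v"
      if "w \<in> cball z\<^sub>1 (\<delta> / 2)" for w v
    proof (rule entire_derivative_bound[OF F])
      fix u assume "u \<in> cball w (\<delta> / 2)"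
      then have "norm (u - z\<^sub>1) \<le> \<delta>"
        using that norm_triangle_ineq[of "u - w" "w - z\<^sub>1"] by (simp add: dist_norm norm_minus_commute)
      then show "cmod (F u) \<le> M" by (rule M)
    qed (use \<delta> in simp)
    show ?thesis
    proof (rule that[OF \<delta>])
      show "cmod (F z) * (\<rho> - norm z) ^ s \<le> cmod (F z\<^sub>1) * (2 * \<delta>) ^ s" if "norm z \<le> \<rho>" for z
        using z\<^sub>1(2)[OF that] unfolding hz by (simp add: h_def)
      \<comment> \<open>The derivative is at most \<open>2 ^ (s + 1) / \<delta>\<close> times
        \<open>cmod (F z\<^sub>1)\<close> nearby, so over this radius \<open>F\<close> changes by at
        most half of \<open>cmod (F z\<^sub>1)\<close>.\<close>
      fix z assume z: "norm (z - z\<^sub>1) \<le> \<delta> / 2 ^ (s + 2)"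
      have "\<delta> / 2 ^ (s + 2) \<le> \<delta> / 2 ^ 1"
        using \<delta> by (intro divide_left_mono power_increasing) auto
      with z have "z \<in> cball z\<^sub>1 (\<delta> / 2)" by (simp add: dist_norm norm_minus_commute)
      moreover have "z\<^sub>1 \<in> cball z\<^sub>1 (\<delta> / 2)" using \<delta> by simp
      moreover have "onorm (frechet_derivative F (at w)) \<le> M / (\<delta> / 2)" if "w \<in> cball z\<^sub>1 (\<delta> / 2)" for w
        by (rule onorm_le) (rule D[OF that])
      moreover have "(F has_derivative frechet_derivative F (at w)) (at w within cball z\<^sub>1 (\<delta> / 2))" for w
        by (rule has_derivative_at_withinI) (rule entire_has_derivative[OF F])
      ultimately have "norm (F z - F z\<^sub>1) \<le> M / (\<delta> / 2) * norm (z - z\<^sub>1)"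
        by (intro differentiable_bound[OF convex_cball])
      also have "\<dots> \<le> M / (\<delta> / 2) * (\<delta> / 2 ^ (s + 2))"
        using z \<delta> by (intro mult_left_mono) (auto simp: M_def)
      also have "\<dots> = cmod (F z\<^sub>1) / 2" using \<delta> by (simp add: M_def power_add)
      finally show "cmod (F z\<^sub>1) / 2 \<le> cmod (F z)"
        using norm_triangle_ineq2[of "F z\<^sub>1" "F z"] by (simp add: norm_minus_commute)
    qed
  qed
qed

section \<open>The Bargmann-type and modulation spaces\<close>

lemma vector_space_fun_scale: "vector_space (fun_scale :: complex \<Rightarrow> ('b \<Rightarrow> complex) \<Rightarrow> 'b \<Rightarrow> complex)"
  by standard (auto simp: fun_scale_def fun_eq_iff algebra_simps)

lemma subspace_fun_scaleI:
  assumes "0 \<in> V" "\<And>f g. f \<in> V \<Longrightarrow> g \<in> V \<Longrightarrow> f + g \<in> V" "\<And>a f. f \<in> V \<Longrightarrow> fun_scale a f \<in> V"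
  shows "module.subspace fun_scale V"
proof -
  interpret vector_space fun_scale by (rule vector_space_fun_scale)
  show ?thesis using assms by (simp add: subspace_def)
qed

lemma quasi_banach_spaceI:
  assumes r: "0 < r" "r \<le> 1"
    and "vector_space smul" "module.subspace smul V"
    and nonneg: "\<And>f. f \<in> V \<Longrightarrow> 0 \<le> N f"
    and "\<And>f g. f \<in> V \<Longrightarrow> g \<in> V \<Longrightarrow> N (f - g) = 0 \<longleftrightarrow> eqv f g"
    and "\<And>a f. f \<in> V \<Longrightarrow> N (smul a f) = cmod a * N f"
    and tri: "\<And>f g. f \<in> V \<Longrightarrow> g \<in> V \<Longrightarrow> N (f + g) \<le> qadd r (N f) (N g)"
    and add: "\<And>f g. f \<in> V \<Longrightarrow> g \<in> V \<Longrightarrow> f + g \<in> V"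
    and complete: "\<And>s. (\<And>n. s n \<in> V) \<Longrightarrow>
      (\<And>e. 0 < e \<Longrightarrow> \<exists>k::nat. \<forall>m\<ge>k. \<forall>n\<ge>k. N (s m - s n) < e) \<Longrightarrow> \<exists>f\<in>V. (\<lambda>n. N (s n - f)) \<longlonglongrightarrow> 0"
  shows "quasi_banach_space smul eqv r V N"
proof -
  have "N (f + g) \<le> 2 powr (1 / r - 1) * (N f + N g)" if "f \<in> V" "g \<in> V" for f g
    using tri[OF that] qadd_le[OF r nonneg[OF that(1)] nonneg[OF that(2)]] by simp
  moreover have "N (f + g) powr r \<le> N f powr r + N g powr r" if "f \<in> V" "g \<in> V" for f g
    using powr_mono2[OF _ nonneg[OF add[OF that]] tri[OF that], of r] r by (simp add: qadd_powr)
  ultimately show ?thesis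
    unfolding quasi_banach_space_def using assms by auto
qed

section \<open>Reduction to one weighted mixed quasi-norm\<close>

locale bargmann_setting = mixed_orlicz r \<Phi>1 \<Phi>2
  for r :: real and \<Phi>1 \<Phi>2 :: "real \<Rightarrow> ennreal" +
  fixes \<omega> :: "(real^'d) \<times> (real^'d) \<Rightarrow> real"
  assumes weight: "weight \<omega>"
begin

text \<open>Absorbs the constant and the Gaussian factors into the weight, so that the quasi-norms
  of all three spaces become one mixed quasi-norm of \<open>F\<close> in phase-space
  coordinates.\<close>

definition wt :: "(real^'d) \<times> (real^'d) \<Rightarrow> real" where
  "wt p = (2 * pi) powr (- (real CARD('d) / 2)) *
     (exp (- (norm (fst p))\<^sup>2 / 4) * exp (- (norm (snd p))\<^sup>2 / 4) * \<omega> p)"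

lemma omega_pos: "0 < \<omega> p"
  using weight unfolding weight_def by blast

lemma wt_pos: "0 < wt p"
  by (simp add: wt_def omega_pos)

lemma wt_measurable [measurable]: "wt \<in> borel_measurable lebesgue"
proof -
  have [measurable]: "\<omega> \<in> borel_measurable lebesgue" using weight by (simp add: weight_def Linf_loc_def)
  have [measurable]: "(\<lambda>p :: (real^'d) \<times> (real^'d). exp (- (norm (fst p))\<^sup>2 / 4) * exp (- (norm (snd p))\<^sup>2 / 4)) \<in> borel_measurable lebesgue"
    by (intro measurable_completion) (auto intro!: borel_measurable_continuous_onI continuous_intros)
  show ?thesis unfolding wt_def[abs_def] by measurable
qed

text \<open>A local essential bound on \<open>1 / \<omega>\<close> is a lower bound on \<omega>,
  valid almost everywhere, and the Gaussian factors are bounded below on the ball.\<close>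

lemma wt_lower_bound:
  obtains w where "0 < w" "AE p in lebesgue. norm p \<le> R \<longrightarrow> w \<le> wt p"
proof -
  have "compact (cball 0 R :: ((real^'d) \<times> (real^'d)) set)" by simp
  then obtain C where C: "AE p in lebesgue. p \<in> cball 0 R \<longrightarrow> \<bar>1 / \<omega> p\<bar> \<le> C"
    using weight unfolding weight_def Linf_loc_def by blast
  define C' where "C' = max C 1"
  define w where "w = (2 * pi) powr (- (real CARD('d) / 2)) * (exp (- R\<^sup>2 / 4) * exp (- R\<^sup>2 / 4) * (1 / C'))"
  show ?thesis
  proof (rule that)
    show "0 < w" by (simp add: w_def C'_def)
    show "AE p in lebesgue. norm p \<le> R \<longrightarrow> w \<le> wt p"
      using C
    proof eventually_elim
      case (elim p)
      show ?case
      proof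
        assume R: "norm p \<le> R"
        note pos = omega_pos[of p]
        have "1 / \<omega> p \<le> C'" using elim R pos by (simp add: C'_def)
        then have om: "1 / C' \<le> \<omega> p" using pos by (simp add: C'_def field_simps)
        have "exp (- R\<^sup>2 / 4) \<le> exp (- (norm (fst p))\<^sup>2 / 4)" "exp (- R\<^sup>2 / 4) \<le> exp (- (norm (snd p))\<^sup>2 / 4)"
          using R norm_fst_le[of "fst p" "snd p"] norm_snd_le[of "snd p" "fst p"] by (auto intro!: power_mono)
        then show "w \<le> wt p"
          unfolding w_def wt_def using om by (intro mult_left_mono mult_mono) (auto simp: C'_def)
      qed
    qed
  qed
qed

definition wnorm :: "(complex^'d \<Rightarrow> complex) \<Rightarrow> ennreal" where
  "wnorm F = mix (\<lambda>p. ennreal (wt p * cmod (F (phase_map p))))"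

lemma B_norm_eq: "B_norm \<Phi>1 \<Phi>2 \<omega> F = wnorm F"
  unfolding B_norm_def wnorm_def mix_def
proof (rule arg_cong[where f = "orlicz_norm \<Phi>2"], rule ext)
  fix \<xi> :: "real^'d"
  have "ennreal (wt (x, \<xi>) * cmod (F (phase_map (x, \<xi>)))) =
      ennreal ((2 * pi) powr (- (real CARD('d) / 2)) * exp (- (norm \<xi>)\<^sup>2 / 4)) *
      ennreal (cmod (of_real (exp (- (norm x)\<^sup>2 / 4)) * F (phase_point x \<xi>) * of_real (\<omega> (x, \<xi>))))" for x
  proof -
    have "0 < \<omega> (x, \<xi>)" by (rule omega_pos)
    then show ?thesis
      by (subst ennreal_mult[symmetric]) (auto simp: wt_def phase_map_def norm_mult mult_ac)
  qed
  then show "ennreal ((2 * pi) powr (- (real CARD('d) / 2)) * exp (- (norm \<xi>)\<^sup>2 / 4)) *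
      o1.lnorm (\<lambda>x. ennreal (cmod (of_real (exp (- (norm x)\<^sup>2 / 4)) * F (phase_point x \<xi>) * of_real (\<omega> (x, \<xi>))))) =
    o1.lnorm (\<lambda>x. ennreal (wt (x, \<xi>) * cmod (F (phase_map (x, \<xi>)))))"
    by (simp only:) (rule o1.lnorm_mult[symmetric], simp)
qed

lemma M_norm_eq: "M_norm \<Phi>1 \<Phi>2 \<omega> c = wnorm (bargmann c)"
proof -
  have "cmod (stft c p * of_real (\<omega> p)) = wt p * cmod (bargmann c (phase_map p))" for p
  proof (cases p)
    case (Pair x \<xi>)
    have "0 < \<omega> (x, \<xi>)" by (rule omega_pos)
    then show ?thesis
      by (simp add: Pair stft_eq_bargmann norm_mult norm_phase_factor wt_def phase_map_def mult_ac)
  qed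
  then show ?thesis by (simp add: M_norm_def mixed_norm_def wnorm_def mix_def)
qed

lemma measurable_phase_map_compose:
  "F \<in> borel_measurable lebesgue \<Longrightarrow> (\<lambda>p. F (phase_map p)) \<in> borel_measurable lebesgue"
  by (rule measurable_compose[OF measurable_phase_map])

lemma wnorm_measurable:
  assumes "F \<in> borel_measurable lebesgue"
  shows "(\<lambda>p. ennreal (wt p * cmod (F (phase_map p)))) \<in> borel_measurable lebesgue"
  using measurable_phase_map_compose[OF assms] by measurable

lemma wnorm_qtri:
  assumes "F \<in> borel_measurable lebesgue" "G \<in> borel_measurable lebesgue"
  shows "qtri r (wnorm F) (wnorm G) (wnorm (F + G))"
  unfolding wnorm_def
proof (intro mix_qtri wnorm_measurable assms AE_I2)
  fix p
  let ?a = "wt p * cmod (F (phase_map p))" and ?b = "wt p * cmod (G (phase_map p))"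
  have "wt p * cmod ((F + G) (phase_map p)) \<le> ?a + ?b"
    using wt_pos[of p] norm_triangle_ineq[of "F (phase_map p)" "G (phase_map p)"]
    by (simp flip: distrib_left)
  then have "ennreal (wt p * cmod ((F + G) (phase_map p))) \<le> ennreal ?a + ennreal ?b"
    using less_imp_le[OF wt_pos[of p]] ennreal_plus[of ?a ?b] ennreal_leI[of _ "?a + ?b"] by simp
  then show "qtri r (ennreal ?a) (ennreal ?b) (ennreal (wt p * cmod ((F + G) (phase_map p))))"
    by (rule qtri_le[OF qtri_add[OF o1.r_pos o1.r_le_1]])
qed

lemma wnorm_scale: "wnorm (fun_scale a F) = ennreal (cmod a) * wnorm F"
proof -
  have "ennreal (wt p * cmod (fun_scale a F (phase_map p))) =
      ennreal (cmod a) * ennreal (wt p * cmod (F (phase_map p)))" for p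
    using wt_pos[of p] by (subst ennreal_mult[symmetric]) (auto simp: fun_scale_def norm_mult mult_ac)
  then show ?thesis by (simp add: wnorm_def mix_mult)
qed

lemma wnorm_eq_0_iff:
  assumes "F \<in> borel_measurable lebesgue"
  shows "wnorm F = 0 \<longleftrightarrow> (AE z in lebesgue. F z = 0)"
proof
  assume "wnorm F = 0"
  then have "AE p in lebesgue. ennreal (wt p * cmod (F (phase_map p))) = 0"
    unfolding wnorm_def by (intro AE_0_if_mix_0 wnorm_measurable assms)
  then have "AE p in lebesgue. F (phase_map p) = 0"
  proof eventually_elim
    case (elim p)
    then show ?case using wt_pos[of p] by (simp add: ennreal_eq_0_iff mult_le_0_iff)
  qed
  then show "AE z in lebesgue. F z = 0" by (simp add: AE_phase_map[of "\<lambda>z. F z = 0"])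
next
  assume "AE z in lebesgue. F z = 0"
  then have "AE p in lebesgue. F (phase_map p) = 0" by (simp add: AE_phase_map[of "\<lambda>z. F z = 0"])
  then have "wnorm F = mix (\<lambda>p :: (real^'d) \<times> (real^'d). 0)"
    unfolding wnorm_def by (intro mix_cong_AE) (auto elim: eventually_mono)
  then show "wnorm F = 0" by simp
qed

section \<open>The space of measurable functions\<close>

abbreviation "B \<equiv> B_space \<Phi>1 \<Phi>2 \<omega>"
abbreviation "nrm F \<equiv> enn2real (B_norm \<Phi>1 \<Phi>2 \<omega> F)"

lemma B_iff: "F \<in> B \<longleftrightarrow> F \<in> borel_measurable lebesgue \<and> wnorm F < \<infinity>"
  by (simp add: B_space_def B_norm_eq)

lemma nrm_eq: "F \<in> B \<Longrightarrow> wnorm F = ennreal (nrm F)"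
  by (simp add: B_iff B_norm_eq)

lemma B_add:
  assumes "F \<in> B" "G \<in> B"
  shows "F + G \<in> B" "nrm (F + G) \<le> qadd r (nrm F) (nrm G)"
proof -
  have "F \<in> borel_measurable lebesgue" "G \<in> borel_measurable lebesgue" using assms by (auto simp: B_iff)
  then have [measurable]: "F + G \<in> borel_measurable lebesgue" by (simp add: plus_fun_def)
  have le: "wnorm (F + G) \<le> ennreal (qadd r (nrm F) (nrm G))"
    using wnorm_qtri[of F G] assms by (simp add: qtri_def B_iff B_norm_eq)
  then have "wnorm (F + G) < \<infinity>" by (rule le_less_trans) simp
  then show "F + G \<in> B" by (simp add: B_iff)
  show "nrm (F + G) \<le> qadd r (nrm F) (nrm G)"
    unfolding B_norm_eq[of "F + G"] by (rule enn2real_leI[OF _ le]) simp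
qed

lemma B_scale:
  assumes "F \<in> B"
  shows "fun_scale a F \<in> B" "nrm (fun_scale a F) = cmod a * nrm F"
proof -
  have [measurable]: "F \<in> borel_measurable lebesgue" using assms by (auto simp: B_iff)
  have "fun_scale a F \<in> borel_measurable lebesgue" unfolding fun_scale_def by measurable
  then show "fun_scale a F \<in> B" using assms by (auto simp: B_iff wnorm_scale ennreal_mult_less_top)
  show "nrm (fun_scale a F) = cmod a * nrm F"
    by (simp add: B_norm_eq wnorm_scale enn2real_mult)
qed

lemma B_minus: "F \<in> B \<Longrightarrow> - F \<in> B"
  using B_scale(1)[of F "-1"] by (simp add: fun_scale_def fun_Compl_def)

lemma B_diff: "F \<in> B \<Longrightarrow> G \<in> B \<Longrightarrow> F - G \<in> B"
  using B_add(1)[of F "- G"] B_minus[of G] by simp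

lemma B_0: "0 \<in> B"
  by (simp add: B_iff zero_fun_def) (simp add: wnorm_def)

lemma nrm_diff_eq_0_iff:
  assumes "F \<in> B" "G \<in> B"
  shows "nrm (F - G) = 0 \<longleftrightarrow> ae_eq F G"
proof -
  have "F - G \<in> B" using assms by (rule B_diff)
  then have "nrm (F - G) = 0 \<longleftrightarrow> wnorm (F - G) = 0" using nrm_eq[of "F - G"] by (auto simp: B_norm_eq)
  also have "\<dots> \<longleftrightarrow> (AE z in lebesgue. (F - G) z = 0)"
    using \<open>F - G \<in> B\<close> by (intro wnorm_eq_0_iff) (simp add: B_iff)
  finally show ?thesis by (simp add: ae_eq_def)
qed

text \<open>Fatou's lemma in \<open>j\<close> transfers the Cauchy bound from
  \<open>s n - s (\<phi> j)\<close> to \<open>s n - f\<close>. The index map covers both uses: a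
  subsequence for the \<open>B\<close> space and the whole sequence for the \<open>A\<close>
  space.\<close>

lemma limit_in_B:
  assumes s: "\<And>n. s n \<in> B"
    and cauchy: "\<And>e. 0 < e \<Longrightarrow> \<exists>k::nat. \<forall>m\<ge>k. \<forall>n\<ge>k. nrm (s m - s n) < e"
    and \<phi>: "filterlim \<phi> at_top sequentially"
    and f: "f \<in> borel_measurable lebesgue"
    and lim: "AE p in lebesgue. (\<lambda>k. s (\<phi> k) (phase_map p)) \<longlonglongrightarrow> f (phase_map p)"
  shows "f \<in> B" "(\<lambda>n. nrm (s n - f)) \<longlonglongrightarrow> 0"
proof -
  have meas: "s n \<in> borel_measurable lebesgue" for n using s by (simp add: B_iff)
  have le: "\<exists>k. \<forall>n\<ge>k. wnorm (s n - f) \<le> ennreal e" if e: "0 < e" for e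
  proof -
    from cauchy[OF e] obtain k where k: "\<And>m n. m \<ge> k \<Longrightarrow> n \<ge> k \<Longrightarrow> nrm (s m - s n) < e" by blast
    have "wnorm (s n - f) \<le> ennreal e" if n: "n \<ge> k" for n
    proof -
      have "wnorm (s n - f) \<le> liminf (\<lambda>j. wnorm (s n - s (\<phi> j)))"
        unfolding wnorm_def
      proof (rule mix_liminf)
        have "s n - s (\<phi> j) \<in> borel_measurable lebesgue" for j
          using meas by (simp add: fun_diff_def)
        then show "(\<lambda>p. ennreal (wt p * cmod ((s n - s (\<phi> j)) (phase_map p)))) \<in> borel_measurable lebesgue" for j
          by (rule wnorm_measurable)
        show "AE p in lebesgue. ennreal (wt p * cmod ((s n - f) (phase_map p))) \<le>
            liminf (\<lambda>j. ennreal (wt p * cmod ((s n - s (\<phi> j)) (phase_map p))))"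
          using lim
        proof eventually_elim
          case (elim p)
          have "(\<lambda>j. ennreal (wt p * cmod ((s n - s (\<phi> j)) (phase_map p)))) \<longlonglongrightarrow>
              ennreal (wt p * cmod ((s n - f) (phase_map p)))"
            unfolding fun_diff_def by (intro tendsto_ennrealI tendsto_intros elim)
          then show ?case by (simp add: lim_imp_Liminf)
        qed
      qed
      also have "\<dots> \<le> ennreal e"
      proof (rule Liminf_le)
        show "\<forall>\<^sub>F j in sequentially. wnorm (s n - s (\<phi> j)) \<le> ennreal e"
          using filterlim_at_top[THEN iffD1, OF \<phi>, rule_format, of k]
        proof eventually_elim
          case (elim j)
          then have "nrm (s n - s (\<phi> j)) \<le> e" using k[OF n elim] by simp
          then show ?case
            using nrm_eq[OF B_diff[OF s s]] by (simp add: ennreal_leI)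
        qed
      qed simp
      finally show ?thesis .
    qed
    then show ?thesis by blast
  qed
  from le[of 1] obtain k where "wnorm (s k - f) \<le> ennreal 1" by auto
  then have "wnorm (s k - f) < \<infinity>" by (rule le_less_trans) simp
  moreover have "s k - f \<in> borel_measurable lebesgue" using meas f by (simp add: fun_diff_def)
  ultimately have "s k - f \<in> B" by (simp add: B_iff)
  from B_diff[OF s this, of k] show fB: "f \<in> B" by simp
  show "(\<lambda>n. nrm (s n - f)) \<longlonglongrightarrow> 0"
  proof (rule LIMSEQ_I)
    fix e :: real assume "0 < e"
    then have "0 < e / 2" by simp
    from le[OF this] obtain k where k: "\<And>n. n \<ge> k \<Longrightarrow> wnorm (s n - f) \<le> ennreal (e / 2)" by blast
    have "norm (nrm (s n - f) - 0) < e" if "n \<ge> k" for n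
      using enn2real_leI[OF _ k[OF that]] \<open>0 < e\<close> by (simp add: B_norm_eq)
    then show "\<exists>k. \<forall>n\<ge>k. norm (nrm (s n - f) - 0) < e" by blast
  qed
qed

lemma B_complete:
  assumes s: "\<And>n. s n \<in> B"
    and cauchy: "\<And>e. 0 < e \<Longrightarrow> \<exists>k::nat. \<forall>m\<ge>k. \<forall>n\<ge>k. nrm (s m - s n) < e"
  shows "\<exists>f\<in>B. (\<lambda>n. nrm (s n - f)) \<longlonglongrightarrow> 0"
proof -
  have "\<exists>k. \<forall>m\<ge>k. \<forall>n\<ge>k. nrm (s m - s n) < (1/4) ^ i" for i :: nat
    by (rule cauchy) simp
  then obtain K where K: "\<And>i m n. m \<ge> K i \<Longrightarrow> n \<ge> K i \<Longrightarrow> nrm (s m - s n) < (1/4) ^ i"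
    using choice[of "\<lambda>i k. \<forall>m\<ge>k. \<forall>n\<ge>k. nrm (s m - s n) < (1/4) ^ i"] by blast
  \<comment> \<open>The sum makes the index increasing and at least \<open>K j\<close>; the summand
    \<open>j\<close> makes it unbounded.\<close>
  define \<phi> where "\<phi> j = j + (\<Sum>i\<le>j. K i)" for j :: nat
  have \<phi>_ge: "K j \<le> \<phi> j" "j \<le> \<phi> j" "\<phi> j \<le> \<phi> (Suc j)" for j
    using member_le_sum[of j "{..j}" K] by (auto simp: \<phi>_def)
  have lim: "filterlim \<phi> at_top sequentially"
    by (rule filterlim_at_top_mono[OF filterlim_ident]) (simp add: \<phi>_ge(2))
  have meas: "s n \<in> borel_measurable lebesgue" for n using s by (simp add: B_iff)
  \<comment> \<open>The weight is attached because \<open>wnorm\<close> measures weighted moduli;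
    its positivity lets it be divided out of the limit afterwards.\<close>
  have "AE p in lebesgue. convergent (\<lambda>j. of_real (wt p) * s (\<phi> j) (phase_map p))"
  proof (rule AE_convergent_if_mix_geometric)
    have [measurable]: "(\<lambda>p. s (\<phi> j) (phase_map p)) \<in> borel_measurable lebesgue" for j
      by (rule measurable_phase_map_compose[OF meas])
    show "(\<lambda>p. of_real (wt p) * s (\<phi> j) (phase_map p)) \<in> borel_measurable lebesgue" for j
      by measurable
    fix j
    have "(\<lambda>p. ennreal (cmod (of_real (wt p) * s (\<phi> (Suc j)) (phase_map p) - of_real (wt p) * s (\<phi> j) (phase_map p)))) =
        (\<lambda>p. ennreal (wt p * cmod ((s (\<phi> (Suc j)) - s (\<phi> j)) (phase_map p))))"
      using wt_pos by (simp add: fun_eq_iff norm_mult less_imp_le flip: right_diff_distrib)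
    then have "mix (\<lambda>p. ennreal (cmod (of_real (wt p) * s (\<phi> (Suc j)) (phase_map p) - of_real (wt p) * s (\<phi> j) (phase_map p)))) =
        wnorm (s (\<phi> (Suc j)) - s (\<phi> j))"
      by (simp add: wnorm_def)
    also have "\<dots> = ennreal (nrm (s (\<phi> (Suc j)) - s (\<phi> j)))"
      by (rule nrm_eq[OF B_diff[OF s s]])
    also have "\<dots> \<le> ennreal ((1/4) ^ j)"
      using K[of j "\<phi> (Suc j)" "\<phi> j"] \<phi>_ge[of j] by (intro ennreal_leI) simp
    finally show "mix (\<lambda>p. ennreal (cmod (of_real (wt p) * s (\<phi> (Suc j)) (phase_map p) - of_real (wt p) * s (\<phi> j) (phase_map p))))
        \<le> ennreal ((1/4) ^ j)" .
  qed
  define f where "f z = lim (\<lambda>j. s (\<phi> j) z)" for z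
  have f: "f \<in> borel_measurable lebesgue"
    unfolding f_def[abs_def] by (rule borel_measurable_lim_metric) (rule meas)
  from \<open>AE p in lebesgue. convergent _\<close>
  have "AE p in lebesgue. (\<lambda>j. s (\<phi> j) (phase_map p)) \<longlonglongrightarrow> f (phase_map p)"
  proof eventually_elim
    case (elim p)
    then have "convergent (\<lambda>j. s (\<phi> j) (phase_map p))"
      using wt_pos[of p] by (simp add: convergent_mult_const_iff)
    then show ?case by (simp add: f_def convergent_LIMSEQ_iff)
  qed
  from limit_in_B[OF s cauchy lim f this] show ?thesis by blast
qed

lemma B_quasi_banach: "quasi_banach_space fun_scale ae_eq r B nrm"
  by (intro quasi_banach_spaceI vector_space_fun_scale subspace_fun_scaleI)
     (simp_all add: o1.r_pos o1.r_le_1 B_0 B_add B_scale B_complete nrm_diff_eq_0_iff)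

text \<open>Around the almost-maximal point of \<open>entire_max_bound\<close>, \<open>F\<close>
  stays large on a product of two balls of radius proportional to \<delta>. The mixed quasi-norm of
  its indicator splits into two Orlicz quasi-norms, and their powers of \<delta> are exactly those
  in the weighted maximum, so a constant independent of \<open>F\<close> results.\<close>

lemma entire_local_bound:
  assumes "0 < R"
  obtains C where "\<And>F z. entire F \<Longrightarrow> F \<in> B \<Longrightarrow> norm z \<le> R \<Longrightarrow> cmod (F z) \<le> C * nrm F"
proof -
  obtain t :: nat where t: "real DIM(real^'d) / r \<le> real t" using real_arch_simple by blast
  have t0: "0 < t"
  proof (rule ccontr)
    assume "\<not> 0 < t"
    then have "real DIM(real^'d) / r \<le> 0" using t by simp
    moreover have "0 < real DIM(real^'d) / r" using o1.r_pos by simp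
    ultimately show False by linarith
  qed
  have "\<exists>c>0. \<forall>(x :: real^'d) \<eta>. 0 < \<eta> \<longrightarrow> \<eta> \<le> 1 \<longrightarrow> ennreal (c * \<eta> ^ t) \<le> o1.lnorm (indicator (cball x \<eta>))"
  proof (rule o1.lnorm_cball_lower_bound[where 'a = "real^'d"])
    fix c assume c: "0 < c" "\<And>(x :: real^'d) \<eta> t. 0 < \<eta> \<Longrightarrow> \<eta> \<le> 1 \<Longrightarrow>
      real DIM(real^'d) / r \<le> real t \<Longrightarrow> ennreal (c * \<eta> ^ t) \<le> o1.lnorm (indicator (cball x \<eta>))"
    show ?thesis by (intro exI[of _ c] conjI allI impI c t)
  qed
  then obtain c1 where c1: "0 < c1" "\<And>(x :: real^'d) \<eta>. 0 < \<eta> \<Longrightarrow> \<eta> \<le> 1 \<Longrightarrow>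
      ennreal (c1 * \<eta> ^ t) \<le> o1.lnorm (indicator (cball x \<eta>))"
    by blast
  have "\<exists>c>0. \<forall>(x :: real^'d) \<eta>. 0 < \<eta> \<longrightarrow> \<eta> \<le> 1 \<longrightarrow> ennreal (c * \<eta> ^ t) \<le> o2.lnorm (indicator (cball x \<eta>))"
  proof (rule o2.lnorm_cball_lower_bound[where 'a = "real^'d"])
    fix c assume c: "0 < c" "\<And>(x :: real^'d) \<eta> t. 0 < \<eta> \<Longrightarrow> \<eta> \<le> 1 \<Longrightarrow>
      real DIM(real^'d) / r \<le> real t \<Longrightarrow> ennreal (c * \<eta> ^ t) \<le> o2.lnorm (indicator (cball x \<eta>))"
    show ?thesis by (intro exI[of _ c] conjI allI impI c t)
  qed
  then obtain c2 where c2: "0 < c2" "\<And>(x :: real^'d) \<eta>. 0 < \<eta> \<Longrightarrow> \<eta> \<le> 1 \<Longrightarrow>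
      ennreal (c2 * \<eta> ^ t) \<le> o2.lnorm (indicator (cball x \<eta>))"
    by blast
  \<comment> \<open>With this radius the weight \<open>(\<rho> - norm z) ^ s\<close> is at least 1
    on the ball of radius \<open>R\<close>.\<close>
  define \<rho> where "\<rho> = R + 1"
  have \<rho>: "1 < \<rho>" using assms by (simp add: \<rho>_def)
  \<comment> \<open>\<open>phase_map\<close> divides norms by \<open>sqrt 2\<close>, so the ball of
    radius \<rho> corresponds to radius \<open>sqrt 2 * \<rho>\<close> in phase space.\<close>
  obtain w where w: "0 < w" "AE p in lebesgue. norm p \<le> sqrt 2 * \<rho> \<longrightarrow> w \<le> wt p"
    using wt_lower_bound by blast
  \<comment> \<open>Each of the two balls contributes the power \<open>t\<close> of its
    radius.\<close>
  define s where "s = 2 * t"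
  have \<rho>0: "0 < \<rho>" and s0: "0 < s" using \<rho> t0 by (auto simp: s_def)
  \<comment> \<open>Since \<open>\<delta> \<le> \<rho>\<close> and \<open>\<rho> > 1\<close>, the
    radius \<open>\<kappa> * \<delta>\<close> is at most 1 and at most
    \<open>\<delta> / 2 ^ (s + 2)\<close>, while \<kappa> does not depend on
    \<open>F\<close>.\<close>
  define \<kappa> where "\<kappa> = 1 / (2 ^ (s + 2) * \<rho>)"
  have \<kappa>: "0 < \<kappa>" using \<rho> by (simp add: \<kappa>_def)
  define D where "D = w / 2 * c1 * c2 * (\<kappa> / 2) ^ s"
  have D: "0 < D" using w c1 c2 \<kappa> by (simp add: D_def)
  show ?thesis
  proof (rule that)
    fix F and z :: "complex^'d" assume F: "entire F" "F \<in> B" and z: "norm z \<le> R"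
    obtain z\<^sub>0 \<delta> where \<delta>: "0 < \<delta>" "norm z\<^sub>0 + 2 * \<delta> = \<rho>"
      and max: "\<And>z. norm z \<le> \<rho> \<Longrightarrow> cmod (F z) * (\<rho> - norm z) ^ s \<le> cmod (F z\<^sub>0) * (2 * \<delta>) ^ s"
      and near: "\<And>z. norm (z - z\<^sub>0) \<le> \<delta> / 2 ^ (s + 2) \<Longrightarrow> cmod (F z\<^sub>0) / 2 \<le> cmod (F z)"
      using entire_max_bound[OF F(1) \<rho>0 s0] by blast
    define \<eta> where "\<eta> = \<kappa> * \<delta>"
    have "\<delta> \<le> \<rho>" using \<delta> norm_ge_zero[of z\<^sub>0] by linarith
    have "(1::real) \<le> 2 ^ (s + 2)" by (rule one_le_power) simp
    have \<eta>: "0 < \<eta>" "\<eta> \<le> 1" "\<eta> \<le> \<delta> / 2 ^ (s + 2)"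
    proof -
      show "0 < \<eta>" using \<kappa> \<delta> by (simp add: \<eta>_def)
      have "\<eta> = (\<delta> / \<rho>) * (1 / 2 ^ (s + 2))" by (simp add: \<eta>_def \<kappa>_def)
      also have "\<dots> \<le> 1 * 1" using \<delta> \<rho> \<open>\<delta> \<le> \<rho>\<close> \<open>1 \<le> 2 ^ (s + 2)\<close> by (intro mult_mono) auto
      finally show "\<eta> \<le> 1" by simp
      have "\<eta> = (1 / \<rho>) * (\<delta> / 2 ^ (s + 2))" by (simp add: \<eta>_def \<kappa>_def)
      also have "\<dots> \<le> 1 * (\<delta> / 2 ^ (s + 2))" using \<delta> \<rho> by (intro mult_right_mono) auto
      finally show "\<eta> \<le> \<delta> / 2 ^ (s + 2)" by simp
    qed
    define p\<^sub>0 where "p\<^sub>0 = phase_inv z\<^sub>0"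
    \<comment> \<open>A product of balls lets the quasi-norm of its indicator factor. It lies within
      \<open>sqrt 2 * \<eta>\<close> of \<open>p\<^sub>0\<close>, which \<open>phase_map\<close>
      shrinks to \<eta> around \<open>z\<^sub>0\<close>.\<close>
    let ?Q1 = "cball (fst p\<^sub>0) \<eta>" and ?Q2 = "cball (snd p\<^sub>0) \<eta>"
    define m where "m = w * (cmod (F z\<^sub>0) / 2)"
    have m: "0 \<le> m" using w by (simp add: m_def)
    have le: "AE p in lebesgue. ennreal m * (indicator ?Q2 (snd p) * indicator ?Q1 (fst p)) \<le>
        ennreal (wt p * cmod (F (phase_map p)))"
      using w(2)
    proof eventually_elim
      case (elim p)
      show ?case
      proof (cases "fst p \<in> ?Q1 \<and> snd p \<in> ?Q2")
        case True
        have "norm (p - p\<^sub>0) \<le> sqrt (\<eta>\<^sup>2 + \<eta>\<^sup>2)"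
          using True \<eta>(1) unfolding norm_prod_def
          by (intro real_sqrt_le_mono add_mono power_mono) (auto simp: dist_norm norm_minus_commute)
        also have "\<dots> = sqrt 2 * \<eta>" using \<eta>(1) by (simp add: real_sqrt_mult flip: mult_2)
        finally have "norm (p - p\<^sub>0) / sqrt 2 \<le> \<eta>" by (simp add: field_simps)
        moreover have "phase_map p - z\<^sub>0 = phase_map (p - p\<^sub>0)"
          by (simp add: linear_diff[OF linear_phase_map] p\<^sub>0_def)
        ultimately have n: "norm (phase_map p - z\<^sub>0) \<le> \<eta>" by (simp add: norm_phase_map)
        then have Fp: "cmod (F z\<^sub>0) / 2 \<le> cmod (F (phase_map p))" using \<eta>(3) by (intro near) simp
        have "\<delta> / 2 ^ (s + 2) \<le> \<delta>"
          using \<delta> \<open>1 \<le> 2 ^ (s + 2)\<close> by (simp add: divide_le_eq_1 divide_le_eq)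
        then have "norm (phase_map p) \<le> \<rho>"
          using n \<eta>(3) \<delta> norm_triangle_sub[of "phase_map p" z\<^sub>0] by linarith
        then have "norm p \<le> sqrt 2 * \<rho>" by (simp add: norm_phase_map field_simps)
        then have "w \<le> wt p" using elim by simp
        then have "m \<le> wt p * cmod (F (phase_map p))"
          unfolding m_def using Fp wt_pos[of p] by (intro mult_mono) auto
        then show ?thesis using True by (simp add: ennreal_leI)
      next
        case False
        then show ?thesis by auto
      qed
    qed
    have "ennreal (m * (c1 * \<eta> ^ t) * (c2 * \<eta> ^ t)) =
        ennreal m * (ennreal (c1 * \<eta> ^ t) * ennreal (c2 * \<eta> ^ t))"
      using m c1 c2 \<eta> by (simp add: mult.assoc flip: ennreal_mult)
    also have "\<dots> \<le> ennreal m * (o1.lnorm (indicator ?Q1) * o2.lnorm (indicator ?Q2))"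
      using \<eta> c1 c2 by (intro mult_left_mono mult_mono) auto
    also have "o1.lnorm (indicator ?Q1) * o2.lnorm (indicator ?Q2) =
        mix (\<lambda>p. indicator ?Q2 (snd p) * indicator ?Q1 (fst p))"
    proof (cases "o1.lnorm (indicator ?Q1 :: real^'d \<Rightarrow> ennreal)")
      case (real l)
      have "o1.lnorm (\<lambda>x. indicator ?Q2 \<xi> * indicator ?Q1 x) = ennreal l * indicator ?Q2 \<xi>" for \<xi>
        using real by (cases "\<xi> \<in> ?Q2") auto
      then show ?thesis
        using real by (simp add: mix_def o2.lnorm_mult)
    next
      \<comment> \<open>This happens when \<open>\<Phi>1\<close> is infinite on the positive
        half-line. Both sides are then \<open>top\<close>, provided that the second factor is
        nonzero, since \<open>top * 0 = 0\<close>.\<close>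
      case top
      have "o2.lnorm (indicator ?Q2 :: real^'d \<Rightarrow> ennreal) \<noteq> 0"
      proof
        assume "o2.lnorm (indicator ?Q2 :: real^'d \<Rightarrow> ennreal) = 0"
        then have "ennreal (c2 * \<eta> ^ t) = 0" using c2(2)[of \<eta> "snd p\<^sub>0"] \<eta> by simp
        then show False
          using c2(1) zero_less_power[OF \<eta>(1), of t] by (simp add: ennreal_eq_0_iff mult_le_0_iff)
      qed
      moreover have "o2.lnorm (\<lambda>\<xi>. o1.lnorm (\<lambda>x. indicator ?Q2 \<xi> * indicator ?Q1 x)) = top"
      proof (rule ccontr)
        assume "\<not> ?thesis"
        then have fin: "o2.lnorm (\<lambda>\<xi>. o1.lnorm (\<lambda>x. indicator ?Q2 \<xi> * indicator ?Q1 x)) < \<infinity>"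
          by (simp add: less_top)
        have eq: "o1.lnorm (\<lambda>x. indicator ?Q2 \<xi> * indicator ?Q1 x) = top * indicator ?Q2 \<xi>" for \<xi>
          using top by (cases "\<xi> \<in> ?Q2") auto
        have "AE \<xi> in lebesgue. top * indicator ?Q2 \<xi> < (\<infinity> :: ennreal)"
        proof (rule o2.AE_finite_if_lnorm_finite)
          have "?Q2 \<in> sets lborel" by simp
          then have "(\<lambda>\<xi> :: real^'d. top * indicator ?Q2 \<xi> :: ennreal) \<in> borel_measurable lborel"
            by (intro borel_measurable_times_ennreal borel_measurable_const borel_measurable_indicator)
          then show "(\<lambda>\<xi> :: real^'d. top * indicator ?Q2 \<xi> :: ennreal) \<in> borel_measurable lebesgue"
            by (rule measurable_completion)
          show "o2.lnorm (\<lambda>\<xi> :: real^'d. top * indicator ?Q2 \<xi>) < \<infinity>"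
            using fin unfolding eq .
        qed
        then have "AE \<xi> in lebesgue. indicator ?Q2 \<xi> = (0 :: ennreal)"
        proof eventually_elim
          case (elim \<xi>)
          then show ?case by (cases "\<xi> \<in> ?Q2") auto
        qed
        then have "o2.lnorm (indicator ?Q2 :: real^'d \<Rightarrow> ennreal) = o2.lnorm (\<lambda>\<xi> :: real^'d. 0)"
          by (rule o2.lnorm_cong_AE)
        with \<open>o2.lnorm (indicator ?Q2 :: real^'d \<Rightarrow> ennreal) \<noteq> 0\<close> show False by simp
      qed
      ultimately show ?thesis by (simp add: mix_def top ennreal_top_mult)
    qed
    also have "ennreal m * mix (\<lambda>p. indicator ?Q2 (snd p) * indicator ?Q1 (fst p)) =
        mix (\<lambda>p. ennreal m * (indicator ?Q2 (snd p) * indicator ?Q1 (fst p)))"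
      using m by (rule mix_mult[symmetric])
    also have "\<dots> \<le> wnorm F" unfolding wnorm_def by (rule mix_mono_AE[OF le])
    finally have "ennreal (m * (c1 * \<eta> ^ t) * (c2 * \<eta> ^ t)) \<le> ennreal (nrm F)"
      using nrm_eq[OF F(2)] by simp
    then have "m * (c1 * \<eta> ^ t) * (c2 * \<eta> ^ t) \<le> nrm F" by (simp add: ennreal_le_iff)
    moreover have "m * (c1 * \<eta> ^ t) * (c2 * \<eta> ^ t) = D * (cmod (F z\<^sub>0) * (2 * \<delta>) ^ s)"
    proof -
      have "\<eta> ^ t * \<eta> ^ t = \<eta> ^ s" by (simp add: s_def mult_2 power_add)
      also have "\<dots> = ((\<kappa> / 2) * (2 * \<delta>)) ^ s" by (simp add: \<eta>_def)
      finally have eq: "\<eta> ^ t * \<eta> ^ t = (\<kappa> / 2) ^ s * (2 * \<delta>) ^ s" by (simp only: power_mult_distrib)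
      have "m = w / 2 * cmod (F z\<^sub>0)" by (simp add: m_def)
      then have "m * (c1 * \<eta> ^ t) * (c2 * \<eta> ^ t) = w / 2 * cmod (F z\<^sub>0) * c1 * c2 * (\<eta> ^ t * \<eta> ^ t)"
        by (simp only: mult_ac)
      then show ?thesis unfolding eq D_def by (simp only: mult_ac)
    qed
    ultimately have "D * (cmod (F z\<^sub>0) * (2 * \<delta>) ^ s) \<le> nrm F" by simp
    moreover
    have "cmod (F z) \<le> cmod (F z\<^sub>0) * (2 * \<delta>) ^ s"
    proof -
      have "cmod (F z) * 1 \<le> cmod (F z) * (\<rho> - norm z) ^ s"
        using z by (intro mult_left_mono one_le_power) (auto simp: \<rho>_def)
      also have "\<dots> \<le> cmod (F z\<^sub>0) * (2 * \<delta>) ^ s" using z by (intro max) (simp add: \<rho>_def)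
      finally show ?thesis by simp
    qed
    from mult_left_mono[OF this less_imp_le[OF D]]
    have "D * cmod (F z) \<le> D * (cmod (F z\<^sub>0) * (2 * \<delta>) ^ s)" .
    ultimately have "D * cmod (F z) \<le> nrm F" by linarith
    then show "cmod (F z) \<le> 1 / D * nrm F" using D by (simp add: field_simps)
  qed
qed

section \<open>The space of entire functions\<close>

abbreviation "A \<equiv> A_space \<Phi>1 \<Phi>2 \<omega>"

lemma A_iff: "F \<in> A \<longleftrightarrow> F \<in> B \<and> entire F"
  by (simp add: A_space_def)

lemma AB: "F \<in> A \<Longrightarrow> F \<in> B"
  by (simp add: A_iff)

text \<open>A limit supplied by \<open>B_complete\<close> is determined only up to null sets and
  need not be entire, so the limit is built here from the locally uniform convergence.\<close>

lemma A_complete: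
  assumes s: "\<And>n. s n \<in> A"
    and cauchy: "\<And>e. 0 < e \<Longrightarrow> \<exists>k::nat. \<forall>m\<ge>k. \<forall>n\<ge>k. nrm (s m - s n) < e"
  shows "\<exists>f\<in>A. (\<lambda>n. nrm (s n - f)) \<longlonglongrightarrow> 0"
proof -
  have sB: "s n \<in> B" and sE: "entire (s n)" for n using s by (auto simp: A_iff)
  have dE: "entire (s m - s n)" for m n
    using entire_diff[OF sE sE, of m n] by (simp add: fun_diff_def)
  define f where "f z = lim (\<lambda>n. s n z)" for z
  have unif: "uniform_limit (cball 0 R) s f sequentially" for R
  proof -
    have "0 < max R 1" by simp
    then obtain C where C: "\<And>F z. entire F \<Longrightarrow> F \<in> B \<Longrightarrow> norm z \<le> max R 1 \<Longrightarrow> cmod (F z) \<le> C * nrm F"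
      using entire_local_bound by blast
    have "uniformly_Cauchy_on (cball 0 R) s"
      unfolding uniformly_Cauchy_on_def
    proof (intro allI impI)
      fix e :: real assume e: "0 < e"
      define C' where "C' = max C 1"
      have "0 < e / C'" using e by (simp add: C'_def)
      from cauchy[OF this] obtain k where k: "\<And>m n. m \<ge> k \<Longrightarrow> n \<ge> k \<Longrightarrow> nrm (s m - s n) < e / C'" by blast
      have "dist (s m z) (s n z) < e" if "z \<in> cball 0 R" "m \<ge> k" "n \<ge> k" for m n z
      proof -
        have "cmod ((s m - s n) z) \<le> C * nrm (s m - s n)"
          using that by (intro C dE B_diff sB) simp
        also have "\<dots> \<le> C' * nrm (s m - s n)"
          by (intro mult_right_mono) (auto simp: C'_def)
        also have "\<dots> < e" using k[OF that(2,3)] by (simp add: C'_def field_simps)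
        finally show ?thesis by (simp add: dist_norm)
      qed
      then show "\<exists>M. \<forall>x\<in>cball 0 R. \<forall>m\<ge>M. \<forall>n\<ge>M. dist (s m x) (s n x) < e" by blast
    qed
    then have "uniformly_convergent_on (cball 0 R) s" by (rule Cauchy_uniformly_convergent)
    then show ?thesis
      unfolding uniformly_convergent_uniform_limit_iff f_def[abs_def] .
  qed
  have fE: "entire f" by (rule entire_uniform_limit[OF sE unif])
  have "(\<lambda>n. s n z) \<longlonglongrightarrow> f z" for z
    by (rule tendsto_uniform_limitI[OF unif[of "norm z"]]) simp
  then have "AE p in lebesgue. (\<lambda>n. s n (phase_map p)) \<longlonglongrightarrow> f (phase_map p)" by simp
  from limit_in_B[OF sB cauchy filterlim_ident entire_measurable[OF fE] this]
  show ?thesis using fE by (auto simp: A_iff)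
qed

lemma A_0: "0 \<in> A"
  using entire_const[of 0] B_0 unfolding A_iff zero_fun_def by simp

lemma A_add: "F \<in> A \<Longrightarrow> G \<in> A \<Longrightarrow> F + G \<in> A"
  using entire_add[of F G] B_add(1)[of F G] unfolding A_iff plus_fun_def by simp

lemma A_scale: "F \<in> A \<Longrightarrow> fun_scale a F \<in> A"
  using entire_mult[OF entire_const[of a], of F] B_scale(1)[of F a] by (simp add: A_iff fun_scale_def)

lemma A_quasi_banach: "quasi_banach_space fun_scale (=) r A nrm"
proof (intro quasi_banach_spaceI vector_space_fun_scale subspace_fun_scaleI)
  fix F G assume FG: "F \<in> A" "G \<in> A"
  then have "nrm (F - G) = 0 \<longleftrightarrow> ae_eq F G" by (simp add: A_iff nrm_diff_eq_0_iff)
  also have "\<dots> \<longleftrightarrow> F = G"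
    using FG AE_eq_imp_eq_entire[of F G] by (auto simp: ae_eq_def A_iff)
  finally show "nrm (F - G) = 0 \<longleftrightarrow> F = G" .
qed (simp_all add: o1.r_pos o1.r_le_1 A_0 A_add A_scale A_complete B_add(2)[OF AB AB] B_scale(2)[OF AB])

section \<open>The modulation space\<close>

abbreviation "M \<equiv> M_space \<Phi>1 \<Phi>2 \<omega>"

lemma continuous_on_phase_factor: "continuous_on UNIV (\<lambda>p. phase_factor (fst p) (snd p))"
  unfolding phase_factor_def by (intro continuous_intros) auto

lemma stft_measurable:
  assumes "entire (bargmann c)"
  shows "stft c \<in> borel_measurable (lebesgue :: ((real^'d) \<times> (real^'d)) measure)"
proof -
  have eq: "stft c = (\<lambda>p. of_real ((2 * pi) powr (- (real CARD('d) / 2))) * phase_factor (fst p) (snd p) *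
      bargmann c (phase_map p))"
    by (auto simp: fun_eq_iff stft_eq_bargmann phase_map_def)
  have "continuous_on UNIV (\<lambda>p. bargmann c (phase_map p))"
    by (rule continuous_on_compose2[OF entire_continuous_on[OF assms, of UNIV]])
       (auto intro: linear_continuous_on simp: linear_phase_map linear_conv_bounded_linear[symmetric])
  then have "continuous_on UNIV (stft c)"
    unfolding eq by (intro continuous_intros continuous_on_phase_factor)
  then show ?thesis
    by (intro measurable_completion) (simp add: borel_measurable_continuous_onI)
qed

lemma entire_bargmann: "c \<in> H_flat_dual \<Longrightarrow> entire (bargmann c)"
  by (simp add: bargmann_eq_flat_series entire_flat_series)

lemma M_iff: "c \<in> M \<longleftrightarrow> c \<in> H_flat_dual \<and> bargmann c \<in> A"
proof (cases "c \<in> H_flat_dual")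
  case True
  then have e: "entire (bargmann c)" by (rule entire_bargmann)
  have "mixed_norm \<Phi>1 \<Phi>2 \<omega> (stft c) = wnorm (bargmann c)"
    using M_norm_eq[of c] by (simp add: M_norm_def)
  then show ?thesis
    using True e by (simp add: M_space_def mixed_space_def stft_measurable A_iff B_iff entire_measurable)
qed (simp add: M_space_def)

lemma M_norm_eq_nrm: "M_norm \<Phi>1 \<Phi>2 \<omega> c = B_norm \<Phi>1 \<Phi>2 \<omega> (bargmann c)"
  by (simp add: M_norm_eq B_norm_eq)

lemma bij_betw_bargmann: "bij_betw bargmann M A"
proof (rule bij_betw_imageI)
  have bij: "bij_betw bargmann (H_flat_dual :: (nat^'d \<Rightarrow> complex) set) {F. entire F}"
    unfolding bargmann_eq_flat_series[abs_def] by (rule bij_betw_flat_series)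
  show "inj_on bargmann M"
    by (rule inj_on_subset[OF bij_betw_imp_inj_on[OF bij]]) (auto simp: M_iff)
  show "bargmann ` M = A"
  proof (intro equalityI subsetI)
    fix F assume F: "F \<in> A"
    then have "F \<in> bargmann ` H_flat_dual"
      using bij_betw_imp_surj_on[OF bij] by (simp add: A_iff)
    then show "F \<in> bargmann ` M" using F by (auto simp: M_iff)
  qed (auto simp: M_iff)
qed

lemma bargmann_diff:
  assumes "c \<in> H_flat_dual" "c' \<in> H_flat_dual"
  shows "bargmann (c - c') = bargmann c - bargmann c'"
proof -
  have "fun_scale (-1) c' = - c'" "fun_scale (-1) (bargmann c') = - bargmann c'"
    by (auto simp: fun_scale_def fun_Compl_def)
  then show ?thesis
    using flat_series_add[OF assms(1) H_flat_dual_scale[OF assms(2), of "-1"]] flat_series_scale[of "-1" c']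
    by (simp add: bargmann_eq_flat_series)
qed

text \<open>All properties are pulled back along the linear map \<open>bargmann\<close>. Injectivity
  gives definiteness of the quasi-norm; surjectivity onto \<open>A\<close> turns a limit there into
  the transform of an element of \<open>M\<close>.\<close>

lemma M_quasi_banach:
  "quasi_banach_space fun_scale (=) r M (\<lambda>c. enn2real (M_norm \<Phi>1 \<Phi>2 \<omega> c))"
proof (intro quasi_banach_spaceI vector_space_fun_scale subspace_fun_scaleI)
  have A: "module.subspace fun_scale A" "\<And>F G. F \<in> A \<Longrightarrow> G \<in> A \<Longrightarrow> nrm (F - G) = 0 \<longleftrightarrow> F = G"
    using A_quasi_banach unfolding quasi_banach_space_def by auto
  have add: "bargmann (c + c') = bargmann c + bargmann c'" if "c \<in> M" "c' \<in> M" for c c'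
    using that by (simp add: M_iff bargmann_eq_flat_series flat_series_add)
  have scale: "bargmann (fun_scale a c) = fun_scale a (bargmann c)" for a c
    by (simp add: bargmann_eq_flat_series flat_series_scale)
  show "0 \<in> M"
  proof -
    have "0 \<in> (H_flat_dual :: (nat^'d \<Rightarrow> complex) set)"
      unfolding H_flat_dual_def by (auto intro!: exI[of _ 0])
    moreover have "bargmann (0 :: nat^'d \<Rightarrow> complex) = 0"
      by (simp add: bargmann_eq_flat_series fun_eq_iff flat_series_def flat_term_def)
    ultimately show ?thesis using A_0 by (simp add: M_iff)
  qed
  show addM: "c + c' \<in> M" if "c \<in> M" "c' \<in> M" for c c'
    using that add[OF that] by (simp add: M_iff H_flat_dual_add A_add)
  then show "c + c' \<in> M" if "c \<in> M" "c' \<in> M" for c c' using that by simp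
  show "fun_scale a c \<in> M" if "c \<in> M" for a c
    using that scale[of a c] by (simp add: M_iff H_flat_dual_scale A_scale)
  show "(enn2real (M_norm \<Phi>1 \<Phi>2 \<omega> (c - c')) = 0) = (c = c')" if "c \<in> M" "c' \<in> M" for c c'
  proof -
    have "bargmann (c - c') = bargmann c - bargmann c'"
      using that by (intro bargmann_diff) (auto simp: M_iff)
    then have "(enn2real (M_norm \<Phi>1 \<Phi>2 \<omega> (c - c')) = 0) = (bargmann c = bargmann c')"
      using that A(2)[of "bargmann c" "bargmann c'"] by (simp add: M_norm_eq_nrm M_iff)
    also have "\<dots> \<longleftrightarrow> c = c'"
      using that bij_betw_bargmann by (auto simp: bij_betw_def inj_on_def)
    finally show ?thesis .
  qed
  show "enn2real (M_norm \<Phi>1 \<Phi>2 \<omega> (fun_scale a c)) = cmod a * enn2real (M_norm \<Phi>1 \<Phi>2 \<omega> c)" if "c \<in> M" for a c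
    using that B_scale(2)[of "bargmann c" a] by (simp add: M_norm_eq_nrm scale M_iff A_iff)
  show "enn2real (M_norm \<Phi>1 \<Phi>2 \<omega> (c + c')) \<le>
      qadd r (enn2real (M_norm \<Phi>1 \<Phi>2 \<omega> c)) (enn2real (M_norm \<Phi>1 \<Phi>2 \<omega> c'))" if "c \<in> M" "c' \<in> M" for c c'
    using that B_add(2)[of "bargmann c" "bargmann c'"] by (simp add: M_norm_eq_nrm add M_iff A_iff)
  fix s :: "nat \<Rightarrow> nat^'d \<Rightarrow> complex"
  assume s: "\<And>n. s n \<in> M"
    and cauchy: "\<And>e. 0 < e \<Longrightarrow> \<exists>k. \<forall>m\<ge>k. \<forall>n\<ge>k. enn2real (M_norm \<Phi>1 \<Phi>2 \<omega> (s m - s n)) < e"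
  have H: "s n \<in> H_flat_dual" for n using s by (simp add: M_iff)
  have "\<exists>f\<in>A. (\<lambda>n. nrm (bargmann (s n) - f)) \<longlonglongrightarrow> 0"
  proof (rule A_complete)
    show "bargmann (s n) \<in> A" for n using s by (simp add: M_iff)
    show "\<exists>k. \<forall>m\<ge>k. \<forall>n\<ge>k. nrm (bargmann (s m) - bargmann (s n)) < e" if "0 < e" for e
      using cauchy[OF that] by (simp add: M_norm_eq_nrm bargmann_diff[OF H H])
  qed
  then obtain f where f: "f \<in> A" "(\<lambda>n. nrm (bargmann (s n) - f)) \<longlonglongrightarrow> 0" by blast
  from f(1) have "f \<in> bargmann ` M"
    by (simp add: bij_betw_imp_surj_on[OF bij_betw_bargmann])
  then obtain c where c: "c \<in> M" "bargmann c = f" by auto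
  then have "(\<lambda>n. enn2real (M_norm \<Phi>1 \<Phi>2 \<omega> (s n - c))) \<longlonglongrightarrow> 0"
    using f(2) by (simp add: M_norm_eq_nrm bargmann_diff[OF H] M_iff)
  then show "\<exists>c\<in>M. (\<lambda>n. enn2real (M_norm \<Phi>1 \<Phi>2 \<omega> (s n - c))) \<longlonglongrightarrow> 0" using c(1) by blast
qed (auto intro: o1.r_pos o1.r_le_1)

end

theorem theorem2p1:
  fixes \<omega> :: "(real^'d) \<times> (real^'d) \<Rightarrow> real"
    and \<Phi>1 \<Phi>2 :: "real \<Rightarrow> ennreal"
    and r\<^sub>0 :: real
  assumes "weight \<omega>"
    and "0 < r\<^sub>0" and "r\<^sub>0 \<le> 1"
    and "quasi_young r\<^sub>0 \<Phi>1" and "quasi_young r\<^sub>0 \<Phi>2"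
  shows
    "(quasi_banach_space fun_scale (=) r\<^sub>0 (A_space \<Phi>1 \<Phi>2 \<omega>) (\<lambda>F. enn2real (B_norm \<Phi>1 \<Phi>2 \<omega> F)) \<and>
      quasi_banach_space fun_scale ae_eq r\<^sub>0 (B_space \<Phi>1 \<Phi>2 \<omega>) (\<lambda>F. enn2real (B_norm \<Phi>1 \<Phi>2 \<omega> F)) \<and>
      quasi_banach_space fun_scale (=) r\<^sub>0 (M_space \<Phi>1 \<Phi>2 \<omega>) (\<lambda>f. enn2real (M_norm \<Phi>1 \<Phi>2 \<omega> f))) \<and>
     ((\<forall>f\<in>M_space \<Phi>1 \<Phi>2 \<omega>. B_norm \<Phi>1 \<Phi>2 \<omega> (bargmann f) = M_norm \<Phi>1 \<Phi>2 \<omega> f) \<and>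
      bij_betw bargmann (M_space \<Phi>1 \<Phi>2 \<omega>) (A_space \<Phi>1 \<Phi>2 \<omega>))"
proof -
  interpret bargmann_setting r\<^sub>0 \<Phi>1 \<Phi>2 \<omega>
    by standard (use assms in auto)
  show ?thesis
    using A_quasi_banach B_quasi_banach M_quasi_banach bij_betw_bargmann by (simp add: M_norm_eq_nrm)
qed

end
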